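(* Let $k,m\geq 0$ be integers and let $F$ be a Jacobi form of weight $2k$ and index $m$. Define \[ \partial^{J}(F) = F' - \frac{2k}{12} E_2 F + \frac{1}{1 - 4m} \Big( F^{\bullet \bullet} - J_1 F^{\bullet} + m J_2 F - \frac{m}{6} E_2 F \Big). \] Then $\partial^J(F)$ (extended holomorphically across the points where $J_1$ has poles) is a Jacobi form of weight $2k+2$ and index $m$, so that $\partial^J$ is a linear map from Jacobi forms of weight $2k$ and index $m$ to Jacobi forms of weight $2k+2$ and index $m$. Moreover \[ (\partial^{J}F)(0, \tau) = \partial^{S}\big(F(0,\tau)\big), \] where for a function $g(\tau)$ regarded as of weight $2k$ the Serre derivative is $\partial^S g = g' - \frac{2k}{12}E_2 g$.
   Context: Let $\tau\in\mathbb{H}$, $z\in\mathbb{C}$, $q=e^{2\pi i\tau}$, $p=e^{2\pi i z}$. For a function $F(z,\tau)$ write $F'=\frac{1}{2\pi i}\frac{\partial F}{\partial \tau}$ and $F^{\bullet}=\frac{1}{2\pi i}\frac{\partial F}{\partial z}$ (iterated as $F^{\bullet\bullet}$ etc.). $E_2(\tau)=1-24\sum_{n\geq1}\sigma_1(n)q^n$ is the second Eisenstein series. The Bernoulli numbers $B_n$ are defined by $x/(e^x-1)=\sum_n B_n x^n/n!$ (so $B_1=-1/2$). For $n\geq 0$ the deformed Eisenstein series are \[ J_n(z,\tau) = \delta_{n,1} \frac{p}{p - 1} + B_n - n \sum_{k, r \geq 1} r^{n - 1} (p^k + (-1)^n p^{-k}) q^{k r}, \] meromorphic in $z$ (defined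 by this series where it converges and meromorphically continued). A Jacobi form of weight $k$ and index $m$ (in the sense of Eichler–Zagier) is a holomorphic $F:\mathbb{C}\times\mathbb{H}\to\mathbb{C}$ with $F\big(\frac{z}{c\tau+d},\frac{a\tau+b}{c\tau+d}\big)=(c\tau+d)^k e^{2\pi i m c z^2/(c\tau+d)}F(z,\tau)$ for all $\begin{pmatrix}a&b\\c&d\end{pmatrix}\in SL_2(\mathbb{Z})$, $F(z+\lambda\tau+\mu,\tau)=e^{-2\pi i m(\lambda^2\tau+2\lambda z)}F(z,\tau)$ for all $\lambda,\mu\in\mathbb{Z}$, and a Fourier expansion $F=\sum_{n\geq0}\sum_{r\in\mathbb{Z},\,r^2\leq 4nm}c(n,r)q^np^r$. *)

theory Defs
  imports "HOL-Complex_Analysis.Complex_Analysis"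
begin

abbreviation upper_half_plane :: "complex set" where
  "upper_half_plane \<equiv> {\<tau>. Im \<tau> > 0}"

definition ee :: "complex \<Rightarrow> complex" where
  "ee x = exp (2 * of_real pi * \<i> * x)"

definition dtau :: "(complex \<Rightarrow> complex \<Rightarrow> complex) \<Rightarrow> complex \<Rightarrow> complex \<Rightarrow> complex" where
  "dtau F z \<tau> = 1 / (2 * of_real pi * \<i>) * deriv (\<lambda>t. F z t) \<tau>"

definition dz :: "(complex \<Rightarrow> complex \<Rightarrow> complex) \<Rightarrow> complex \<Rightarrow> complex \<Rightarrow> complex" where
  "dz F z \<tau> = 1 / (2 * of_real pi * \<i>) * deriv (\<lambda>w. F w \<tau>) z"

definition sigma1 :: "nat \<Rightarrow> nat" where
  "sigma1 n = (\<Sum>d | d dvd n. d)"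

definition E2 :: "complex \<Rightarrow> complex" where
  "E2 \<tau> = 1 - 24 * (\<Sum>\<^sub>\<infinity>n\<in>{1..}. of_nat (sigma1 n) * ee \<tau> ^ n)"

definition bernoulli_number :: "nat \<Rightarrow> complex" where
  "bernoulli_number n = fact n * fps_nth (fps_X / (fps_exp 1 - 1)) n"

definition J_series :: "nat \<Rightarrow> complex \<Rightarrow> complex \<Rightarrow> complex" where
  "J_series n z \<tau> =
     (if n = 1 then ee z / (ee z - 1) else 0) + bernoulli_number n
     - of_nat n * (\<Sum>\<^sub>\<infinity>(k, r)\<in>{1::nat..} \<times> {1::nat..}.
         of_nat r powi (int n - 1) * (ee z ^ k + (- 1) ^ n * inverse (ee z) ^ k) * ee \<tau> ^ (k * r))"

text \<open>
  For \<open>n > 0\<close> the double series converges exactly for \<open>|q| < |p| < 1/|q|\<close>, that is, for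
  \<open>|Im z| < Im \<tau>\<close>. \<open>J n z \<tau>\<close> is the meromorphic continuation in \<open>z\<close> to the whole plane. Requiring
  the continuation to be nicely meromorphic (no removable singularities, value 0 at poles) makes
  it unique as a total function. The integers are excluded for \<open>n = 1\<close> because \<open>p/(p - 1)\<close> has
  its poles there.
\<close>
definition J :: "nat \<Rightarrow> complex \<Rightarrow> complex \<Rightarrow> complex" where
  "J n z \<tau> = (THE f. f nicely_meromorphic_on UNIV \<and>
     (\<forall>w. \<bar>Im w\<bar> < Im \<tau> \<longrightarrow> (n = 1 \<longrightarrow> w \<notin> \<int>) \<longrightarrow> f w = J_series n w \<tau>)) z"

text \<open>
  Holomorphy in two complex variables on an open set: total differentiability with a
  complex-linear derivative.
\<close>
definition holomorphic2_on ::
  "(complex \<Rightarrow> complex \<Rightarrow> complex) \<Rightarrow> (complex \<times> complex) set \<Rightarrow> bool" where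
  "holomorphic2_on F S \<longleftrightarrow>
     (\<forall>x\<in>S. \<exists>a b. ((\<lambda>(z, \<tau>). F z \<tau>) has_derivative (\<lambda>(u, v). a * u + b * v)) (at x))"

text \<open>
  Functions on \<open>\<complex> \<times> \<H>\<close> are total functions whose values for \<open>\<tau> \<notin> \<H>\<close> are irrelevant.
\<close>
definition jacobi_form :: "nat \<Rightarrow> nat \<Rightarrow> (complex \<Rightarrow> complex \<Rightarrow> complex) \<Rightarrow> bool" where
  "jacobi_form w m F \<longleftrightarrow>
     holomorphic2_on F (UNIV \<times> upper_half_plane) \<and>
     (\<forall>a b c d :: int. a * d - b * c = 1 \<longrightarrow> (\<forall>z. \<forall>\<tau>\<in>upper_half_plane.
        F (z / (of_int c * \<tau> + of_int d))
          ((of_int a * \<tau> + of_int b) / (of_int c * \<tau> + of_int d)) =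
        (of_int c * \<tau> + of_int d) ^ w
          * ee (of_nat m * of_int c * z ^ 2 / (of_int c * \<tau> + of_int d)) * F z \<tau>)) \<and>
     (\<forall>l u :: int. \<forall>z. \<forall>\<tau>\<in>upper_half_plane.
        F (z + of_int l * \<tau> + of_int u) \<tau> =
        ee (- of_nat m * (of_int l ^ 2 * \<tau> + 2 * of_int l * z)) * F z \<tau>) \<and>
     (\<exists>coef :: nat \<Rightarrow> int \<Rightarrow> complex. \<forall>z. \<forall>\<tau>\<in>upper_half_plane.
        ((\<lambda>(n, r). coef n r * ee \<tau> ^ n * ee z powi r) has_sum F z \<tau>)
          {(n, r). r ^ 2 \<le> 4 * int n * int m})"

definition serre_deriv :: "nat \<Rightarrow> (complex \<Rightarrow> complex) \<Rightarrow> complex \<Rightarrow> complex" where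
  "serre_deriv w g \<tau> =
     1 / (2 * of_real pi * \<i>) * deriv g \<tau> - of_nat w / 12 * E2 \<tau> * g \<tau>"

definition jacobi_serre_formula ::
  "nat \<Rightarrow> nat \<Rightarrow> (complex \<Rightarrow> complex \<Rightarrow> complex) \<Rightarrow> complex \<Rightarrow> complex \<Rightarrow> complex" where
  "jacobi_serre_formula w m F z \<tau> =
     dtau F z \<tau> - of_nat w / 12 * E2 \<tau> * F z \<tau>
     + 1 / (1 - 4 * of_nat m) *
         (dz (dz F) z \<tau> - J 1 z \<tau> * dz F z \<tau> + of_nat m * J 2 z \<tau> * F z \<tau>
          - of_nat m / 6 * E2 \<tau> * F z \<tau>)"

text \<open>
  At the poles of \<open>J 1\<close> (which include those of \<open>J 2\<close>) the formula is replaced by its limit in \<open>z\<close>,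
  the only value compatible with a holomorphic extension.
\<close>
definition jacobi_serre_deriv ::
  "nat \<Rightarrow> nat \<Rightarrow> (complex \<Rightarrow> complex \<Rightarrow> complex) \<Rightarrow> complex \<Rightarrow> complex \<Rightarrow> complex" where
  "jacobi_serre_deriv w m F z \<tau> =
     (if is_pole (\<lambda>x. J 1 x \<tau>) z
      then Lim (at z) (\<lambda>x. jacobi_serre_formula w m F x \<tau>)
      else jacobi_serre_formula w m F z \<tau>)"

end

theory Submission imports Defs begin

text \<open>
  Write \<open>A = J\<^sub>1\<close>, which has simple poles exactly on the lattice and satisfies \<open>A(z + \<tau>) = A(z) - 1\<close>.
  Liouville's theorem on the torus gives the modular law
  \<open>A(z/(c\<tau>+d), \<gamma>\<tau>) = (c\<tau>+d) A(z, \<tau>) + c z\<close> and the identity \<open>J\<^sub>2 = A\<^sup>\<bullet> + A\<^sup>2 - E\<^sub>2/12\<close>; comparing the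
  linear Laurent coefficients of \<open>A\<close> at \<open>0\<close>, which are multiples of \<open>E\<^sub>2\<close>, gives the modular law of \<open>E\<^sub>2\<close>.
  With these the two transformation laws of \<open>\<partial>\<^sup>J F\<close> off the lattice are polynomial identities. At \<open>z = 0\<close>
  the pole of \<open>A\<close> cancels because \<open>F\<close> is even, and the elliptic law transports this to the other lattice
  points. For the Fourier expansion, products of absolutely convergent series expand \<open>\<partial>\<^sup>J F\<close> in the
  strip \<open>0 < Im z < Im \<tau>\<close>, with coefficients supported where \<open>n + r x + m x\<^sup>2 \<ge> 0\<close> for all \<open>x \<in> [0, 1]\<close>.
  As \<open>\<partial>\<^sup>J F\<close> is entire in \<open>z\<close>, the elliptic law makes the coefficients invariant under
  \<open>(n, r) \<mapsto> (n + l r + m l\<^sup>2, r + 2 l m)\<close>, so the inequality holds for all real \<open>x\<close>, that is,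
  \<open>r\<^sup>2 \<le> 4 n m\<close>, and the expansion is valid everywhere.
\<close>

section \<open>Double Fourier series\<close>

text \<open>The constants in the formula are forced. Under a translation or a matrix, the
  \<tau>-derivative of \<open>F\<close> acquires multiples of \<open>dz F\<close> and of
  \<open>F\<close>, because the first argument moves with \<tau>; the z-part acquires the same terms
  with opposite sign and factor \<open>1 - 4 * m\<close>, whence the denominator. With
  \<open>m / 6\<close>, the \<open>E2 / 12\<close> inside \<open>J_2\<close> grows to
  \<open>E2 / 4\<close>, and this quarter of the defect of \<open>E_2\<close> (three units, when
  \<open>E_2\<close> has twelve) matches two units from the second z-derivative and one from the
  derivative of \<open>A\<close>. The support condition is about growth: for
  \<open>x = Im z / Im \<tau>\<close>, the term \<open>q^n p^r\<close> decays at the rate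
  \<open>n + r x\<close>. The interval \<open>[0, 1]\<close> is the strip, and the summand
  \<open>m x^2\<close> turns the translation of \<open>z\<close> by \<open>l * \<tau>\<close> into
  the translation of \<open>x\<close> by \<open>l\<close>. An obstacle is joint holomorphy:
  \<open>J\<close> is specified for each \<tau> separately, and the values at lattice points are
  limits in \<open>z\<close>. Holomorphy in both variables is therefore obtained last, from the
  Fourier series valid everywhere.\<close>

lemma ee_add: "ee (x + y) = ee x * ee y"
  by (simp add: ee_def exp_add ring_distribs)

lemma ee_0 [simp]: "ee 0 = 1"
  by (simp add: ee_def)

lemma ee_nonzero [simp]: "ee x \<noteq> 0"
  by (simp add: ee_def)

lemma ee_minus: "ee (- x) = inverse (ee x)"
  by (simp add: ee_def exp_minus)

lemma ee_eq_1_iff: "ee x = 1 \<longleftrightarrow> x \<in> \<int>"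
proof
  assume "ee x = 1"
  then obtain n :: int where n: "Re (2 * of_real pi * \<i> * x) = 0"
      "Im (2 * of_real pi * \<i> * x) = of_int (2 * n) * pi"
    unfolding ee_def exp_eq_1 by auto
  then have "Im x = 0" "Re x = of_int n" by auto
  then have "x = of_int n" by (simp add: complex_eq_iff)
  then show "x \<in> \<int>" by auto
next
  assume "x \<in> \<int>"
  then obtain n :: int where "x = of_int n" by (auto elim: Ints_cases)
  then show "ee x = 1" unfolding ee_def exp_eq_1 by (auto intro!: exI[of _ n])
qed

lemma ee_of_int [simp]: "ee (of_int n) = 1"
  by (simp add: ee_eq_1_iff)

lemma norm_ee: "norm (ee x) = exp (- (2 * pi * Im x))"
  by (simp add: ee_def)

lemma ee_power: "ee x ^ n = ee (of_nat n * x)"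
  by (simp add: ee_def exp_of_nat_mult[symmetric] mult_ac)

lemma ee_powi: "ee x powi n = ee (of_int n * x)"
proof (cases "n \<ge> 0")
  case True
  then show ?thesis by (simp add: power_int_def ee_power)
next
  case False
  then have "ee x powi n = inverse (ee (of_nat (nat (- n)) * x))"
    by (simp add: power_int_def ee_power power_inverse)
  also have "\<dots> = ee (of_int n * x)"
    using False by (simp flip: ee_minus)
  finally show ?thesis .
qed

lemma ee_has_field_derivative [derivative_intros]:
  assumes "(g has_field_derivative g') (at x within S)"
  shows "((\<lambda>x. ee (g x)) has_field_derivative 2 * of_real pi * \<i> * g' * ee (g x)) (at x within S)"
  unfolding ee_def by (rule derivative_eq_intros assms refl)+ simp

lemma holomorphic_on_ee [holomorphic_intros]:
  "f holomorphic_on S \<Longrightarrow> (\<lambda>x. ee (f x)) holomorphic_on S"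
  unfolding ee_def by (intro holomorphic_intros)

lemma analytic_on_ee [analytic_intros]:
  "f analytic_on S \<Longrightarrow> (\<lambda>x. ee (f x)) analytic_on S"
  unfolding ee_def by (intro analytic_intros)

lemma continuous_on_ee [continuous_intros]:
  "continuous_on S f \<Longrightarrow> continuous_on S (\<lambda>x. ee (f x))"
  unfolding ee_def by (intro continuous_intros)

lemma tendsto_ee [tendsto_intros]:
  "(f \<longlongrightarrow> l) F \<Longrightarrow> ((\<lambda>x. ee (f x)) \<longlongrightarrow> ee l) F"
  unfolding ee_def by (intro tendsto_intros)

text \<open>The norm is monotone in \<open>Im w\<close>, in a direction that depends on the sign of
  \<open>n\<close>. Adding the values at both ends covers both signs and yields uniform majorants
  for Fourier series.\<close>

lemma norm_ee_le_ends:
  assumes "\<bar>Im w - Im w0\<bar> \<le> r"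
  shows "norm (ee (of_int n * w)) \<le> norm (ee (of_int n * (w0 + \<i> * of_real r)))
    + norm (ee (of_int n * (w0 - \<i> * of_real r)))"
proof (cases "n \<ge> 0")
  case True
  have "real_of_int n * Im w \<ge> real_of_int n * (Im w0 - r)"
    using assms True by (intro mult_left_mono) auto
  then have "norm (ee (of_int n * w)) \<le> norm (ee (of_int n * (w0 - \<i> * of_real r)))"
    by (simp add: norm_ee)
  then show ?thesis by (smt (verit) norm_ge_zero)
next
  case False
  have "real_of_int n * Im w \<ge> real_of_int n * (Im w0 + r)"
    using assms False by (intro mult_left_mono_neg) auto
  then have "norm (ee (of_int n * w)) \<le> norm (ee (of_int n * (w0 + \<i> * of_real r)))"
    by (simp add: norm_ee)
  then show ?thesis by (smt (verit) norm_ge_zero)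
qed

text \<open>Convergence at the highest and lowest points of a small disc already bounds all terms on
  the disc by a summable family. The convergence is then uniform along finite subsets, and termwise
  differentiation follows. The frequencies \<open>g\<close> may repeat, so a double series can be
  differentiated in one variable.\<close>

lemma fourier_series_deriv:
  fixes a :: "'i \<Rightarrow> complex" and g :: "'i \<Rightarrow> int"
  assumes S: "open S" "w0 \<in> S"
    and sum: "\<And>w. w \<in> S \<Longrightarrow> ((\<lambda>i. a i * ee (of_int (g i) * w)) has_sum f w) I"
  shows "f field_differentiable (at w0)"
    and "((\<lambda>i. of_int (g i) * a i * ee (of_int (g i) * w0)) has_sum
           1 / (2 * of_real pi * \<i>) * deriv f w0) I"
proof -
  obtain r where r: "r > 0" "cball w0 r \<subseteq> S"
    using S open_contains_cball by blast
  define M where "M i = norm (a i) * (norm (ee (of_int (g i) * (w0 + \<i> * of_real r)))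
    + norm (ee (of_int (g i) * (w0 - \<i> * of_real r))))" for i
  have "w0 + \<i> * of_real r \<in> S" "w0 - \<i> * of_real r \<in> S"
    using r by (auto simp: dist_norm norm_mult subset_iff)
  then have "(\<lambda>i. norm (a i * ee (of_int (g i) * (w0 + \<i> * of_real r)))
       + norm (a i * ee (of_int (g i) * (w0 - \<i> * of_real r)))) summable_on I"
    using sum by (intro summable_on_add)
      (auto simp flip: summable_on_iff_abs_summable_on_complex intro: has_sum_imp_summable)
  then have M: "M summable_on I"
    unfolding M_def by (simp add: norm_mult ring_distribs)
  have le: "norm (a i * ee (of_int (g i) * w)) \<le> M i" if "w \<in> cball w0 r" for i w
  proof -
    have "\<bar>Im w - Im w0\<bar> \<le> r"
      using that abs_Im_le_cmod[of "w - w0"] by (auto simp: dist_norm norm_minus_commute)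
    then show ?thesis unfolding M_def norm_mult
      by (intro mult_left_mono norm_ee_le_ends) auto
  qed
  have ulim: "uniform_limit (cball w0 r) (\<lambda>X y. \<Sum>i\<in>X. a i * ee (of_int (g i) * y)) f
      (finite_subsets_at_top I)"
    using le sum r by (intro Weierstrass_m_test_general'[OF _ _ M]) auto
  define f' where "f' X w = (\<Sum>i\<in>X. 2 * of_real pi * \<i> * of_int (g i) * ee (of_int (g i) * w) * a i)"
    for X w
  have der: "((\<lambda>y. \<Sum>i\<in>X. a i * ee (of_int (g i) * y)) has_field_derivative f' X w) (at w)" for X w
    unfolding f'_def by (intro DERIV_sum) (auto intro!: derivative_eq_intros)
  have "\<forall>\<^sub>F X in finite_subsets_at_top I. continuous_on (cball w0 r) (\<lambda>y. \<Sum>i\<in>X. a i * ee (of_int (g i) * y)) \<and>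
          (\<forall>w \<in> ball w0 r. ((\<lambda>y. \<Sum>i\<in>X. a i * ee (of_int (g i) * y)) has_field_derivative f' X w) (at w))"
    using der by (intro always_eventually) (auto intro!: continuous_intros)
  from has_complex_derivative_uniform_limit[OF this ulim finite_subsets_at_top_neq_bot r(1)]
  obtain g' where g': "\<And>w. w \<in> ball w0 r \<Longrightarrow>
      (f has_field_derivative g' w) (at w) \<and> ((\<lambda>X. f' X w) \<longlongrightarrow> g' w) (finite_subsets_at_top I)"
    by blast
  have w0: "w0 \<in> ball w0 r" using r by auto
  have 1: "(f has_field_derivative g' w0) (at w0)" and 2: "((\<lambda>X. f' X w0) \<longlongrightarrow> g' w0) (finite_subsets_at_top I)"
    using g'[OF w0] by auto
  show "f field_differentiable (at w0)" using 1 field_differentiable_def by blast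
  have "((\<lambda>i. 2 * of_real pi * \<i> * of_int (g i) * ee (of_int (g i) * w0) * a i) has_sum deriv f w0) I"
    using 2 DERIV_imp_deriv[OF 1] unfolding has_sum_def f'_def by simp
  then have "((\<lambda>i. 1 / (2 * of_real pi * \<i>) *
      (2 * of_real pi * \<i> * of_int (g i) * ee (of_int (g i) * w0) * a i)) has_sum
        1 / (2 * of_real pi * \<i>) * deriv f w0) I"
    by (rule has_sum_cmult_right)
  moreover have "(\<lambda>i. 1 / (2 * of_real pi * \<i>) *
      (2 * of_real pi * \<i> * of_int (g i) * ee (of_int (g i) * w0) * a i)) =
      (\<lambda>i. of_int (g i) * a i * ee (of_int (g i) * w0))"
    by (simp add: fun_eq_iff)
  ultimately show "((\<lambda>i. of_int (g i) * a i * ee (of_int (g i) * w0)) has_sum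
           1 / (2 * of_real pi * \<i>) * deriv f w0) I"
    by (simp only:)
qed

section \<open>Series in both variables\<close>

definition fourier_term :: "(int \<times> int \<Rightarrow> complex) \<Rightarrow> complex \<Rightarrow> complex \<Rightarrow> int \<times> int \<Rightarrow> complex" where
  "fourier_term c z \<tau> x = c x * ee (of_int (fst x) * \<tau> + of_int (snd x) * z)"

lemma fourier_dz:
  assumes "\<And>z. (fourier_term c z \<tau> has_sum F z \<tau>) UNIV"
  shows "(\<lambda>z. F z \<tau>) field_differentiable (at z)"
    and "(fourier_term (\<lambda>x. of_int (snd x) * c x) z \<tau> has_sum dz F z \<tau>) UNIV"
proof -
  have *: "((\<lambda>x. c x * ee (of_int (fst x) * \<tau>) * ee (of_int (snd x) * w)) has_sum F w \<tau>) UNIV"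
    if "w \<in> UNIV" for w
    using assms[of w] by (simp add: fourier_term_def[abs_def] ee_add mult.assoc)
  show "(\<lambda>z. F z \<tau>) field_differentiable (at z)"
    by (rule fourier_series_deriv(1)[OF open_UNIV _ *]) simp
  show "(fourier_term (\<lambda>x. of_int (snd x) * c x) z \<tau> has_sum dz F z \<tau>) UNIV"
    using fourier_series_deriv(2)[OF open_UNIV _ *, of z]
    by (simp add: fourier_term_def[abs_def] ee_add mult.assoc dz_def)
qed

lemma open_upper_half_plane: "open upper_half_plane"
  by (simp add: open_halfspace_Im_gt)

lemma fourier_dtau:
  assumes "\<And>\<tau>. Im \<tau> > 0 \<Longrightarrow> (fourier_term c z \<tau> has_sum F z \<tau>) UNIV" "Im \<tau> > 0"
  shows "(\<lambda>t. F z t) field_differentiable (at \<tau>)"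
    and "(fourier_term (\<lambda>x. of_int (fst x) * c x) z \<tau> has_sum dtau F z \<tau>) UNIV"
proof -
  have *: "((\<lambda>x. c x * ee (of_int (snd x) * z) * ee (of_int (fst x) * w)) has_sum F z w) UNIV"
    if "w \<in> upper_half_plane" for w
    using assms(1)[of w] that by (simp add: fourier_term_def[abs_def] ee_add mult_ac)
  show "(\<lambda>t. F z t) field_differentiable (at \<tau>)"
    using assms(2) by (intro fourier_series_deriv(1)[OF open_upper_half_plane _ *]) auto
  show "(fourier_term (\<lambda>x. of_int (fst x) * c x) z \<tau> has_sum dtau F z \<tau>) UNIV"
    using fourier_series_deriv(2)[OF open_upper_half_plane _ *, of \<tau>] assms(2)
    by (simp add: fourier_term_def[abs_def] ee_add mult_ac dtau_def)
qed

text \<open>Provides the joint continuity of the \<tau>-derivative on which total differentiability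
  rests below.\<close>

lemma fourier_continuous:
  assumes "\<And>z \<tau>. Im \<tau> > 0 \<Longrightarrow> (fourier_term c z \<tau> has_sum F z \<tau>) UNIV"
  shows "continuous_on (UNIV \<times> upper_half_plane) (\<lambda>(z, \<tau>). F z \<tau>)"
proof -
  have "continuous (at (z0, t0)) (\<lambda>(z, \<tau>). F z \<tau>)" if t0: "Im t0 > 0" for z0 t0
  proof -
    define r where "r = Im t0 / 2"
    have r: "r > 0" using t0 by (simp add: r_def)
    define M where "M x = norm (c x) *
      ((norm (ee (of_int (fst x) * (t0 + \<i> * of_real r))) + norm (ee (of_int (fst x) * (t0 - \<i> * of_real r)))) *
       (norm (ee (of_int (snd x) * (z0 + \<i> * of_real r))) + norm (ee (of_int (snd x) * (z0 - \<i> * of_real r)))))"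
      for x :: "int \<times> int"
    have summ: "(\<lambda>x. norm (fourier_term c z \<tau> x)) summable_on UNIV" if "Im \<tau> > 0" for z \<tau>
      using assms[OF that, of z]
      by (auto simp flip: summable_on_iff_abs_summable_on_complex intro: has_sum_imp_summable)
    \<comment> \<open>Multiplied out, the majorant is the sum of the norms of a term at four
      corners, \<open>z0\<close> and \<open>t0\<close> each moved up or down by \<open>r\<close>.
      The choice \<open>r = Im t0 / 2\<close> keeps the corners where the series converges.\<close>
    have "(\<lambda>x. norm (fourier_term c (z0 + \<i> * of_real r) (t0 + \<i> * of_real r) x)
             + norm (fourier_term c (z0 + \<i> * of_real r) (t0 - \<i> * of_real r) x)
             + (norm (fourier_term c (z0 - \<i> * of_real r) (t0 + \<i> * of_real r) x)
             + norm (fourier_term c (z0 - \<i> * of_real r) (t0 - \<i> * of_real r) x))) summable_on UNIV"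
      using t0 r by (intro summable_on_add summ) (auto simp: r_def)
    moreover have alg: "a * (p * u) + a * (q * u) + (a * (p * v) + a * (q * v)) = a * ((p + q) * (u + v))"
      for a p q u v :: real
      by (simp add: algebra_simps)
    ultimately have M: "M summable_on UNIV"
      unfolding M_def by (simp only: fourier_term_def ee_add norm_mult alg)
    define S where "S = {z. \<bar>Im z - Im z0\<bar> < r} \<times> {t. \<bar>Im t - Im t0\<bar> < r}"
    have op: "open {z. \<bar>Im z - Im z0\<bar> < r}" for z0
      by (intro open_Collect_less continuous_intros)
    have S: "open S" "(z0, t0) \<in> S" using r op unfolding S_def by (auto intro: open_Times)
    have le: "norm (fourier_term c (fst y) (snd y) x) \<le> M x" if "y \<in> S" for x y
      using that unfolding S_def M_def fourier_term_def ee_add norm_mult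
      by (intro mult_left_mono mult_mono norm_ee_le_ends) auto
    have "Im (snd y) > 0" if "y \<in> S" for y using that r by (auto simp: S_def r_def abs_if split: if_splits)
    then have "uniform_limit S (\<lambda>X y. \<Sum>x\<in>X. fourier_term c (fst y) (snd y) x) (\<lambda>y. F (fst y) (snd y))
      (finite_subsets_at_top UNIV)"
      using le assms by (intro Weierstrass_m_test_general'[OF _ _ M]) auto
    then have "continuous_on S (\<lambda>y. F (fst y) (snd y))"
      by (rule uniform_limit_theorem[rotated])
        (auto intro!: always_eventually continuous_intros simp: fourier_term_def)
    then show ?thesis using S by (simp add: continuous_on_eq_continuous_at case_prod_beta')
  qed
  then show ?thesis
    by (auto intro!: continuous_at_imp_continuous_on)
qed

text \<open>One partial derivative at the point and a second one that is continuous nearby suffice.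
  The \<tau>-derivative is continuous because it is again a double Fourier series.\<close>

lemma fourier_holomorphic2:
  assumes sum: "\<And>z \<tau>. Im \<tau> > 0 \<Longrightarrow> (fourier_term c z \<tau> has_sum F z \<tau>) UNIV"
  shows "holomorphic2_on F (UNIV \<times> upper_half_plane)"
  unfolding holomorphic2_on_def
proof safe
  fix z0 t0 assume t0: "Im t0 > 0"
  define r where "r = Im t0 / 2"
  have r: "r > 0" using t0 by (simp add: r_def)
  have ball: "Im t > 0" if "t \<in> ball t0 r" for t
    using that abs_Im_le_cmod[of "t - t0"] t0 by (auto simp: r_def dist_norm norm_minus_commute)
  have cont: "continuous_on (UNIV \<times> upper_half_plane) (\<lambda>(z, \<tau>). dtau F z \<tau>)"
    by (rule fourier_continuous[where c = "\<lambda>x. of_int (fst x) * c x"], rule fourier_dtau(2))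
      (simp_all add: sum)
  obtain a where a: "((\<lambda>z. F z t0) has_field_derivative a) (at z0)"
    using fourier_dz(1)[of c t0 F z0] sum[OF t0] unfolding field_differentiable_def by blast
  define b where "b z t = 2 * of_real pi * \<i> * dtau F z t" for z t
  have b: "((\<lambda>t. F z t) has_field_derivative b z t) (at t)" if "Im t > 0" for z t
    using fourier_dtau(1)[of c z F t] sum that by (simp add: b_def dtau_def DERIV_deriv_iff_field_differentiable)
  have cont': "continuous (at (z0, t0)) (\<lambda>(z, t). b z t)"
  proof -
    have "continuous_on (UNIV \<times> upper_half_plane) (\<lambda>x. 2 * of_real pi * \<i> * (\<lambda>(z, \<tau>). dtau F z \<tau>) x)"
      by (intro continuous_intros cont)
    moreover have "open ((UNIV :: complex set) \<times> upper_half_plane)"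
      by (intro open_Times open_UNIV open_upper_half_plane)
    ultimately show ?thesis using t0
      by (auto simp: continuous_on_eq_continuous_at b_def case_prod_beta')
  qed
  have "((\<lambda>(z, t). F z t) has_derivative (\<lambda>(u, v). (\<lambda>u. a * u) u + blinfun_mult_right (b z0 t0) v))
      (at (z0, t0) within UNIV \<times> ball t0 r)"
  proof (rule has_derivative_partialsI)
    show "((\<lambda>z. F z t0) has_derivative (\<lambda>u. a * u)) (at z0)"
      using a by (simp add: has_field_derivative_def)
    show "((\<lambda>t. F z t) has_derivative blinfun_apply (blinfun_mult_right (b z t))) (at t within ball t0 r)"
      if "t \<in> ball t0 r" for z t
      using b[OF ball[OF that], of z] by (auto simp: has_field_derivative_def intro: has_derivative_at_withinI)
    have "continuous (at (z0, t0)) (\<lambda>x. blinfun_mult_right ((\<lambda>(z, t). b z t) x))"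
      by (rule bounded_linear.continuous[OF bounded_linear_blinfun_mult_right cont'])
    then show "continuous (at (z0, t0) within UNIV \<times> ball t0 r) (\<lambda>(z, t). blinfun_mult_right (b z t))"
      by (simp add: case_prod_beta' continuous_at_imp_continuous_at_within)
  qed (use r in auto)
  then have "((\<lambda>(z, t). F z t) has_derivative (\<lambda>(u, v). a * u + b z0 t0 * v)) (at (z0, t0) within UNIV \<times> ball t0 r)"
    by simp
  moreover have "(at (z0, t0) within UNIV \<times> ball t0 r) = at (z0, t0)"
    using r by (intro at_within_open open_Times) auto
  ultimately show "\<exists>a b. ((\<lambda>(z, t). F z t) has_derivative (\<lambda>(u, v). a * u + b * v)) (at (z0, t0))"
    by (intro exI[of _ a] exI[of _ "b z0 t0"]) simp
qed

section \<open>Expansions in a strip\<close>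

lemma convex_strip: "convex {w. y1 < Im w \<and> Im w < y2}"
proof -
  have "{w. y1 < Im w \<and> Im w < y2} = {w. Im w > y1} \<inter> {w. Im w < y2}" by auto
  then show ?thesis by (simp add: convex_Int convex_halfspace_Im_gt convex_halfspace_Im_lt)
qed

lemma open_strip: "open {w. y1 < Im w \<and> Im w < y2}"
  by (intro open_Collect_conj open_Collect_less continuous_intros)

text \<open>The \<open>k\<close>-th Fourier coefficient of an entire 1-periodic \<open>h\<close> is the increment over a period of a
  primitive of \<open>h(z) ee(- k z)\<close>, so it is the same for every strip in which \<open>h\<close> is expanded.\<close>
lemma fourier_coefficient_eq_increment:
  fixes a :: "'i \<Rightarrow> complex" and g :: "'i \<Rightarrow> int"
  assumes prim: "\<And>z. (H has_field_derivative h z * ee (- of_int k * z)) (at z)"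
    and per: "\<And>z. h (z + 1) = h z"
    and "y1 < y2"
    and sum: "\<And>w. y1 < Im w \<Longrightarrow> Im w < y2 \<Longrightarrow> ((\<lambda>i. a i * ee (of_int (g i) * w)) has_sum h w) I"
  shows "(a has_sum H 1 - H 0) {i\<in>I. g i = k}"
proof -
  define S where "S = {w. y1 < Im w \<and> Im w < y2}"
  define J where "J = {i\<in>I. g i = k}"
  define w0 where "w0 = \<i> * of_real ((y1 + y2) / 2)"
  have w0: "w0 \<in> S" using \<open>y1 < y2\<close> by (simp add: S_def w0_def)
  have ee1: "ee (- of_int k * (z + 1)) = ee (- of_int k * z)" for z
  proof -
    have "- of_int k * (z + 1) = - of_int k * z + of_int (- k)" by (simp add: ring_distribs)
    then show ?thesis by (simp only: ee_add ee_of_int mult_1_right)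
  qed
  have sum': "((\<lambda>i. a i * ee (of_int (g i - k) * w)) has_sum h w * ee (- of_int k * w)) I" if "w \<in> S" for w
  proof -
    have "((\<lambda>i. a i * ee (of_int (g i) * w) * ee (- of_int k * w)) has_sum h w * ee (- of_int k * w)) I"
      using that by (intro has_sum_cmult_left sum) (auto simp: S_def)
    moreover have "a i * ee (of_int (g i) * w) * ee (- of_int k * w) = a i * ee (of_int (g i - k) * w)" for i
      by (simp add: mult.assoc ring_distribs flip: ee_add)
    ultimately show ?thesis by (simp only:)
  qed
  have "(\<lambda>i. a i * ee (of_int (g i - k) * w0)) summable_on J"
    using has_sum_imp_summable[OF sum'[OF w0]] by (rule summable_on_subset_banach) (auto simp: J_def)
  then have "a summable_on J"
    by (rule summable_on_cong[THEN iffD1, rotated]) (simp add: J_def)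
  then have A: "(a has_sum infsum a J) J" by simp
  \<comment> \<open>\<open>K\<close> integrates the terms one by one, up to the factor
    \<open>2 * pi * \<i>\<close>. Terms of frequency \<open>k\<close> have become constant and
    integrate to the linear function \<open>w * infsum a J\<close>; they are left out of
    \<open>K\<close>, so that \<open>K\<close> is periodic.\<close>
  define b where "b i = (if g i = k then 0 else a i / of_int (g i - k))" for i
  define K where "K w = (\<Sum>\<^sub>\<infinity>i\<in>I. b i * ee (of_int (g i - k) * w))" for w
  have K: "((\<lambda>i. b i * ee (of_int (g i - k) * w)) has_sum K w) I" if "w \<in> S" for w
  proof -
    have "(\<lambda>i. norm (a i * ee (of_int (g i - k) * w))) summable_on I"
      using has_sum_imp_summable[OF sum'[OF that]] by (simp flip: summable_on_iff_abs_summable_on_complex)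
    then have "(\<lambda>i. norm (b i * ee (of_int (g i - k) * w))) summable_on I"
    proof (rule Infinite_Sum.abs_summable_on_comparison_test')
      fix i
      have "norm (b i) \<le> norm (a i)"
      proof (cases "g i = k")
        case False
        then have "1 \<le> \<bar>g i - k\<bar>" by auto
        then have "1 \<le> norm (of_int (g i - k) :: complex)"
          by (metis norm_of_int of_int_1_le_iff of_int_abs)
        then show ?thesis
          using False by (simp add: b_def norm_divide divide_le_eq mult_le_cancel_left1 del: of_int_diff)
      qed (simp add: b_def)
      then show "norm (b i * ee (of_int (g i - k) * w)) \<le> norm (a i * ee (of_int (g i - k) * w))"
        by (simp add: norm_mult mult_right_mono)
    qed
    then show ?thesis unfolding K_def
      by (intro has_sum_infsum) (simp flip: summable_on_iff_abs_summable_on_complex)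
  qed
  have dK: "(K has_field_derivative 2 * of_real pi * \<i> * (h w * ee (- of_int k * w) - infsum a J)) (at w)"
    if w: "w \<in> S" for w
  proof -
    have "open S" by (simp add: S_def open_strip)
    note fs = fourier_series_deriv[OF this w K]
    have "((\<lambda>i. a i * ee (of_int (g i - k) * w)) has_sum infsum a J) J"
      using A by (rule has_sum_cong[THEN iffD1, rotated]) (simp add: J_def)
    then have "((\<lambda>i. a i * ee (of_int (g i - k) * w)) has_sum h w * ee (- of_int k * w) - infsum a J) (I - J)"
      by (intro has_sum_Diff sum'[OF w]) (auto simp: J_def)
    moreover have "((\<lambda>i. a i * ee (of_int (g i - k) * w)) has_sum h w * ee (- of_int k * w) - infsum a J) (I - J) \<longleftrightarrow>
       ((\<lambda>i. of_int (g i - k) * b i * ee (of_int (g i - k) * w)) has_sum h w * ee (- of_int k * w) - infsum a J) I"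
      by (rule has_sum_cong_neutral) (auto simp: J_def b_def)
    ultimately have "h w * ee (- of_int k * w) - infsum a J = 1 / (2 * of_real pi * \<i>) * deriv K w"
      using fs(2) has_sum_unique by blast
    then have "deriv K w = 2 * of_real pi * \<i> * (h w * ee (- of_int k * w) - infsum a J)" by simp
    then show ?thesis using fs(1) by (simp flip: DERIV_deriv_iff_field_differentiable)
  qed
  have per_K: "K (w + 1) = K w" for w
  proof -
    have "ee (of_int (g i - k) * (w + 1)) = ee (of_int (g i - k) * w)" for i
      using ee_add[of "of_int (g i - k) * w" "of_int (g i - k)"] by (simp add: ring_distribs del: of_int_diff)
    then show ?thesis by (simp add: K_def)
  qed
  \<comment> \<open>As \<open>D\<close> is constant on the strip and \<open>K\<close> is periodic,
    the increment of \<open>H\<close> over a period is that of the linear term.\<close>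
  define D where "D w = H w - (w * infsum a J + 1 / (2 * of_real pi * \<i>) * K w)" for w
  have "(D has_field_derivative 0) (at w within S)" if "w \<in> S" for w
    unfolding D_def
    by (rule derivative_eq_intros DERIV_subset[OF prim] DERIV_subset[OF dK[OF that]] refl | simp)+
  then obtain d where d: "\<And>w. w \<in> S \<Longrightarrow> D w = d"
    using has_field_derivative_zero_constant[of S D] convex_strip unfolding S_def by metis
  have "w0 + 1 \<in> S" using w0 by (simp add: S_def)
  then have "D (w0 + 1) = D w0" using d w0 by simp
  then have H0: "H (w0 + 1) - H w0 = infsum a J"
    by (simp only: D_def per_K) (simp add: algebra_simps)
  \<comment> \<open>The integrand is periodic, so the increment is the same from every starting
    point and can be moved out of the strip to \<open>0\<close>.\<close>
  have "((\<lambda>z. H (z + 1) - H z) has_field_derivative 0) (at z within UNIV)" for z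
  proof -
    have "((\<lambda>z. H (z + 1)) has_field_derivative h (z + 1) * ee (- of_int k * (z + 1)) * 1) (at z)"
      by (rule DERIV_chain2[OF prim]) (rule derivative_eq_intros refl | simp)+
    from DERIV_diff[OF this prim[of z]] show ?thesis by (simp only: per ee1 mult_1_right diff_self)
  qed
  then have "H (0 + 1) - H 0 = H (w0 + 1) - H w0"
    using has_field_derivative_zero_constant[of UNIV "\<lambda>z. H (z + 1) - H z"] by (metis UNIV_I convex_UNIV)
  then show ?thesis using A H0 by (simp add: J_def)
qed

text \<open>The increment \<open>H 1 - H 0\<close> of an entire primitive refers to neither strip.
  The strips may be disjoint, which is how the elliptic law is exploited later.\<close>

lemma fourier_coefficients_unique:
  fixes a :: "'i \<Rightarrow> complex" and g :: "'i \<Rightarrow> int" and a' :: "'j \<Rightarrow> complex" and g' :: "'j \<Rightarrow> int"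
  assumes h: "h holomorphic_on UNIV" and per: "\<And>z. h (z + 1) = h z"
    and y: "y1 < y2"
    and sum: "\<And>w. y1 < Im w \<Longrightarrow> Im w < y2 \<Longrightarrow> ((\<lambda>i. a i * ee (of_int (g i) * w)) has_sum h w) I"
    and y': "y1' < y2'"
    and sum': "\<And>w. y1' < Im w \<Longrightarrow> Im w < y2' \<Longrightarrow> ((\<lambda>i. a' i * ee (of_int (g' i) * w)) has_sum h w) I'"
  shows "\<exists>x. (a has_sum x) {i\<in>I. g i = k} \<and> (a' has_sum x) {i\<in>I'. g' i = k}"
proof -
  have "(\<lambda>z. h z * ee (- of_int k * z)) holomorphic_on UNIV"
    by (intro holomorphic_intros h)
  then obtain H where H: "\<And>z. (H has_field_derivative h z * ee (- of_int k * z)) (at z)"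
    using holomorphic_convex_primitive'[of UNIV "\<lambda>z. h z * ee (- of_int k * z)"] by auto
  show ?thesis
    using fourier_coefficient_eq_increment[OF H per y sum]
      fourier_coefficient_eq_increment[OF H per y' sum'] by blast
qed

text \<open>The condition on the support is what remains of \<open>r\<^sup>2 \<le> 4 n \<mu>\<close> after multiplication by the expansions
  of \<open>J\<^sub>1\<close> and \<open>J\<^sub>2\<close> in the strip. It is stable under products, with the indices \<open>\<mu>\<close> adding up.\<close>
definition expands :: "real \<Rightarrow> (complex \<Rightarrow> complex \<Rightarrow> complex) \<Rightarrow> bool" where
  "expands \<mu> f \<longleftrightarrow> (\<exists>c. (\<forall>n r. c (n, r) \<noteq> 0 \<longrightarrow> (\<forall>x\<in>{0..1}. 0 \<le> of_int n + of_int r * x + \<mu> * x\<^sup>2)) \<and>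
     (\<forall>z \<tau>. 0 < Im z \<longrightarrow> Im z < Im \<tau> \<longrightarrow> (fourier_term c z \<tau> has_sum f z \<tau>) UNIV))"

text \<open>Admits series with repeated exponents: the coefficient at \<open>(n, r)\<close> is the
  sum over a fibre of \<open>g\<close>, and it can be nonzero only if some member of the fibre
  is.\<close>

lemma expands_family:
  fixes a :: "'i \<Rightarrow> complex" and g :: "'i \<Rightarrow> int \<times> int"
  assumes supp: "\<And>i x. i \<in> I \<Longrightarrow> a i \<noteq> 0 \<Longrightarrow> 0 \<le> x \<Longrightarrow> x \<le> 1 \<Longrightarrow>
      0 \<le> of_int (fst (g i)) + of_int (snd (g i)) * x + \<mu> * x\<^sup>2"
    and sum: "\<And>z \<tau>. 0 < Im z \<Longrightarrow> Im z < Im \<tau> \<Longrightarrow>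
      ((\<lambda>i. a i * ee (of_int (fst (g i)) * \<tau> + of_int (snd (g i)) * z)) has_sum f z \<tau>) I"
  shows "expands \<mu> f"
  unfolding expands_def
proof (intro exI[of _ "\<lambda>s. infsum a {i\<in>I. g i = s}"] conjI allI impI ballI)
  fix n r :: int and x :: real
  assume nz: "infsum a {i \<in> I. g i = (n, r)} \<noteq> 0" and x: "x \<in> {0..1}"
  obtain i where "i \<in> I" "g i = (n, r)" "a i \<noteq> 0"
  proof (rule ccontr)
    assume "\<not> thesis"
    then have "infsum a {i \<in> I. g i = (n, r)} = 0"
      using that by (intro infsum_0) auto
    then show False using nz by simp
  qed
  then show "0 \<le> of_int n + of_int r * x + \<mu> * x\<^sup>2" using supp[of i x] x by auto
next
  fix z \<tau> assume z: "0 < Im z" "Im z < Im \<tau>"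
  let ?e = "\<lambda>s :: int \<times> int. ee (of_int (fst s) * \<tau> + of_int (snd s) * z)"
  have "((\<lambda>i. a i * ?e (g i)) has_sum f z \<tau>) I" by (rule sum[OF z])
  then have S: "((\<lambda>(s, i). a i * ?e s) has_sum f z \<tau>) (Sigma UNIV (\<lambda>s. {i\<in>I. g i = s}))"
    by (rule has_sum_reindex_bij_witness[where i = snd and j = "\<lambda>i. (g i, i)", THEN iffD1, rotated -1]) auto
  show "(fourier_term (\<lambda>s. infsum a {i \<in> I. g i = s}) z \<tau> has_sum f z \<tau>) UNIV"
  proof (rule has_sum_SigmaD[OF S])
    fix s :: "int \<times> int"
    have "(\<lambda>(s, i). a i * ?e s) summable_on (Sigma UNIV (\<lambda>s. {i\<in>I. g i = s}))"
      using S by (rule has_sum_imp_summable)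
    then have "(\<lambda>i. a i * ?e s) summable_on {i\<in>I. g i = s}"
      by (rule summable_on_SigmaD1) simp
    then have "((\<lambda>i. a i * ?e s) has_sum (\<Sum>\<^sub>\<infinity>i\<in>{i\<in>I. g i = s}. a i * ?e s)) {i\<in>I. g i = s}"
      by simp
    then show "((\<lambda>i. case (s, i) of (s, i) \<Rightarrow> a i * ?e s) has_sum fourier_term (\<lambda>s. infsum a {i \<in> I. g i = s}) z \<tau> s) {i \<in> I. g i = s}"
      by (simp add: fourier_term_def infsum_cmult_left')
  qed
qed

lemma expands_cong:
  assumes "expands \<mu> f" "\<And>z \<tau>. 0 < Im z \<Longrightarrow> Im z < Im \<tau> \<Longrightarrow> f z \<tau> = g z \<tau>"
  shows "expands \<mu> g"
  using assms unfolding expands_def by metis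

lemma expands_add:
  assumes "expands \<mu> f" "expands \<mu> g"
  shows "expands \<mu> (\<lambda>z \<tau>. f z \<tau> + g z \<tau>)"
proof -
  obtain c where c: "\<And>n r x. c (n, r) \<noteq> 0 \<Longrightarrow> x \<in> {0..1} \<Longrightarrow> 0 \<le> of_int n + of_int r * x + \<mu> * x\<^sup>2"
    "\<And>z \<tau>. 0 < Im z \<Longrightarrow> Im z < Im \<tau> \<Longrightarrow> (fourier_term c z \<tau> has_sum f z \<tau>) UNIV"
    using assms(1) unfolding expands_def by blast
  obtain d where d: "\<And>n r x. d (n, r) \<noteq> 0 \<Longrightarrow> x \<in> {0..1} \<Longrightarrow> 0 \<le> of_int n + of_int r * x + \<mu> * x\<^sup>2"
    "\<And>z \<tau>. 0 < Im z \<Longrightarrow> Im z < Im \<tau> \<Longrightarrow> (fourier_term d z \<tau> has_sum g z \<tau>) UNIV"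
    using assms(2) unfolding expands_def by blast
  show ?thesis unfolding expands_def
  proof (intro exI[of _ "\<lambda>s. c s + d s"] conjI allI impI ballI)
    fix n r :: int and x :: real
    assume "c (n, r) + d (n, r) \<noteq> 0" "x \<in> {0..1}"
    then show "0 \<le> of_int n + of_int r * x + \<mu> * x\<^sup>2" using c(1)[of n r x] d(1)[of n r x] by force
  next
    fix z \<tau> assume "0 < Im z" "Im z < Im \<tau>"
    from has_sum_add[OF c(2)[OF this] d(2)[OF this]]
    show "(fourier_term (\<lambda>s. c s + d s) z \<tau> has_sum f z \<tau> + g z \<tau>) UNIV"
      by (simp add: fourier_term_def[abs_def] ring_distribs)
  qed
qed

lemma expands_cmult:
  assumes "expands \<mu> f"
  shows "expands \<mu> (\<lambda>z \<tau>. b * f z \<tau>)"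
proof -
  obtain c where c: "\<And>n r x. c (n, r) \<noteq> 0 \<Longrightarrow> x \<in> {0..1} \<Longrightarrow> 0 \<le> of_int n + of_int r * x + \<mu> * x\<^sup>2"
    "\<And>z \<tau>. 0 < Im z \<Longrightarrow> Im z < Im \<tau> \<Longrightarrow> (fourier_term c z \<tau> has_sum f z \<tau>) UNIV"
    using assms(1) unfolding expands_def by blast
  have "(fourier_term (\<lambda>s. b * c s) z \<tau> has_sum b * f z \<tau>) UNIV" if "0 < Im z" "Im z < Im \<tau>" for z \<tau>
    using has_sum_cmult_right[OF c(2)[OF that], of b] by (simp add: fourier_term_def[abs_def] mult.assoc)
  then show ?thesis unfolding expands_def
    using c(1) by (intro exI[of _ "\<lambda>s. b * c s"]) auto
qed

lemma has_sum_product_complex: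
  fixes f g :: "_ \<Rightarrow> complex"
  assumes "(f has_sum a) A" "(g has_sum b) B"
  shows "((\<lambda>(x, y). f x * g y) has_sum a * b) (A \<times> B)"
proof (rule has_sum_SigmaI)
  show "((\<lambda>y. case (x, y) of (x, y) \<Rightarrow> f x * g y) has_sum f x * b) B" for x
    using has_sum_cmult_right[OF assms(2), of "f x"] by simp
  show "((\<lambda>x. f x * b) has_sum a * b) A"
    by (rule has_sum_cmult_left[OF assms(1)])
  have f: "(\<lambda>x. norm (f x)) summable_on A" and g: "(\<lambda>x. norm (g x)) summable_on B"
    using assms by (auto simp flip: summable_on_iff_abs_summable_on_complex intro: has_sum_imp_summable)
  have "(\<lambda>(x, y). norm (f x) * norm (g y)) summable_on A \<times> B"
  proof (rule summable_on_SigmaI)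
    show "((\<lambda>y. case (x, y) of (x, y) \<Rightarrow> norm (f x) * norm (g y)) has_sum norm (f x) * (\<Sum>\<^sub>\<infinity>y\<in>B. norm (g y))) B" for x
      using has_sum_cmult_right[OF has_sum_infsum[OF g], of "norm (f x)"] by simp
    show "(\<lambda>x. norm (f x) * (\<Sum>\<^sub>\<infinity>y\<in>B. norm (g y))) summable_on A"
      by (rule summable_on_cmult_left[OF f])
  qed auto
  then have "(\<lambda>x. norm ((\<lambda>(x, y). f x * g y) x)) summable_on A \<times> B"
    by (simp add: case_prod_beta' norm_mult)
  then show "(\<lambda>(x, y). f x * g y) summable_on A \<times> B"
    by (simp flip: summable_on_iff_abs_summable_on_complex)
qed

text \<open>Exponents add under multiplication, and the two quadratic lower bounds add with
  them.\<close>

lemma expands_mult: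
  assumes "expands \<mu> f" "expands \<nu> g"
  shows "expands (\<mu> + \<nu>) (\<lambda>z \<tau>. f z \<tau> * g z \<tau>)"
proof -
  obtain c where c: "\<And>n r x. c (n, r) \<noteq> 0 \<Longrightarrow> x \<in> {0..1} \<Longrightarrow> 0 \<le> of_int n + of_int r * x + \<mu> * x\<^sup>2"
    "\<And>z \<tau>. 0 < Im z \<Longrightarrow> Im z < Im \<tau> \<Longrightarrow> (fourier_term c z \<tau> has_sum f z \<tau>) UNIV"
    using assms(1) unfolding expands_def by blast
  obtain d where d: "\<And>n r x. d (n, r) \<noteq> 0 \<Longrightarrow> x \<in> {0..1} \<Longrightarrow> 0 \<le> of_int n + of_int r * x + \<nu> * x\<^sup>2"
    "\<And>z \<tau>. 0 < Im z \<Longrightarrow> Im z < Im \<tau> \<Longrightarrow> (fourier_term d z \<tau> has_sum g z \<tau>) UNIV"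
    using assms(2) unfolding expands_def by blast
  define s where "s = (\<lambda>((n, r), (n', r')). (n + n', r + r') :: int \<times> int)"
  show ?thesis
  proof (rule expands_family[where I = UNIV and a = "\<lambda>(x, y). c x * d y" and g = s])
    fix i and x :: real
    assume *: "(case i of (x, y) \<Rightarrow> c x * d y) \<noteq> 0" "0 \<le> x" "x \<le> 1"
    obtain n r n' r' where i: "i = ((n, r), (n', r'))" by (metis surj_pair)
    show "0 \<le> of_int (fst (s i)) + of_int (snd (s i)) * x + (\<mu> + \<nu>) * x\<^sup>2"
      using c(1)[of n r x] d(1)[of n' r' x] * by (simp add: i s_def ring_distribs)
  next
    fix z \<tau> assume "0 < Im z" "Im z < Im \<tau>"
    from has_sum_product_complex[OF c(2)[OF this] d(2)[OF this]]
    have "((\<lambda>(x, y). fourier_term c z \<tau> x * fourier_term d z \<tau> y) has_sum f z \<tau> * g z \<tau>) UNIV"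
      by simp
    moreover have "(\<lambda>(x, y). fourier_term c z \<tau> x * fourier_term d z \<tau> y) =
      (\<lambda>i. (case i of (x, y) \<Rightarrow> c x * d y) * ee (of_int (fst (s i)) * \<tau> + of_int (snd (s i)) * z))"
      by (auto simp: fun_eq_iff fourier_term_def s_def ring_distribs mult_ac ee_add)
    ultimately show "((\<lambda>i. (case i of (x, y) \<Rightarrow> c x * d y) * ee (of_int (fst (s i)) * \<tau> + of_int (snd (s i)) * z)) has_sum
      f z \<tau> * g z \<tau>) UNIV" by simp
  qed
qed


section \<open>From the strip to all \<open>z\<close>\<close>

lemma nonneg_quadratic_discriminant:
  fixes n r :: int and m :: nat
  assumes nonneg: "\<And>x :: real. 0 \<le> of_int n + of_int r * x + of_nat m * x\<^sup>2"
  shows "r\<^sup>2 \<le> 4 * n * int m" "0 \<le> n"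
proof -
  show "0 \<le> n" using nonneg[of 0] by simp
  show "r\<^sup>2 \<le> 4 * n * int m"
  proof (cases "m = 0")
    case True
    have "r = 0"
    proof (rule ccontr)
      assume "r \<noteq> 0"
      \<comment> \<open>Here the linear function \<open>n + r x\<close> takes the value
        \<open>-1\<close>.\<close>
      then show False using nonneg[of "(- of_int n - 1) / of_int r"] True by simp
    qed
    then show ?thesis using True by simp
  next
    case False
    \<comment> \<open>The vertex of the parabola, where the bound is sharpest.\<close>
    have "0 \<le> real_of_int n + of_int r * (- of_int r / (2 * of_nat m)) + of_nat m * (- of_int r / (2 * of_nat m))\<^sup>2"
      by (rule nonneg)
    also have "\<dots> = of_int n - (of_int r)\<^sup>2 / (4 * of_nat m)"
      using False by (simp add: field_simps power2_eq_square)
    finally have "(of_int r :: real)\<^sup>2 \<le> 4 * of_int n * of_nat m"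
      using False by (simp add: field_simps)
    then have "real_of_int (r\<^sup>2) \<le> real_of_int (4 * n * int m)" by simp
    then show ?thesis by (simp only: of_int_le_iff)
  qed
qed

text \<open>For fixed \<tau>, the elliptic law with \<open>l = 1\<close> turns the expansion above
  the real axis into one below it. Both belong to the same entire function, so their coefficients in
  \<open>z\<close> agree; these are still series in powers of \<open>ee \<tau>\<close>, and
  uniqueness in \<tau> separates the powers.\<close>

lemma fourier_coefficients_shift:
  fixes c :: "int \<times> int \<Rightarrow> complex"
  assumes sum: "\<And>z \<tau>. 0 < Im z \<Longrightarrow> Im z < Im \<tau> \<Longrightarrow> (fourier_term c z \<tau> has_sum G z \<tau>) UNIV"
    and hol: "\<And>\<tau>. Im \<tau> > 0 \<Longrightarrow> (\<lambda>z. G z \<tau>) holomorphic_on UNIV"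
    and ell: "\<And>l u z \<tau>. Im \<tau> > 0 \<Longrightarrow> G (z + of_int l * \<tau> + of_int u) \<tau> =
        ee (- of_nat m * (of_int l ^ 2 * \<tau> + 2 * of_int l * z)) * G z \<tau>"
  shows "c (n - r + int m, r - 2 * int m) = c (n, r)"
proof -
  define d where "d n = c (n, r) - c (n - r + int m, r - 2 * int m)" for n
  have d: "((\<lambda>n. d n * ee (of_int n * \<tau>)) has_sum 0) UNIV" if \<tau>: "Im \<tau> > 0" for \<tau>
  proof -
    define a where "a s = c s * ee (of_int (fst s) * \<tau>)" for s
    define a' where "a' s = c s * ee (of_int (fst s + snd s + int m) * \<tau>)" for s
    have 1: "((\<lambda>s. a s * ee (of_int (snd s) * w)) has_sum G w \<tau>) UNIV" if "0 < Im w" "Im w < Im \<tau>" for w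
      using sum[OF that] by (simp add: a_def fourier_term_def[abs_def] ee_add mult.assoc)
    \<comment> \<open>Passing to \<open>w + \<tau>\<close> and dividing by the automorphy factor
      sends the exponent pair \<open>(n, r)\<close> to
      \<open>(n + r + m, r + 2 * m)\<close>.\<close>
    have 2: "((\<lambda>s. a' s * ee (of_int (snd s + 2 * int m) * w)) has_sum G w \<tau>) UNIV"
      if w: "- Im \<tau> < Im w" "Im w < 0" for w
    proof -
      have "(fourier_term c (w + \<tau>) \<tau> has_sum G (w + \<tau>) \<tau>) UNIV"
        using w by (intro sum) auto
      then have "((\<lambda>s. fourier_term c (w + \<tau>) \<tau> s * ee (of_nat m * (\<tau> + 2 * w))) has_sum
          G (w + \<tau>) \<tau> * ee (of_nat m * (\<tau> + 2 * w))) UNIV"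
        by (rule has_sum_cmult_left)
      moreover have "G (w + \<tau>) \<tau> * ee (of_nat m * (\<tau> + 2 * w)) = G w \<tau>"
        using ell[OF \<tau>, of w 1 0] by (simp add: ee_minus)
      moreover have "fourier_term c (w + \<tau>) \<tau> s * ee (of_nat m * (\<tau> + 2 * w)) =
          a' s * ee (of_int (snd s + 2 * int m) * w)" for s
        unfolding fourier_term_def a'_def mult.assoc ee_add[symmetric] by (simp add: algebra_simps)
      ultimately show ?thesis by (simp only:)
    qed
    have per: "G (z + 1) \<tau> = G z \<tau>" for z using ell[OF \<tau>, of z 0 1] by simp
    obtain x where x: "(a has_sum x) {s\<in>UNIV. snd s = r}" "(a' has_sum x) {s\<in>UNIV. snd s + 2 * int m = r}"
      using fourier_coefficients_unique[of "\<lambda>z. G z \<tau>" 0 "Im \<tau>" a snd UNIV "- Im \<tau>" 0 a'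
          "\<lambda>s. snd s + 2 * int m" UNIV r, OF hol[OF \<tau>] per \<tau> 1 _ 2] \<tau> by auto
    have x1: "((\<lambda>n. c (n, r) * ee (of_int n * \<tau>)) has_sum x) UNIV"
      using x(1) by (rule has_sum_reindex_bij_witness[where i = "\<lambda>n. (n, r)" and j = fst, THEN iffD1, rotated -1])
        (auto simp: a_def)
    have x2: "((\<lambda>n. c (n - r + int m, r - 2 * int m) * ee (of_int n * \<tau>)) has_sum x) UNIV"
      using x(2) by (rule has_sum_reindex_bij_witness[where i = "\<lambda>n. (n - r + int m, r - 2 * int m)"
            and j = "\<lambda>s. fst s + snd s + int m", THEN iffD1, rotated -1])
        (auto simp: a'_def algebra_simps)
    have "((\<lambda>n. c (n, r) * ee (of_int n * \<tau>) + - (c (n - r + int m, r - 2 * int m) * ee (of_int n * \<tau>)))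
        has_sum x + - x) UNIV"
      by (intro has_sum_add x1 has_sum_uminusI x2)
    then show ?thesis by (simp add: d_def ring_distribs)
  qed
  \<comment> \<open>Uniqueness is now applied in the variable \<tau> to the zero function, whose
    second expansion is the empty sum. Any strip within the upper half plane would do.\<close>
  have "\<exists>x. (d has_sum x) {i\<in>UNIV. (\<lambda>i. i) i = n} \<and> ((\<lambda>_::int. 0) has_sum x) {i\<in>{}. (\<lambda>i. i) i = n}"
    by (rule fourier_coefficients_unique[where h = "\<lambda>_. 0" and ?y1.0 = 0 and ?y2.0 = 1 and ?y1' = 0 and ?y2' = 1])
      (use d in auto)
  then obtain x where "(d has_sum x) {n}" "((\<lambda>_. 0) has_sum x) ({} :: int set)" by auto
  then have "(d has_sum 0) {n}" using has_sum_unique[OF _ has_sum_empty] by blast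
  then have "d n = 0" using has_sum_unique[OF _ has_sum_finite[of "{n}" d]] by fastforce
  then show ?thesis by (simp add: d_def)
qed

text \<open>The elliptic law carries the expansion to every open strip between consecutive multiples
  of \<open>Im \<tau>\<close>, and the invariance of the coefficients makes it the same series
  there. The separating lines lie in none of these strips; they are reached by continuity in the
  vertical direction.\<close>

lemma fourier_expansion_extends:
  assumes expands: "expands (real m) G"
    and hol: "\<And>\<tau>. Im \<tau> > 0 \<Longrightarrow> (\<lambda>z. G z \<tau>) holomorphic_on UNIV"
    and ell: "\<And>l u z \<tau>. Im \<tau> > 0 \<Longrightarrow> G (z + of_int l * \<tau> + of_int u) \<tau> =
        ee (- of_nat m * (of_int l ^ 2 * \<tau> + 2 * of_int l * z)) * G z \<tau>"
  obtains c where "\<And>n r. c (n, r) \<noteq> 0 \<Longrightarrow> r\<^sup>2 \<le> 4 * n * int m \<and> 0 \<le> n"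
    and "\<And>z \<tau>. Im \<tau> > 0 \<Longrightarrow> (fourier_term c z \<tau> has_sum G z \<tau>) UNIV"
proof -
  obtain c where supp: "\<And>n r x. c (n, r) \<noteq> 0 \<Longrightarrow> x \<in> {0..1} \<Longrightarrow> 0 \<le> of_int n + of_int r * x + real m * x\<^sup>2"
    and sum: "\<And>z \<tau>. 0 < Im z \<Longrightarrow> Im z < Im \<tau> \<Longrightarrow> (fourier_term c z \<tau> has_sum G z \<tau>) UNIV"
    using expands unfolding expands_def by blast
  have shift1: "c (n - r + int m, r - 2 * int m) = c (n, r)" for n r
    by (rule fourier_coefficients_shift[OF sum hol ell])
  have shift: "c (n + l * r + int m * l\<^sup>2, r + 2 * l * int m) = c (n, r)" for n r l
  proof (induction l rule: int_induct[where k = 0])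
    case (step1 l)
    have "c (n + (l + 1) * r + int m * (l + 1)\<^sup>2, r + 2 * (l + 1) * int m) =
        c (n + l * r + int m * l\<^sup>2, r + 2 * l * int m)"
      using shift1[of "n + (l + 1) * r + int m * (l + 1)\<^sup>2" "r + 2 * (l + 1) * int m"]
      by (simp add: algebra_simps power2_eq_square)
    then show ?case using step1 by simp
  next
    case (step2 l)
    have "c (n + (l - 1) * r + int m * (l - 1)\<^sup>2, r + 2 * (l - 1) * int m) =
        c (n + l * r + int m * l\<^sup>2, r + 2 * l * int m)"
      using shift1[of "n + l * r + int m * l\<^sup>2" "r + 2 * l * int m"]
      by (simp add: algebra_simps power2_eq_square)
    then show ?case using step2 by simp
  qed simp
  have "0 \<le> of_int n + of_int r * x + of_nat m * x\<^sup>2" if "c (n, r) \<noteq> 0" for n r and x :: real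
  proof -
    let ?l = "\<lfloor>x\<rfloor>"
    have fl: "x = frac x + of_int ?l" by (simp add: frac_def)
    \<comment> \<open>The shifted pair has a nonzero coefficient too, and its quadratic polynomial
      at \<open>frac x\<close> is the original one at \<open>x\<close>. This removes the restriction
      to \<open>[0, 1]\<close>.\<close>
    have "0 \<le> of_int (n + ?l * r + int m * ?l\<^sup>2) + of_int (r + 2 * ?l * int m) * frac x + real m * (frac x)\<^sup>2"
      using that by (intro supp) (auto simp: shift frac_lt_1 less_imp_le)
    also have "\<dots> = of_int n + of_int r * (frac x + of_int ?l) + of_nat m * (frac x + of_int ?l)\<^sup>2"
      by (simp add: algebra_simps power2_eq_square)
    finally show ?thesis using fl by simp
  qed
  then have c: "r\<^sup>2 \<le> 4 * n * int m \<and> 0 \<le> n" if "c (n, r) \<noteq> 0" for n r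
    using nonneg_quadratic_discriminant[of n r m] that by blast
  have inside: "(fourier_term c z \<tau> has_sum G z \<tau>) UNIV"
    if \<tau>: "Im \<tau> > 0" and z: "of_int l * Im \<tau> < Im z" "Im z < (of_int l + 1) * Im \<tau>" for z \<tau> l
  proof -
    define w where "w = z - of_int l * \<tau>"
    have w: "0 < Im w" "Im w < Im \<tau>" using z by (auto simp: w_def algebra_simps)
    define b where "b = ee (- of_nat m * (of_int l ^ 2 * \<tau> + 2 * of_int l * w))"
    have "G z \<tau> = b * G w \<tau>" using ell[OF \<tau>, of w l 0] by (simp add: w_def b_def)
    then have "((\<lambda>s. b * fourier_term c w \<tau> s) has_sum G z \<tau>) UNIV"
      using has_sum_cmult_right[OF sum[OF w], of b] by simp
    then show ?thesis
    proof (rule has_sum_reindex_bij_witness[where j = "\<lambda>s. (fst s - l * snd s + int m * l\<^sup>2, snd s - 2 * l * int m)"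
            and i = "\<lambda>s. (fst s + l * snd s + int m * l\<^sup>2, snd s + 2 * l * int m)", THEN iffD1, rotated -1])
      fix s :: "int \<times> int"
      have "c (fst s - l * snd s + int m * l\<^sup>2, snd s - 2 * l * int m) = c s"
        using shift[of "fst s" "- l" "snd s"] by simp
      then show "fourier_term c z \<tau> (fst s - l * snd s + int m * l\<^sup>2, snd s - 2 * l * int m) = b * fourier_term c w \<tau> s"
        by (simp add: fourier_term_def b_def w_def mult_ac flip: ee_add)
          (simp add: algebra_simps power2_eq_square)
    qed (auto simp: algebra_simps power2_eq_square)
  qed
  have "(fourier_term c z \<tau> has_sum G z \<tau>) UNIV" if \<tau>: "Im \<tau> > 0" for z \<tau>
  proof -
    define l where "l = \<lfloor>Im z / Im \<tau>\<rfloor>"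
    have l1: "of_int l * Im \<tau> \<le> Im z"
      using \<tau> of_int_floor_le[of "Im z / Im \<tau>"] by (simp add: l_def pos_le_divide_eq del: of_int_floor_le)
    have l2: "Im z < (of_int l + 1) * Im \<tau>"
      using \<tau> floor_correct[of "Im z / Im \<tau>"] by (simp add: l_def pos_divide_less_eq del: real_of_int_floor_add_one_gt)
    show ?thesis
    proof (cases "Im z = of_int l * Im \<tau>")
      case False
      then show ?thesis using inside[OF \<tau> _ l2] l1 by simp
    next
      case True
      define \<epsilon> where "\<epsilon> = Im \<tau> / 2"
      have \<epsilon>: "\<epsilon> > 0" using \<tau> by (simp add: \<epsilon>_def)
      have off: "(fourier_term c (z + \<i> * of_real y) \<tau> has_sum G (z + \<i> * of_real y) \<tau>) UNIV"
        if "y \<noteq> 0" "\<bar>y\<bar> \<le> \<epsilon>" for y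
      proof (cases "y > 0")
        case True
        then show ?thesis using that \<open>Im z = _\<close> \<epsilon>
          by (intro inside[OF \<tau>, of l]) (auto simp: \<epsilon>_def algebra_simps)
      next
        case False
        then show ?thesis using that \<open>Im z = _\<close> \<epsilon>
          by (intro inside[OF \<tau>, of "l - 1"]) (auto simp: \<epsilon>_def algebra_simps)
      qed
      \<comment> \<open>On the vertical segment through \<open>z\<close>, the terms are dominated by
        those at its two ends, which lie inside open strips where the expansion is known.\<close>
      define M where "M s = norm (fourier_term c (z + \<i> * of_real \<epsilon>) \<tau> s)
          + norm (fourier_term c (z + \<i> * of_real (- \<epsilon>)) \<tau> s)" for s
      have M: "M summable_on UNIV"
        unfolding M_def using off[of \<epsilon>] off[of "- \<epsilon>"] \<epsilon>
        by (intro summable_on_add)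
          (auto simp flip: summable_on_iff_abs_summable_on_complex intro: has_sum_imp_summable)
      have le: "norm (fourier_term c (z + \<i> * of_real y) \<tau> s) \<le> M s" if "y \<in> {-\<epsilon>..\<epsilon>}" for s y
      proof -
        have "norm (ee (of_int (snd s) * (z + \<i> * of_real y))) \<le>
            norm (ee (of_int (snd s) * (z + \<i> * of_real \<epsilon>))) + norm (ee (of_int (snd s) * (z - \<i> * of_real \<epsilon>)))"
          using that by (intro norm_ee_le_ends) auto
        from mult_left_mono[OF this, of "norm (c s * ee (of_int (fst s) * \<tau>))"]
        show ?thesis by (simp add: M_def fourier_term_def ee_add norm_mult ring_distribs mult.assoc)
      qed
      define S where "S y = (\<Sum>\<^sub>\<infinity>s. fourier_term c (z + \<i> * of_real y) \<tau> s)" for y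
      have sumS: "(fourier_term c (z + \<i> * of_real y) \<tau> has_sum S y) UNIV" if "y \<in> {-\<epsilon>..\<epsilon>}" for y
      proof -
        have "(\<lambda>s. norm (fourier_term c (z + \<i> * of_real y) \<tau> s)) summable_on UNIV"
          using M le[OF that] by (intro Infinite_Sum.abs_summable_on_comparison_test'[of M]) auto
        then show ?thesis unfolding S_def
          by (intro has_sum_infsum) (simp flip: summable_on_iff_abs_summable_on_complex)
      qed
      have "uniform_limit {-\<epsilon>..\<epsilon>} (\<lambda>X y. \<Sum>s\<in>X. fourier_term c (z + \<i> * of_real y) \<tau> s) S (finite_subsets_at_top UNIV)"
        using le sumS by (intro Weierstrass_m_test_general'[OF _ _ M]) auto
      then have "continuous_on {-\<epsilon>..\<epsilon>} S"
        by (rule uniform_limit_theorem[rotated])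
          (auto intro!: always_eventually continuous_intros simp: fourier_term_def)
      then have "S \<midarrow>0\<rightarrow> S 0"
        using continuous_on_interior[of "{-\<epsilon>..\<epsilon>}" S 0] \<epsilon> by (simp add: isCont_def)
      moreover have "((\<lambda>y. G (z + \<i> * of_real y) \<tau>) \<longlongrightarrow> G (z + \<i> * of_real 0) \<tau>) (at (0::real))"
      proof -
        have "continuous_on UNIV (\<lambda>y. (\<lambda>z. G z \<tau>) (z + \<i> * of_real y))"
          by (rule continuous_on_compose2[OF holomorphic_on_imp_continuous_on[OF hol[OF \<tau>]]])
            (auto intro!: continuous_intros)
        then show ?thesis unfolding continuous_on_def by blast
      qed
      moreover have "\<forall>\<^sub>F y in at 0. S y = G (z + \<i> * of_real y) \<tau>"
      proof -
        have "\<forall>\<^sub>F y in at 0. y \<noteq> 0 \<and> \<bar>y\<bar> \<le> \<epsilon>"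
          unfolding eventually_at using \<epsilon> by (intro exI[of _ \<epsilon>]) auto
        then show ?thesis
        proof (rule eventually_mono)
          fix y assume y: "y \<noteq> 0 \<and> \<bar>y\<bar> \<le> \<epsilon>"
          then have "y \<in> {-\<epsilon>..\<epsilon>}" by auto
          from has_sum_unique[OF sumS[OF this] off] y show "S y = G (z + \<i> * of_real y) \<tau>" by blast
        qed
      qed
      ultimately have "S 0 = G z \<tau>"
        using tendsto_cong[of S "\<lambda>y. G (z + \<i> * of_real y) \<tau>" "at 0" "G z \<tau>"] tendsto_unique[of "at 0" S "S 0" "G z \<tau>"]
        by simp
      then show ?thesis using sumS[of 0] \<epsilon> by simp
    qed
  qed
  then show ?thesis using c that by blast
qed

section \<open>The functions \<open>J\<^sub>1\<close> and \<open>J\<^sub>2\<close>\<close>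

definition lattice :: "complex \<Rightarrow> complex set" where
  "lattice \<tau> = {of_int l * \<tau> + of_int u | l u. True}"

lemma lattice_Im: "z \<in> lattice \<tau> \<Longrightarrow> \<bar>Im z\<bar> < Im \<tau> \<Longrightarrow> z \<in> \<int>"
proof -
  assume "z \<in> lattice \<tau>" and lt: "\<bar>Im z\<bar> < Im \<tau>"
  then obtain l u where z: "z = of_int l * \<tau> + of_int u" by (auto simp: lattice_def)
  have \<tau>: "Im \<tau> > 0" using lt by linarith
  then have "\<bar>of_int l\<bar> * Im \<tau> < 1 * Im \<tau>" using lt z by (auto simp: abs_mult)
  then have "\<bar>real_of_int l\<bar> < 1" using \<tau> by (simp add: mult_less_cancel_right)
  then have "l = 0" by linarith
  then show ?thesis using z by simp
qed

lemma Ints_subset_lattice: "z \<in> \<int> \<Longrightarrow> z \<in> lattice \<tau>"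
  unfolding lattice_def by (elim Ints_cases) (auto intro: exI[of _ "0::int"])

lemma lattice_add_iff: "z + of_int l * \<tau> + of_int u \<in> lattice \<tau> \<longleftrightarrow> z \<in> lattice \<tau>"
proof
  assume "z + of_int l * \<tau> + of_int u \<in> lattice \<tau>"
  then obtain l' u' where "z + of_int l * \<tau> + of_int u = of_int l' * \<tau> + of_int u'"
    by (auto simp: lattice_def)
  then have "z = of_int (l' - l) * \<tau> + of_int (u' - u)" by (simp add: algebra_simps)
  then show "z \<in> lattice \<tau>" unfolding lattice_def by blast
next
  assume "z \<in> lattice \<tau>"
  then obtain l' u' where "z = of_int l' * \<tau> + of_int u'" by (auto simp: lattice_def)
  then have "z + of_int l * \<tau> + of_int u = of_int (l' + l) * \<tau> + of_int (u' + u)" by (simp add: algebra_simps)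
  then show "z + of_int l * \<tau> + of_int u \<in> lattice \<tau>" unfolding lattice_def by blast
qed

lemma lattice_minus_iff: "- z \<in> lattice \<tau> \<longleftrightarrow> z \<in> lattice \<tau>"
proof -
  have "- z \<in> lattice \<tau>" if z: "z \<in> lattice \<tau>" for z
  proof -
    obtain l u where "z = of_int l * \<tau> + of_int u" using z by (auto simp: lattice_def)
    then have "- z = of_int (- l) * \<tau> + of_int (- u)" by simp
    then show ?thesis unfolding lattice_def by blast
  qed
  from this[of z] this[of "- z"] show ?thesis by auto
qed

section \<open>Lambert series and meromorphic continuation\<close>

text \<open>At \<open>x = z + r * \<tau>\<close>, this is the sum over \<open>k\<close> of
  \<open>p^k q^(k r)\<close> in closed form. Once summed over \<open>k\<close>, the double series of
  \<open>J\<close> makes sense beyond its strip of convergence.\<close>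

definition geom :: "complex \<Rightarrow> complex" where
  "geom x = ee x / (1 - ee x)"

text \<open>Unlike the double series of \<open>J\<^sub>n\<close>, these series converge for all \<open>z\<close> (a summand takes the value 0
  at its poles).\<close>
definition lambert :: "nat \<Rightarrow> complex \<Rightarrow> complex \<Rightarrow> complex" where
  "lambert a \<tau> z = (\<Sum>r. of_nat (Suc r) ^ a * geom (z + of_nat (Suc r) * \<tau>))"

lemma geom_add_int: "geom (z + of_int n) = geom z"
  by (simp add: geom_def ee_add)

lemma lambert_add_int: "lambert a \<tau> (z + of_int n) = lambert a \<tau> z"
proof -
  have "geom (z + of_int n + w) = geom (z + w)" for w
    using geom_add_int[of "z + w" n] by (simp add: ac_simps)
  then show ?thesis by (simp add: lambert_def)
qed

text \<open>All but finitely many \<open>r\<close> satisfy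
  \<open>norm (ee (z + r * \<tau>)) < 1/2\<close>. For those the denominator of \<open>geom\<close>
  is at least \<open>1/2\<close>, and the terms are bounded by those of a differentiated geometric
  series.\<close>

lemma summable_norm_lambert:
  assumes "Im \<tau> > 0" "a \<le> 1"
  shows "summable (\<lambda>r. norm (of_nat (Suc r) ^ a * geom (z + of_nat (Suc r) * \<tau>)))"
proof -
  define \<rho> where "\<rho> = norm (ee \<tau>)"
  have \<rho>: "0 < \<rho>" "\<rho> < 1" using assms by (auto simp: \<rho>_def norm_ee)
  have x: "norm (ee (z + of_nat (Suc r) * \<tau>)) = norm (ee z) * \<rho> * \<rho> ^ r" for r
    by (simp add: ring_distribs ee_add norm_mult \<rho>_def norm_power flip: ee_power)
  have "(\<lambda>r. norm (ee z) * \<rho> * \<rho> ^ r) \<longlonglongrightarrow> norm (ee z) * \<rho> * 0"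
    using \<rho> by (intro tendsto_intros LIMSEQ_power_zero) auto
  then have "\<forall>\<^sub>F r in sequentially. norm (ee z) * \<rho> * \<rho> ^ r < 1 / 2"
    by (rule order_tendstoD) simp
  then have "\<forall>\<^sub>F r in sequentially. norm (norm (of_nat (Suc r) ^ a * geom (z + of_nat (Suc r) * \<tau>))) \<le>
      2 * (norm (ee z) * \<rho>) * (of_nat (Suc r) * \<rho> ^ r)"
  proof eventually_elim
    case (elim r)
    define y where "y = ee (z + of_nat (Suc r) * \<tau>)"
    have y: "norm y < 1 / 2" using elim x by (simp add: y_def)
    have "1 - norm y \<le> norm (1 - y)" by (metis norm_one norm_triangle_ineq2)
    then have "1 / 2 \<le> norm (1 - y)" using y by simp
    then have "norm y / norm (1 - y) \<le> norm y / (1 / 2)"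
      by (intro divide_left_mono) auto
    then have 1: "norm (geom (z + of_nat (Suc r) * \<tau>)) \<le> 2 * (norm (ee z) * \<rho> * \<rho> ^ r)"
      using x[of r] by (simp add: geom_def norm_divide y_def)
    have "real (Suc r) ^ a \<le> real (Suc r) ^ 1"
      using assms(2) by (intro power_increasing) auto
    then have "real (Suc r) ^ a * norm (geom (z + of_nat (Suc r) * \<tau>)) \<le>
        real (Suc r) * (2 * (norm (ee z) * \<rho> * \<rho> ^ r))"
      using 1 by (intro mult_mono) auto
    then show ?case by (simp add: norm_mult norm_power mult_ac del: of_nat_Suc)
  qed
  moreover have "summable (\<lambda>r. 2 * (norm (ee z) * \<rho>) * (of_nat (Suc r) * \<rho> ^ r))"
    using geometric_deriv_sums[of \<rho>] \<rho> by (intro summable_mult) (auto dest: sums_summable)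
  ultimately show ?thesis by (rule summable_comparison_test_ev)
qed

text \<open>A reindexing by one, valid at the poles as well, since division by zero gives a term the
  same value on both sides.\<close>

lemma lambert_0_shift:
  assumes "Im \<tau> > 0"
  shows "lambert 0 \<tau> (z + \<tau>) = lambert 0 \<tau> z - geom (z + \<tau>)"
proof -
  have "summable (\<lambda>r. geom (z + of_nat (Suc r) * \<tau>))"
    using summable_norm_cancel[OF summable_norm_lambert[OF assms, of 0 z]] by simp
  from suminf_split_head[OF this] show ?thesis
    by (simp add: lambert_def ring_distribs ac_simps)
qed

lemma lambert_1_shift:
  assumes "Im \<tau> > 0"
  shows "lambert 1 \<tau> (z + \<tau>) = lambert 1 \<tau> z - lambert 0 \<tau> z"
proof -
  have s0: "summable (\<lambda>r. geom (z + of_nat (Suc r) * \<tau>))"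
    using summable_norm_cancel[OF summable_norm_lambert[OF assms, of 0 z]] by simp
  have s1: "summable (\<lambda>r. of_nat (Suc r) * geom (z + of_nat (Suc r) * \<tau>))"
    using summable_norm_cancel[OF summable_norm_lambert[OF assms, of 1 z]] by simp
  have s: "summable (\<lambda>r. of_nat (Suc r) * geom (z + of_nat (Suc r) * \<tau>) - geom (z + of_nat (Suc r) * \<tau>))"
    by (rule summable_diff[OF s1 s0])
  have "lambert 1 \<tau> z - lambert 0 \<tau> z =
      (\<Sum>r. of_nat (Suc r) * geom (z + of_nat (Suc r) * \<tau>) - geom (z + of_nat (Suc r) * \<tau>))"
    using suminf_diff[OF s1 s0] by (simp add: lambert_def)
  also have "\<dots> = (\<Sum>r. of_nat (Suc r) * geom (z + \<tau> + of_nat (Suc r) * \<tau>))"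
    using suminf_split_head[OF s] by (simp add: ring_distribs ac_simps)
  finally show ?thesis by (simp add: lambert_def)
qed

lemma has_sum_lambert:
  assumes z: "Im z > - Im \<tau>" and \<tau>: "Im \<tau> > 0" and a: "a \<le> 1"
  shows "((\<lambda>(k, r). of_nat r ^ a * ee (of_nat k * (z + of_nat r * \<tau>))) has_sum lambert a \<tau> z)
    ({1::nat..} \<times> {1::nat..})"
proof -
  define x where "x r = ee (z + of_nat r * \<tau>)" for r :: nat
  have x1: "norm (x r) \<le> norm (x 1)" if "r \<ge> 1" for r
    using that \<tau> by (simp add: x_def norm_ee)
  have x1': "norm (x 1) < 1" using z by (simp add: x_def norm_ee)
  have x: "norm (x r) < 1" if "r \<ge> 1" for r using x1[OF that] x1' by linarith
  have abs: "(\<lambda>r. norm (of_nat r ^ a * geom (z + of_nat r * \<tau>))) summable_on {1..}"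
  proof -
    have "(\<lambda>r. norm (of_nat (Suc r) ^ a * geom (z + of_nat (Suc r) * \<tau>))) summable_on UNIV"
      using summable_norm_lambert[OF \<tau> a, of z] by (intro summable_nonneg_imp_summable_on) auto
    then show ?thesis
      by (rule summable_on_reindex_bij_witness[of _ "\<lambda>n. n - 1" "\<lambda>n. n + 1", THEN iffD1, rotated -1]) auto
  qed
  have outer: "((\<lambda>r. of_nat r ^ a * geom (z + of_nat r * \<tau>)) has_sum lambert a \<tau> z) {1..}"
  proof -
    have "((\<lambda>r. of_nat (Suc r) ^ a * geom (z + of_nat (Suc r) * \<tau>)) has_sum lambert a \<tau> z) UNIV"
      using summable_norm_lambert[OF \<tau> a, of z] unfolding lambert_def
      by (intro norm_summable_imp_has_sum summable_sums) (auto dest: summable_norm_cancel)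
    then show ?thesis
      by (rule has_sum_reindex_bij_witness[of _ "\<lambda>n. n - 1" "\<lambda>n. n + 1", THEN iffD1, rotated -1]) auto
  qed
  have inner: "((\<lambda>k. of_nat r ^ a * x r ^ k) has_sum of_nat r ^ a * geom (z + of_nat r * \<tau>)) {1..}"
    if "r \<ge> 1" for r
    using has_sum_cmult_right[OF has_sum_geometric_from_1[OF x[OF that]], of "of_nat r ^ a"]
    by (simp add: geom_def x_def)
  have inner': "((\<lambda>k. norm (of_nat r ^ a * x r ^ k)) has_sum of_nat r ^ a * (norm (x r) / (1 - norm (x r)))) {1..}"
    if "r \<ge> 1" for r
    using has_sum_cmult_right[OF has_sum_geometric_from_1[of "norm (x r)"], of "of_nat r ^ a"] x[OF that]
    by (simp add: norm_mult norm_power)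
  have "(\<lambda>(r, k). norm (of_nat r ^ a * x r ^ k)) summable_on ({1..} \<times> {1..})"
  proof (rule summable_on_SigmaI)
    show "((\<lambda>k. case (r, k) of (r, k) \<Rightarrow> norm (of_nat r ^ a * x r ^ k)) has_sum
        of_nat r ^ a * (norm (x r) / (1 - norm (x r)))) {1..}" if "r \<in> {1..}" for r
      using inner'[of r] that by simp
    show "(\<lambda>r. of_nat r ^ a * (norm (x r) / (1 - norm (x r)))) summable_on {1..}"
    proof (rule summable_on_comparison_test)
      \<comment> \<open>The factor arises from \<open>norm (1 - x r) \<le> 2\<close> and
        \<open>1 - norm (x r) \<ge> 1 - norm (x 1)\<close>: it bounds the inner sums of norms by the
        norms of the inner sums.\<close>
      show "(\<lambda>r. 2 / (1 - norm (x 1)) * norm (of_nat r ^ a * geom (z + of_nat r * \<tau>))) summable_on {1..}"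
        by (rule summable_on_cmult_right[OF abs])
      fix r :: nat assume r: "r \<in> {1..}"
      have "norm (x r) / (1 - norm (x r)) \<le> norm (x r) / (1 - norm (x 1))"
        using x1[of r] x1' r by (intro divide_left_mono mult_pos_pos) auto
      also have "\<dots> \<le> 2 / (1 - norm (x 1)) * norm (geom (z + of_nat r * \<tau>))"
      proof -
        have "norm (1 - x r) \<le> 2"
          using norm_triangle_ineq4[of 1 "x r"] x[of r] r by simp
        moreover have "x r \<noteq> 1" using x[of r] r by auto
        ultimately have "norm (x r) / 2 \<le> norm (x r) / norm (1 - x r)"
          by (intro divide_left_mono) auto
        then have "norm (x r) \<le> 2 * norm (geom (z + of_nat r * \<tau>))"
          by (simp add: geom_def x_def norm_divide mult.commute)
        then show ?thesis using x1' by (simp add: divide_right_mono)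
      qed
      finally have "of_nat r ^ a * (norm (x r) / (1 - norm (x r))) \<le>
          of_nat r ^ a * (2 / (1 - norm (x 1)) * norm (geom (z + of_nat r * \<tau>)))"
        by (rule mult_left_mono) simp
      then show "of_nat r ^ a * (norm (x r) / (1 - norm (x r))) \<le>
        2 / (1 - norm (x 1)) * norm (of_nat r ^ a * geom (z + of_nat r * \<tau>))"
        by (simp add: norm_mult norm_power mult_ac)
      show "0 \<le> of_nat r ^ a * (norm (x r) / (1 - norm (x r)))" using x[of r] r by simp
    qed
  qed auto
  then have "(\<lambda>y. norm ((\<lambda>(r, k). of_nat r ^ a * x r ^ k) y)) summable_on ({1..} \<times> {1..})"
    by (simp add: case_prod_beta')
  then have "(\<lambda>(r, k). of_nat r ^ a * x r ^ k) summable_on ({1..} \<times> {1..})"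
    by (simp flip: summable_on_iff_abs_summable_on_complex)
  then have "((\<lambda>(r, k). of_nat r ^ a * x r ^ k) has_sum lambert a \<tau> z) ({1..} \<times> {1..})"
    using inner outer by (intro has_sum_SigmaI[where g = "\<lambda>r. of_nat r ^ a * geom (z + of_nat r * \<tau>)"]) auto
  then show ?thesis
    by (subst has_sum_swap) (simp add: x_def ee_power)
qed

lemma analytic_on_shift:
  assumes "f analytic_on {z + c}"
  shows "(\<lambda>w. f (w + c)) analytic_on {z}"
proof -
  have "(f \<circ> (\<lambda>w. w + c)) analytic_on {z}"
    by (rule analytic_on_compose_gen[OF _ assms]) (auto intro!: analytic_intros)
  then show ?thesis by (simp add: o_def)
qed

lemma analytic_on_uminus_arg:
  assumes "f analytic_on {- z}"
  shows "(\<lambda>w. f (- w)) analytic_on {z}"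
proof -
  have "(f \<circ> uminus) analytic_on {z}"
    by (rule analytic_on_compose_gen[OF _ assms]) (auto intro!: analytic_intros)
  then show ?thesis by (simp add: o_def)
qed

lemma geom_analytic: "z \<notin> \<int> \<Longrightarrow> geom analytic_on {z}"
  unfolding geom_def by (intro analytic_intros) (auto simp: ee_eq_1_iff[symmetric])

lemma ee_meromorphic: "ee meromorphic_on S"
  unfolding ee_def by (intro analytic_on_imp_meromorphic_on analytic_intros)

lemma geom_meromorphic: "geom meromorphic_on S"
  unfolding geom_def by (intro meromorphic_intros ee_meromorphic)

lemma lambert_analytic_upper:
  assumes \<tau>: "Im \<tau> > 0" and a: "a \<le> 1" and z: "Im z > - Im \<tau>"
  shows "lambert a \<tau> analytic_on {z}"
proof -
  define S where "S = {w. Im w > - Im \<tau>}"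
  have S: "open S" unfolding S_def by (rule open_halfspace_Im_gt)
  have *: "((\<lambda>i. (of_nat (snd i) ^ a * ee (of_nat (fst i * snd i) * \<tau>)) * ee (of_int (int (fst i)) * w))
      has_sum lambert a \<tau> w) ({1..} \<times> {1..})" if "w \<in> S" for w
    using has_sum_lambert[of \<tau> w a] that \<tau> a
    by (simp add: S_def case_prod_beta' ring_distribs ee_add mult_ac)
  have "lambert a \<tau> holomorphic_on S"
    unfolding holomorphic_on_def using fourier_series_deriv(1)[OF S _ *]
    by (auto intro: field_differentiable_at_within)
  then show ?thesis using S z unfolding analytic_at S_def by blast
qed

text \<open>Induction over the half planes \<open>Im z > - (N + 1) * Im \<tau>\<close>, with the
  shift relations expressing values at \<open>z\<close> by values at \<open>z + \<tau>\<close>. Both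
  series are treated together because the relation for \<open>lambert 1\<close> involves
  \<open>lambert 0\<close>.\<close>

lemma lambert_analytic_meromorphic:
  assumes \<tau>: "Im \<tau> > 0" and a: "a \<le> 1"
  shows "z \<notin> lattice \<tau> \<Longrightarrow> lambert a \<tau> analytic_on {z}" "lambert a \<tau> meromorphic_on {z}"
proof -
  have eq0: "lambert 0 \<tau> = (\<lambda>z. lambert 0 \<tau> (z + \<tau>) + geom (z + \<tau>))"
    using lambert_0_shift[OF \<tau>] by (simp add: fun_eq_iff)
  have eq1: "lambert 1 \<tau> = (\<lambda>z. lambert 1 \<tau> (z + \<tau>) + lambert 0 \<tau> z)"
    using lambert_1_shift[OF \<tau>] by (simp add: fun_eq_iff)
  have lat: "z + \<tau> \<in> lattice \<tau> \<longleftrightarrow> z \<in> lattice \<tau>" for z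
    using lattice_add_iff[of z 1 \<tau> 0] by simp
  have *: "(z \<notin> lattice \<tau> \<longrightarrow> lambert 0 \<tau> analytic_on {z} \<and> lambert 1 \<tau> analytic_on {z}) \<and>
     lambert 0 \<tau> meromorphic_on {z} \<and> lambert 1 \<tau> meromorphic_on {z}"
    if "Im z > - of_nat (Suc N) * Im \<tau>" for N z
    using that
  proof (induction N arbitrary: z)
    case 0
    then show ?case using lambert_analytic_upper[OF \<tau>] by (auto intro: analytic_on_imp_meromorphic_on)
  next
    case (Suc N)
    have "Im (z + \<tau>) > - of_nat (Suc N) * Im \<tau>"
      using Suc.prems by (simp add: algebra_simps)
    note IH = Suc.IH[OF this]
    have m: "(\<lambda>w. f (w + \<tau>)) meromorphic_on {z}" if "f meromorphic_on {z + \<tau>}" for f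
      by (rule meromorphic_on_compose[OF that]) (auto intro!: analytic_intros)
    have m0: "lambert 0 \<tau> meromorphic_on {z}"
      using IH by (subst eq0) (intro meromorphic_intros m geom_meromorphic, auto)
    have m1: "lambert 1 \<tau> meromorphic_on {z}"
      using IH m0 by (subst eq1) (intro meromorphic_intros m, auto)
    have a01: "lambert 0 \<tau> analytic_on {z} \<and> lambert 1 \<tau> analytic_on {z}" if z: "z \<notin> lattice \<tau>"
    proof -
      have "z + \<tau> \<notin> lattice \<tau>" using z lat by simp
      then have "z + \<tau> \<notin> \<int>" using Ints_subset_lattice by blast
      have a0: "lambert 0 \<tau> analytic_on {z}"
        using IH z lat \<open>z + \<tau> \<notin> \<int>\<close>
        by (subst eq0) (intro analytic_intros analytic_on_shift geom_analytic, auto)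
      moreover have "lambert 1 \<tau> analytic_on {z}"
        using IH z lat a0 by (subst eq1) (intro analytic_intros analytic_on_shift, auto)
      ultimately show ?thesis by blast
    qed
    show ?case using m0 m1 a01 by blast
  qed
  obtain N :: nat where "- Im z / Im \<tau> < of_nat N" using reals_Archimedean2 by blast
  then have "- Im z < of_nat N * Im \<tau>" using \<tau> by (metis pos_divide_less_eq)
  also have "\<dots> \<le> of_nat (Suc N) * Im \<tau>" using \<tau> by (intro mult_right_mono) auto
  finally have "Im z > - of_nat (Suc N) * Im \<tau>" by (metis minus_less_iff mult_minus_left)
  from *[OF this] show "z \<notin> lattice \<tau> \<Longrightarrow> lambert a \<tau> analytic_on {z}" "lambert a \<tau> meromorphic_on {z}"
    using a by (cases "a = 0"; cases "a = 1"; force)+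
qed

text \<open>The continuation of \<open>J 1\<close>, with \<open>p / (p - 1)\<close> and the
  Bernoulli number \<open>-1/2\<close> merged into one odd fraction. It is the logarithmic
  z-derivative of the Jacobi theta function \<open>\<theta>_1\<close>, divided by
  \<open>2 * pi * \<i>\<close>.\<close>

definition jA :: "complex \<Rightarrow> complex \<Rightarrow> complex" where
  "jA \<tau> z = (ee z + 1) / (2 * (ee z - 1)) - lambert 0 \<tau> z + lambert 0 \<tau> (- z)"

definition jB :: "complex \<Rightarrow> complex \<Rightarrow> complex" where
  "jB \<tau> z = 1 / 6 - 2 * (lambert 1 \<tau> z + lambert 1 \<tau> (- z))"

lemma meromorphic_on_uminus_arg:
  assumes "f meromorphic_on {- z}" shows "(\<lambda>w. f (- w)) meromorphic_on {z}"
  by (rule meromorphic_on_compose[OF assms]) (auto intro!: analytic_intros)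

lemma jA_meromorphic: "Im \<tau> > 0 \<Longrightarrow> jA \<tau> meromorphic_on UNIV"
  unfolding meromorphic_on_meromorphic_at[of _ UNIV] jA_def
  by (intro ballI meromorphic_intros ee_meromorphic lambert_analytic_meromorphic meromorphic_on_uminus_arg) auto

lemma jB_meromorphic: "Im \<tau> > 0 \<Longrightarrow> jB \<tau> meromorphic_on UNIV"
  unfolding meromorphic_on_meromorphic_at[of _ UNIV] jB_def
  by (intro ballI meromorphic_intros lambert_analytic_meromorphic meromorphic_on_uminus_arg) auto

lemma jA_analytic: "Im \<tau> > 0 \<Longrightarrow> z \<notin> lattice \<tau> \<Longrightarrow> jA \<tau> analytic_on {z}"
  unfolding jA_def using Ints_subset_lattice
  by (intro analytic_intros lambert_analytic_meromorphic analytic_on_uminus_arg)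
    (auto simp: ee_eq_1_iff lattice_minus_iff)

lemma jB_analytic: "Im \<tau> > 0 \<Longrightarrow> z \<notin> lattice \<tau> \<Longrightarrow> jB \<tau> analytic_on {z}"
  unfolding jB_def
  by (intro analytic_intros lambert_analytic_meromorphic analytic_on_uminus_arg)
    (auto simp: lattice_minus_iff)

text \<open>In contrast to \<open>jA\<close> there is no fraction with poles at the integers, and
  the Lambert series start at \<open>r = 1\<close>, so that their poles lie outside the
  strip.\<close>

lemma jB_analytic_strip: "Im \<tau> > 0 \<Longrightarrow> \<bar>Im z\<bar> < Im \<tau> \<Longrightarrow> jB \<tau> analytic_on {z}"
  unfolding jB_def
  by (intro analytic_intros lambert_analytic_upper analytic_on_uminus_arg) auto

text \<open>Each Lambert series changes by one \<open>geom\<close> term. One of them cancels the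
  fraction at \<open>z + \<tau>\<close>, the other rebuilds the fraction at \<open>z\<close>, and
  the constants \<open>-1/2\<close> on either side of this exchange add up to
  \<open>-1\<close>.\<close>

lemma jA_add_tau:
  assumes "Im \<tau> > 0" "z \<notin> lattice \<tau>"
  shows "jA \<tau> (z + \<tau>) = jA \<tau> z - 1"
proof -
  have 1: "ee z \<noteq> 1" and 2: "ee (z + \<tau>) \<noteq> 1"
    using assms Ints_subset_lattice lattice_add_iff[of z 1 \<tau> 0] by (auto simp: ee_eq_1_iff)
  have 3: "lambert 0 \<tau> (- z) = lambert 0 \<tau> (- (z + \<tau>)) - geom (- z)"
    using lambert_0_shift[OF assms(1), of "- z - \<tau>"] by simp
  have 4: "geom (- z) = 1 / (ee z - 1)"
    using 1 by (simp add: geom_def ee_minus field_simps)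
  have 5: "(ee (z + \<tau>) + 1) / (2 * (ee (z + \<tau>) - 1)) = - 1 / 2 - geom (z + \<tau>)"
    using 2 by (simp add: geom_def divide_simps) (simp add: algebra_simps)
  have 6: "(ee z + 1) / (2 * (ee z - 1)) = 1 / (ee z - 1) + 1 / 2"
    using 1 by (simp add: divide_simps) (simp add: algebra_simps)
  show ?thesis
    unfolding jA_def 5 6 3 4 lambert_0_shift[OF assms(1)] by (simp add: algebra_simps)
qed

text \<open>The increment is that of \<open>A^2\<close> when \<open>A\<close> becomes
  \<open>A - 1\<close>. Hence \<open>A^2 - J_2\<close> is periodic, which is the basis of
  \<open>jB_eq\<close>.\<close>

lemma jB_add_tau:
  assumes "Im \<tau> > 0" "z \<notin> lattice \<tau>"
  shows "jB \<tau> (z + \<tau>) = jB \<tau> z - 2 * jA \<tau> z + 1"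
proof -
  have 1: "ee z \<noteq> 1"
    using assms Ints_subset_lattice by (auto simp: ee_eq_1_iff)
  have 3: "lambert 0 \<tau> (- z) = lambert 0 \<tau> (- (z + \<tau>)) - geom (- z)"
    using lambert_0_shift[OF assms(1), of "- z - \<tau>"] by simp
  have 4: "geom (- z) = 1 / (ee z - 1)"
    using 1 by (simp add: geom_def ee_minus field_simps)
  have 5: "lambert 1 \<tau> (- z) = lambert 1 \<tau> (- (z + \<tau>)) - lambert 0 \<tau> (- (z + \<tau>))"
    using lambert_1_shift[OF assms(1), of "- z - \<tau>"] by simp
  have 6: "(ee z + 1) / (2 * (ee z - 1)) = 1 / (ee z - 1) + 1 / 2"
    using 1 by (simp add: divide_simps) (simp add: algebra_simps)
  show ?thesis
    unfolding jA_def jB_def 6 lambert_1_shift[OF assms(1)] 5 3 4 by (simp add: algebra_simps)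
qed

lemma jA_add_int: "jA \<tau> (z + of_int n) = jA \<tau> z"
  using lambert_add_int[of 0 \<tau> z n] lambert_add_int[of 0 \<tau> "- z" "- n"]
  by (simp add: jA_def ee_add)

lemma jB_add_int: "jB \<tau> (z + of_int n) = jB \<tau> z"
  using lambert_add_int[of 1 \<tau> z n] lambert_add_int[of 1 \<tau> "- z" "- n"]
  by (simp add: jB_def)

lemma jA_add_lattice:
  assumes \<tau>: "Im \<tau> > 0" and z: "z \<notin> lattice \<tau>"
  shows "jA \<tau> (z + of_int l * \<tau> + of_int u) = jA \<tau> z - of_int l"
proof -
  have lat: "z + of_int l * \<tau> \<notin> lattice \<tau>" for l
    using lattice_add_iff[of z l \<tau> 0] z by simp
  have "jA \<tau> (z + of_int l * \<tau>) = jA \<tau> z - of_int l"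
  proof (induction l rule: int_induct[where k = 0])
    case (step1 l)
    have "jA \<tau> (z + of_int (l + 1) * \<tau>) = jA \<tau> (z + of_int l * \<tau>) - 1"
      using jA_add_tau[OF \<tau> lat[of l]] by (simp add: ring_distribs add.assoc)
    then show ?case using step1 by simp
  next
    case (step2 l)
    have eq: "z + of_int (l - 1) * \<tau> + \<tau> = z + of_int l * \<tau>" by (simp add: algebra_simps)
    have "jA \<tau> (z + of_int (l - 1) * \<tau>) = jA \<tau> (z + of_int l * \<tau>) + 1"
      using jA_add_tau[OF \<tau> lat[of "l - 1"]] unfolding eq by (metis diff_add_cancel)
    also have "\<dots> = jA \<tau> z - of_int (l - 1)" using step2.IH by simp
    finally show ?case .
  qed simp
  then show ?thesis by (simp add: jA_add_int)
qed

section \<open>Identification with the continued \<open>J\<close>\<close>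

lemma bernoulli_number_1_2: "bernoulli_number 1 = - 1 / 2" "bernoulli_number 2 = 1 / 6"
proof -
  define f where "f = fps_exp 1 - (1 :: complex fps)"
  define q where "q = fps_X / f"
  have f: "f $ 0 = 0" "f $ Suc 0 = 1" "f $ Suc (Suc 0) = 1 / 2" "f $ Suc (Suc (Suc 0)) = 1 / 6"
    by (simp_all add: f_def)
  \<comment> \<open>Exhibits \<open>f\<close> as \<open>fps_X\<close> times a unit, so that
    \<open>f\<close> divides \<open>fps_X\<close> and the formal quotient is a true one.\<close>
  have "f = fps_X * fps_shift 1 f"
    by (rule fps_ext) (use f(1) in \<open>auto simp: fps_X_mult_nth not_less\<close>)
  moreover have "fps_shift 1 f * inverse (fps_shift 1 f) = 1"
    using f by (intro inverse_mult_eq_1') simp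
  ultimately have "fps_X = f * inverse (fps_shift 1 f)"
    by (metis mult.assoc mult_1_right)
  then have "q * f = fps_X" unfolding q_def by (metis dvd_div_mult_self dvd_triv_left)
  then have nth: "(q * f) $ n = fps_X $ n" for n by simp
  have q0: "q $ 0 = 1"
    using nth[of 1] f by (simp add: fps_mult_nth)
  have q1: "q $ 1 = - 1 / 2"
    using nth[of 2] f q0 by (simp add: fps_mult_nth numeral_2_eq_2) (simp add: add_eq_0_iff)
  have q2: "q $ 2 = 1 / 12"
    using nth[of 3] f q0 q1 by (simp add: fps_mult_nth numeral_2_eq_2 numeral_3_eq_3)
  have "bernoulli_number n = fact n * q $ n" for n
    by (simp add: bernoulli_number_def q_def f_def)
  then show "bernoulli_number 1 = - 1 / 2" "bernoulli_number 2 = 1 / 6"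
    by (simp_all only: q1 q2) simp_all
qed

lemma J_series_eq:
  assumes w: "\<bar>Im w\<bar> < Im \<tau>"
  shows "w \<notin> \<int> \<Longrightarrow> J_series 1 w \<tau> = jA \<tau> w" "J_series 2 w \<tau> = jB \<tau> w"
proof -
  have \<tau>: "Im \<tau> > 0" using w by linarith
  have h1: "((\<lambda>(k, r). of_nat r ^ a * ee (of_nat k * (w + of_nat r * \<tau>))) has_sum lambert a \<tau> w)
      ({1::nat..} \<times> {1::nat..})" if "a \<le> 1" for a
    using w \<tau> that by (intro has_sum_lambert) auto
  have h2: "((\<lambda>(k, r). of_nat r ^ a * ee (of_nat k * (- w + of_nat r * \<tau>))) has_sum lambert a \<tau> (- w))
      ({1::nat..} \<times> {1::nat..})" if "a \<le> 1" for a
    using w \<tau> that by (intro has_sum_lambert) auto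
  have e: "ee (of_nat k * (w + of_nat r * \<tau>)) = ee w ^ k * ee \<tau> ^ (k * r)"
    "ee (of_nat k * (- w + of_nat r * \<tau>)) = inverse (ee w) ^ k * ee \<tau> ^ (k * r)" for k r
    by (simp_all add: ee_power ee_minus[symmetric] ring_distribs ee_add[symmetric] mult_ac)
  have "((\<lambda>(k, r). of_nat r powi (int 1 - 1) * (ee w ^ k + (- 1) ^ 1 * inverse (ee w) ^ k) * ee \<tau> ^ (k * r))
      has_sum (lambert 0 \<tau> w + - lambert 0 \<tau> (- w))) ({1::nat..} \<times> {1::nat..})"
    using has_sum_add[OF h1[of 0] has_sum_uminusI[OF h2[of 0]]]
    unfolding e case_prod_beta' by (simp add: ring_distribs)
  note s1 = infsumI[OF this]
  have "((\<lambda>(k, r). of_nat r powi (int 2 - 1) * (ee w ^ k + (- 1) ^ 2 * inverse (ee w) ^ k) * ee \<tau> ^ (k * r))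
      has_sum (lambert 1 \<tau> w + lambert 1 \<tau> (- w))) ({1::nat..} \<times> {1::nat..})"
    using has_sum_add[OF h1[of 1] h2[of 1]]
    unfolding e case_prod_beta' by (simp add: ring_distribs mult.assoc)
  note s2 = infsumI[OF this]
  show "J_series 2 w \<tau> = jB \<tau> w"
    unfolding J_series_def s2 bernoulli_number_1_2 by (simp add: jB_def)
  show "J_series 1 w \<tau> = jA \<tau> w" if "w \<notin> \<int>"
  proof -
    have "ee w / (ee w - 1) + - 1 / 2 = (ee w + 1) / (2 * (ee w - 1))"
      using that by (simp add: divide_simps flip: ee_eq_1_iff)
    then show ?thesis
      unfolding J_series_def s1 bernoulli_number_1_2 by (simp add: jA_def)
  qed
qed

lemma remove_sings_nicely_meromorphic_eq:
  "f nicely_meromorphic_on UNIV \<Longrightarrow> remove_sings f z = f z"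
  unfolding nicely_meromorphic_on_def using remove_sings_at_pole remove_sings_eqI by (metis UNIV_I)

text \<open>The identity theorem applies to the difference once its singularities are removed. A
  nicely meromorphic function is determined at every point, poles included, by its values nearby, so
  the agreement holds for all values.\<close>

lemma nicely_meromorphic_unique:
  assumes f: "f nicely_meromorphic_on UNIV" and g: "g nicely_meromorphic_on UNIV"
    and ev: "\<forall>\<^sub>F w in at w0. f w = g w"
  shows "f = g"
proof
  fix z
  define h where "h w = f w - g w" for w
  have h: "h meromorphic_on UNIV"
    using f g unfolding h_def nicely_meromorphic_on_def by (intro meromorphic_intros) auto
  have h_eq: "\<forall>\<^sub>F w in at z. remove_sings h w = h w" for z
    by (intro eventually_remove_sings_eq_at meromorphic_on_isolated_singularity meromorphic_on_subset[OF h]) auto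
  have "\<forall>\<^sub>F w in at w0. remove_sings h w = 0"
    using h_eq[of w0] ev by eventually_elim (simp add: h_def)
  then have "remove_sings h w = 0" for w
    by (intro frequently_eq_meromorphic_imp_constant[OF _ remove_sings_nicely_meromorphic[OF h]])
      (auto intro: eventually_frequently)
  then have "\<forall>\<^sub>F w in at z. f w = g w"
    using h_eq[of z] by (auto elim!: eventually_mono simp: h_def)
  then have "remove_sings f z = remove_sings g z" by (rule remove_sings_cong) simp
  then show "f z = g z" using f g by (simp add: remove_sings_nicely_meromorphic_eq)
qed

text \<open>Evaluates the definite description in \<open>J\<close>. Two candidates are compared on
  \<open>0 < Im w < Im \<tau>\<close>, where no integers occur and the exclusion for
  \<open>n = 1\<close> is automatic.\<close>

lemma J_eq_remove_sings:
  assumes \<tau>: "Im \<tau> > 0" and g: "g meromorphic_on UNIV"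
    and eq: "\<And>w. \<bar>Im w\<bar> < Im \<tau> \<Longrightarrow> (n = 1 \<longrightarrow> w \<notin> \<int>) \<Longrightarrow> g analytic_on {w} \<and> g w = J_series n w \<tau>"
  shows "J n z \<tau> = remove_sings g z"
proof -
  let ?P = "\<lambda>f. f nicely_meromorphic_on UNIV \<and>
     (\<forall>w. \<bar>Im w\<bar> < Im \<tau> \<longrightarrow> (n = 1 \<longrightarrow> w \<notin> \<int>) \<longrightarrow> f w = J_series n w \<tau>)"
  have P: "?P (remove_sings g)"
    using eq by (auto intro: remove_sings_nicely_meromorphic[OF g])
  have "(THE f. ?P f) = remove_sings g"
  proof (rule the_equality[where P = ?P, OF P])
    fix f assume f: "?P f"
    define S where "S = {w. 0 < Im w \<and> Im w < Im \<tau>}"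
    have "w \<notin> \<int>" if "w \<in> S" for w
      using that by (auto simp: S_def elim!: Ints_cases)
    then have S: "f w = remove_sings g w" if "w \<in> S" for w
      using f P that by (auto simp: S_def)
    have "\<forall>\<^sub>F w in at (\<i> * of_real (Im \<tau> / 2)). w \<in> S"
      by (rule eventually_at_in_open') (use \<tau> in \<open>auto simp: S_def open_strip\<close>)
    then have "\<forall>\<^sub>F w in at (\<i> * of_real (Im \<tau> / 2)). f w = remove_sings g w"
      by (rule eventually_mono) (rule S)
    then show "f = remove_sings g"
      using nicely_meromorphic_unique f P by blast
  qed
  then show ?thesis unfolding J_def by simp
qed

lemma J1_eq:
  assumes "Im \<tau> > 0"
  shows "J 1 z \<tau> = remove_sings (jA \<tau>) z"
proof (rule J_eq_remove_sings[OF assms jA_meromorphic[OF assms]])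
  fix w assume w: "\<bar>Im w\<bar> < Im \<tau>" "1 = 1 \<longrightarrow> w \<notin> \<int>"
  then have "w \<notin> lattice \<tau>" using lattice_Im by blast
  then show "jA \<tau> analytic_on {w} \<and> jA \<tau> w = J_series 1 w \<tau>"
    using J_series_eq(1)[OF w(1)] jA_analytic[OF assms] w by simp
qed

lemma J2_eq:
  assumes "Im \<tau> > 0"
  shows "J 2 z \<tau> = remove_sings (jB \<tau>) z"
proof (rule J_eq_remove_sings[OF assms jB_meromorphic[OF assms]])
  fix w assume w: "\<bar>Im w\<bar> < Im \<tau>"
  then show "jB \<tau> analytic_on {w} \<and> jB \<tau> w = J_series 2 w \<tau>"
    using J_series_eq(2)[OF w] jB_analytic_strip[OF assms w] by simp
qed

lemma J1_eq_jA: "Im \<tau> > 0 \<Longrightarrow> z \<notin> lattice \<tau> \<Longrightarrow> J 1 z \<tau> = jA \<tau> z"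
  using J1_eq jA_analytic by simp

lemma J2_eq_jB: "Im \<tau> > 0 \<Longrightarrow> z \<notin> lattice \<tau> \<Longrightarrow> J 2 z \<tau> = jB \<tau> z"
  by (simp add: J2_eq jB_analytic)

section \<open>Identities for \<open>J\<^sub>1\<close>, \<open>J\<^sub>2\<close> and \<open>E\<^sub>2\<close>\<close>

lemma closed_lattice:
  assumes "Im \<tau> > 0"
  shows "closed (lattice \<tau>)"
proof -
  have eq: "lattice \<tau> = {z. Im z / Im \<tau> \<in> \<int>} \<inter> {z. Re z - Im z / Im \<tau> * Re \<tau> \<in> \<int>}" (is "_ = ?R")
  proof (intro set_eqI iffI)
    fix z assume "z \<in> lattice \<tau>"
    then show "z \<in> ?R" using assms by (auto simp: lattice_def)
  next
    fix z assume "z \<in> ?R"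
    then have "Im z / Im \<tau> \<in> \<int>" "Re z - Im z / Im \<tau> * Re \<tau> \<in> \<int>" by blast+
    then obtain l u where "Im z / Im \<tau> = of_int l" "Re z - Im z / Im \<tau> * Re \<tau> = of_int u"
      by (metis Ints_cases)
    then have "Im z = of_int l * Im \<tau>" "Re z = of_int l * Re \<tau> + of_int u"
      using assms by (auto simp: field_simps)
    then have "z = of_int l * \<tau> + of_int u" by (simp add: complex_eq_iff)
    then show "z \<in> lattice \<tau>" by (auto simp: lattice_def)
  qed
  have cl: "closed {z. f z \<in> (\<int> :: real set)}" if "continuous_on UNIV f" for f :: "complex \<Rightarrow> real"
    using continuous_closed_vimage[OF closed_Ints, of f] that
    by (simp add: vimage_def continuous_on_eq_continuous_at)
  show ?thesis unfolding eq
    by (intro closed_Int cl continuous_intros) (use assms in auto)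
qed

lemma eventually_not_lattice:
  assumes \<tau>: "Im \<tau> > 0"
  shows "\<forall>\<^sub>F w in at z. w \<notin> lattice \<tau>"
proof (cases "z \<in> lattice \<tau>")
  case False
  then show ?thesis
    using eventually_at_in_open'[of "- lattice \<tau>" z] closed_lattice[OF \<tau>] by (simp add: open_closed)
next
  case True
  have "w \<notin> lattice \<tau>" if w: "w \<in> ball z (min 1 (Im \<tau>))" "w \<noteq> z" for w
  proof
    assume "w \<in> lattice \<tau>"
    obtain l u where z: "z = of_int l * \<tau> + of_int u" using True by (auto simp: lattice_def)
    have "w - z = w + of_int (- l) * \<tau> + of_int (- u)" by (simp add: z)
    then have "w - z \<in> lattice \<tau>" using \<open>w \<in> lattice \<tau>\<close> lattice_add_iff by metis
    moreover have n: "norm (w - z) < 1" "norm (w - z) < Im \<tau>"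
      using w by (auto simp: dist_norm norm_minus_commute)
    moreover have "\<bar>Im (w - z)\<bar> < Im \<tau>" using n abs_Im_le_cmod[of "w - z"] by linarith
    ultimately have "w - z \<in> \<int>" using lattice_Im by blast
    then obtain n where "w - z = of_int n" by (auto elim: Ints_cases)
    then have "w - z = 0" using n by auto
    then show False using w by simp
  qed
  then show ?thesis using \<tau>
    by (auto simp: eventually_at dist_commute intro!: exI[of _ "min 1 (Im \<tau>)"])
qed

text \<open>Filling in \<open>L\<close> at all lattice points gives an entire function, since
  periodicity carries the removable singularity at \<open>0\<close> to the others. It takes all its
  values on a compact period parallelogram, so Liouville's theorem applies.\<close>

lemma elliptic_constant:
  assumes \<tau>: "Im \<tau> > 0"
    and ana: "\<And>z. z \<notin> lattice \<tau> \<Longrightarrow> f analytic_on {z}"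
    and per1: "\<And>z. z \<notin> lattice \<tau> \<Longrightarrow> f (z + 1) = f z"
    and per\<tau>: "\<And>z. z \<notin> lattice \<tau> \<Longrightarrow> f (z + \<tau>) = f z"
    and lim: "f \<midarrow>0\<rightarrow> L"
    and z: "z \<notin> lattice \<tau>"
  shows "f z = L"
proof -
  define g where "g z = (if z \<in> lattice \<tau> then L else f z)" for z
  have g1: "g (z + 1) = g z" for z
    using per1[of z] lattice_add_iff[of z 0 \<tau> 1] by (simp add: g_def)
  have g\<tau>: "g (z + \<tau>) = g z" for z
    using per\<tau>[of z] lattice_add_iff[of z 1 \<tau> 0] by (simp add: g_def)
  have gl: "g (z + of_int l * \<tau>) = g z" for z l
  proof (induction l rule: int_induct[where k = 0])
    case (step1 l)
    then show ?case using g\<tau>[of "z + of_int l * \<tau>"] by (simp add: ring_distribs add.assoc)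
  next
    case (step2 l)
    have eq: "z + of_int (l - 1) * \<tau> + \<tau> = z + of_int l * \<tau>" by (simp add: ring_distribs)
    show ?case using g\<tau>[of "z + of_int (l - 1) * \<tau>"] step2.IH unfolding eq by simp
  qed simp
  have gu: "g (z + of_int u) = g z" for z u
  proof (induction u rule: int_induct[where k = 0])
    case (step1 u)
    then show ?case using g1[of "z + of_int u"] by (simp add: add.assoc)
  next
    case (step2 u)
    then show ?case using g1[of "z + of_int (u - 1)"] by simp
  qed simp
  have glu: "g (z + of_int l * \<tau> + of_int u) = g z" for z l u
    by (simp add: gl gu)
  have "isolated_singularity_at f 0"
  proof -
    obtain r where r: "r > 0" "\<And>w. w \<noteq> 0 \<Longrightarrow> dist w 0 < r \<Longrightarrow> w \<notin> lattice \<tau>"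
      using eventually_not_lattice[OF \<tau>, of 0] unfolding eventually_at by blast
    then have "f analytic_on ball 0 r - {0}"
      by (subst analytic_on_analytic_at) (auto intro!: ana simp: dist_commute)
    then show ?thesis using r unfolding isolated_singularity_at_def by blast
  qed
  from removable_singularity'[OF this lim]
  have "(\<lambda>y. if y = 0 then L else f y) analytic_on {0}" .
  moreover have "\<forall>\<^sub>F y in nhds 0. (if y = 0 then L else f y) = g y"
  proof -
    have "\<forall>\<^sub>F y in at 0. (if y = 0 then L else f y) = g y"
      using eventually_not_lattice[OF \<tau>, of 0] eventually_neq_at_within[of 0 0 UNIV]
      by eventually_elim (simp add: g_def)
    then show ?thesis
      using Ints_subset_lattice[OF Ints_0] by (simp add: eventually_nhds_conv_at g_def)
  qed
  ultimately have g0: "g analytic_on {0}" using analytic_at_cong[of "\<lambda>y. if y = 0 then L else f y" g 0 0] by simp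
  have "g analytic_on {z}" for z
  proof (cases "z \<in> lattice \<tau>")
    case True
    then obtain l u where z: "z = of_int l * \<tau> + of_int u" by (auto simp: lattice_def)
    have "g analytic_on {z + of_int (- l) * \<tau> + of_int (- u)}" using g0 by (simp add: z)
    then have "(\<lambda>w. g (w + (of_int (- l) * \<tau> + of_int (- u)))) analytic_on {z}"
      by (intro analytic_on_shift) (simp only: add.assoc)
    then show ?thesis using glu[of _ "- l" "- u"] by (simp only: add.assoc)
  next
    case False
    have "\<forall>\<^sub>F y in nhds z. f y = g y"
      using eventually_not_lattice[OF \<tau>, of z] False
      by (auto simp: eventually_nhds_conv_at g_def elim: eventually_mono)
    then show ?thesis using ana[OF False] analytic_at_cong[of f g z z] by blast
  qed
  then have "g analytic_on UNIV" using analytic_on_analytic_at by blast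
  then have hol: "g holomorphic_on UNIV" by (simp add: analytic_on_open)
  define K where "K = (\<lambda>(s, t). of_real s * \<tau> + of_real t) ` ({0..1} \<times> {0..1 :: real})"
  have "compact K" unfolding K_def
    by (intro compact_continuous_image compact_Times) (auto intro!: continuous_intros simp: case_prod_beta')
  then have "bounded (g ` K)"
    by (intro compact_imp_bounded compact_continuous_image
        holomorphic_on_imp_continuous_on holomorphic_on_subset[OF hol]) auto
  moreover have "range g \<subseteq> g ` K"
  proof safe
    fix z
    define s where "s = Im z / Im \<tau>"
    define t where "t = Re z - s * Re \<tau>"
    have z: "z = of_real s * \<tau> + of_real t"
      using \<tau> by (simp add: complex_eq_iff s_def t_def)
    have "z + of_int (- \<lfloor>s\<rfloor>) * \<tau> + of_int (- \<lfloor>t\<rfloor>) = of_real (frac s) * \<tau> + of_real (frac t)"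
      by (simp add: z frac_def algebra_simps)
    then have "g z = g (of_real (frac s) * \<tau> + of_real (frac t))"
      using glu[of z "- \<lfloor>s\<rfloor>" "- \<lfloor>t\<rfloor>"] by simp
    moreover have "of_real (frac s) * \<tau> + of_real (frac t) \<in> K"
      unfolding K_def by (intro image_eqI[of _ _ "(frac s, frac t)"]) (auto simp: frac_lt_1 less_imp_le)
    ultimately show "g z \<in> g ` K" by simp
  qed
  ultimately have "g constant_on UNIV"
    using Liouville_theorem[OF hol] bounded_subset by blast
  then have "g z = g 0" unfolding constant_on_def by auto
  then show ?thesis using z Ints_subset_lattice[OF Ints_0] by (simp add: g_def)
qed

text \<open>Setting \<open>n = k * r\<close> groups the double series by the divisors
  \<open>r\<close> of \<open>n\<close>.\<close>

lemma has_sum_sigma1: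
  assumes "Im \<tau> > 0"
  shows "((\<lambda>n. of_nat (sigma1 n) * ee \<tau> ^ n) has_sum lambert 1 \<tau> 0) {1..}"
proof -
  have "((\<lambda>(k, r). of_nat r ^ 1 * ee (of_nat k * (0 + of_nat r * \<tau>))) has_sum lambert 1 \<tau> 0)
      ({1::nat..} \<times> {1::nat..})"
    using assms by (intro has_sum_lambert) auto
  then have "((\<lambda>(n, r). of_nat r * ee \<tau> ^ n) has_sum lambert 1 \<tau> 0) (Sigma {1..} (\<lambda>n. {r. r dvd n}))"
    by (rule has_sum_reindex_bij_witness[where i = "\<lambda>(n, r). (n div r, r)" and j = "\<lambda>(k, r). (k * r, r)",
          THEN iffD1, rotated -1])
      (auto simp: ee_power dvd_div_eq_0_iff Suc_le_eq mult.assoc intro!: Nat.gr0I)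
  then show ?thesis
  proof (rule has_sum_SigmaD)
    fix n :: nat assume "n \<in> {1..}"
    then show "((\<lambda>r. case (n, r) of (n, r) \<Rightarrow> of_nat r * ee \<tau> ^ n) has_sum of_nat (sigma1 n) * ee \<tau> ^ n) {r. r dvd n}"
      by (intro has_sum_finiteI) (auto simp: sigma1_def sum_distrib_right)
  qed
qed

lemma E2_eq: "Im \<tau> > 0 \<Longrightarrow> E2 \<tau> = 1 - 24 * lambert 1 \<tau> 0"
  using infsumI[OF has_sum_sigma1[of \<tau>]] by (simp add: E2_def)

text \<open>With this value the two terms carrying \<open>m\<close> in the formula cancel at
  \<open>z = 0\<close>.\<close>

lemma jB_0: "Im \<tau> > 0 \<Longrightarrow> jB \<tau> 0 = E2 \<tau> / 6"
  by (simp add: jB_def E2_eq field_simps)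

text \<open>Differentiation multiplies a term by \<open>k\<close>; at \<open>z = 0\<close> the
  double series is symmetric in \<open>k\<close> and \<open>r\<close>, so this is the weight
  \<open>r\<close> of \<open>lambert 1\<close>.\<close>

lemma deriv_lambert_0:
  assumes \<tau>: "Im \<tau> > 0"
  shows "deriv (lambert 0 \<tau>) 0 = 2 * of_real pi * \<i> * lambert 1 \<tau> 0"
proof -
  define S where "S = {w. Im w > - Im \<tau>}"
  have S: "open S" "0 \<in> S" unfolding S_def using \<tau> by (auto simp: open_halfspace_Im_gt)
  have "((\<lambda>i. ee (of_nat (fst i * snd i) * \<tau>) * ee (of_int (int (fst i)) * w))
      has_sum lambert 0 \<tau> w) ({1..} \<times> {1..})" if "w \<in> S" for w
    using has_sum_lambert[of \<tau> w 0] that \<tau>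
    by (simp add: S_def case_prod_beta' ring_distribs ee_add mult_ac)
  from fourier_series_deriv(2)[OF S this]
  have "((\<lambda>i. of_nat (fst i) * ee (of_nat (fst i * snd i) * \<tau>))
      has_sum 1 / (2 * of_real pi * \<i>) * deriv (lambert 0 \<tau>) 0) ({1..} \<times> {1..})"
    by simp
  moreover have "((\<lambda>(k, r). of_nat r ^ 1 * ee (of_nat k * (0 + of_nat r * \<tau>))) has_sum lambert 1 \<tau> 0)
      ({1::nat..} \<times> {1::nat..})"
    using \<tau> by (intro has_sum_lambert) auto
  then have "((\<lambda>i. of_nat (fst i) * ee (of_nat (fst i * snd i) * \<tau>)) has_sum lambert 1 \<tau> 0) ({1..} \<times> {1..})"
    by (subst has_sum_swap) (simp add: case_prod_beta' mult_ac)
  ultimately have "1 / (2 * of_real pi * \<i>) * deriv (lambert 0 \<tau>) 0 = lambert 1 \<tau> 0"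
    using has_sum_unique by blast
  then show ?thesis by (simp add: field_simps)
qed

text \<open>The fraction is half the hyperbolic cotangent of \<open>x / 2\<close>, with expansion
  \<open>1/x + x/12 + ...\<close>.\<close>

lemma cot_regular_part:
  obtains h :: "complex \<Rightarrow> complex" where "h analytic_on {0}" "h 0 = 1 / 12"
    "\<And>x. x \<noteq> 0 \<Longrightarrow> exp x \<noteq> 1 \<Longrightarrow> (exp x + 1) / (2 * (exp x - 1)) = 1 / x + x * h x"
proof -
  \<comment> \<open>Numerator and denominator of \<open>h\<close> both vanish to order three, with
    leading coefficients \<open>1/6\<close> and \<open>2\<close>; their quotient is
    \<open>1/12\<close>.\<close>
  define F :: "complex fps" where "F = (fps_exp 1 + 1) * fps_X - fps_const 2 * (fps_exp 1 - 1)"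
  define G :: "complex fps" where "G = fps_const 2 * fps_X ^ 2 * (fps_exp 1 - 1)"
  define h where "h x = (if x = 0 then 1 / 12 else ((exp x + 1) * x - 2 * (exp x - 1)) / (2 * x ^ 2 * (exp x - 1)))"
    for x :: complex
  have F: "(\<lambda>x. (exp x + 1) * x - 2 * (exp x - 1)) has_fps_expansion F"
    unfolding F_def by (intro fps_expansion_intros)
  have G: "(\<lambda>x. 2 * x ^ 2 * (exp x - 1)) has_fps_expansion G"
    unfolding G_def by (intro fps_expansion_intros)
  have nG: "G $ n = (if n < 3 then 0 else 2 / fact (n - 2))" for n
    by (auto simp: G_def fps_X_power_mult_nth mult.assoc)
  have nF: "F $ n = 0" if "n < 3" for n
  proof -
    from that have "n = 0 \<or> n = 1 \<or> n = 2" by auto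
    then show ?thesis by (auto simp: F_def)
  qed
  have F3: "F $ 3 = 1 / 6" by (simp add: F_def fact_numeral)
  have sG: "subdegree G = 3" by (rule subdegreeI) (auto simp: nG)
  have sF: "subdegree F = 3" by (rule subdegreeI) (auto simp: nF F3)
  have "h has_fps_expansion (F / G)"
    unfolding h_def
    by (intro has_fps_expansion_divide[OF F G]) (use sG sF F3 nG[of 3] in auto)
  then have "h analytic_on {0}" by (rule has_fps_expansion_imp_analytic_0)
  moreover have "(exp x + 1) / (2 * (exp x - 1)) = 1 / x + x * h x" if "x \<noteq> 0" "exp x \<noteq> 1" for x
    using that by (simp add: h_def divide_simps power2_eq_square)
  ultimately show ?thesis using that[of h] by (simp add: h_def)
qed

text \<open>There is no constant term because the function is odd. The linear coefficient combines
  \<open>1/12\<close> from the fraction with \<open>-2 * lambert 1 \<tau> 0\<close> from the Lambert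
  part, which together make \<open>E2 \<tau> / 12\<close>.\<close>

lemma jA_local:
  assumes \<tau>: "Im \<tau> > 0"
  obtains Y r where "r > 0" "Y holomorphic_on ball 0 r" "Y 0 = E2 \<tau> / 12"
    "\<And>z. z \<in> ball 0 r - {0} \<Longrightarrow> z \<notin> lattice \<tau> \<and>
        jA \<tau> z = 1 / (2 * of_real pi * \<i> * z) + 2 * of_real pi * \<i> * z * Y z"
proof -
  define \<kappa> where "\<kappa> = 2 * of_real pi * \<i>"
  have \<kappa>: "\<kappa> \<noteq> 0" by (simp add: \<kappa>_def)
  obtain h where h: "h analytic_on {0}" "h 0 = 1 / 12"
    "\<And>x. x \<noteq> 0 \<Longrightarrow> exp x \<noteq> 1 \<Longrightarrow> (exp x + 1) / (2 * (exp x - 1)) = 1 / x + x * h x"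
    by (rule cot_regular_part) blast
  define V where "V z = lambert 0 \<tau> z - lambert 0 \<tau> (- z)" for z
  have l: "lambert 0 \<tau> analytic_on {0}" using \<tau> by (intro lambert_analytic_upper) auto
  have V: "V analytic_on {0}"
    unfolding V_def by (intro analytic_intros l analytic_on_uminus_arg) (simp add: l)
  \<comment> \<open>The difference quotient of \<open>V\<close> at \<open>0\<close>, not its
    derivative; as \<open>V 0 = 0\<close>, it divides \<open>V\<close> by \<open>z\<close>.\<close>
  define V' where "V' z = (if z = 0 then deriv V 0 else (V z - V 0) / (z - 0))" for z
  have V': "V' analytic_on {0}"
  proof -
    obtain S where "open S" "0 \<in> S" "V holomorphic_on S" using V analytic_at by blast
    then have "V' holomorphic_on S" unfolding V'_def by (intro pole_lemma_open)
    then show ?thesis using \<open>open S\<close> \<open>0 \<in> S\<close> analytic_at by blast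
  qed
  have dV: "deriv V 0 = 2 * \<kappa> * lambert 1 \<tau> 0"
  proof -
    have d: "(lambert 0 \<tau> has_field_derivative deriv (lambert 0 \<tau>) 0) (at 0)"
      using l analytic_on_imp_differentiable_at DERIV_deriv_iff_field_differentiable by blast
    have "(V has_field_derivative deriv (lambert 0 \<tau>) 0 - deriv (lambert 0 \<tau>) 0 * - 1) (at 0)"
      unfolding V_def
      by (intro DERIV_diff d DERIV_chain2[where f = "lambert 0 \<tau>" and g = uminus])
        (auto intro!: derivative_eq_intros simp: d)
    then show ?thesis by (simp add: DERIV_imp_deriv deriv_lambert_0[OF \<tau>] \<kappa>_def)
  qed
  define Y where "Y z = h (\<kappa> * z) - V' z / \<kappa>" for z
  have "(h \<circ> (\<lambda>z. \<kappa> * z)) analytic_on {0}"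
    by (rule analytic_on_compose_gen[OF _ h(1)]) (auto intro!: analytic_intros)
  then have Y: "Y analytic_on {0}"
    unfolding Y_def o_def by (intro analytic_intros V') (use \<kappa> in auto)
  have Y0: "Y 0 = E2 \<tau> / 12"
    using \<kappa> by (simp add: Y_def V'_def dV h(2) E2_eq[OF \<tau>] field_simps)
  obtain S where S: "open S" "0 \<in> S" "Y holomorphic_on S" using Y analytic_at by blast
  obtain r1 where r1: "r1 > 0" "ball 0 r1 \<subseteq> S" using S open_contains_ball by blast
  obtain r2 where r2: "r2 > 0" "\<And>w. w \<noteq> 0 \<Longrightarrow> dist w 0 < r2 \<Longrightarrow> w \<notin> lattice \<tau>"
    using eventually_not_lattice[OF \<tau>, of 0] unfolding eventually_at by blast
  have eq: "z \<notin> lattice \<tau> \<and> jA \<tau> z = 1 / (2 * of_real pi * \<i> * z) + 2 * of_real pi * \<i> * z * Y z"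
    if z: "z \<in> ball 0 (min r1 r2) - {0}" for z
  proof -
    have lat: "z \<notin> lattice \<tau>" using z r2 by (auto simp: dist_commute)
    then have "exp (\<kappa> * z) \<noteq> 1"
      using ee_eq_1_iff[of z] Ints_subset_lattice[of z \<tau>] by (auto simp: ee_def \<kappa>_def)
    then have "(ee z + 1) / (2 * (ee z - 1)) = 1 / (\<kappa> * z) + \<kappa> * z * h (\<kappa> * z)"
      using h(3)[of "\<kappa> * z"] z \<kappa> by (simp add: ee_def \<kappa>_def)
    moreover have "V z = z * V' z" using z by (simp add: V'_def V_def)
    ultimately have "jA \<tau> z = 1 / (\<kappa> * z) + \<kappa> * z * Y z"
      using \<kappa> by (simp add: jA_def Y_def V_def algebra_simps)
    then show ?thesis using lat by (simp add: \<kappa>_def)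
  qed
  have "Y holomorphic_on ball 0 (min r1 r2)"
    by (rule holomorphic_on_subset[OF S(3)]) (use r1 in auto)
  then show ?thesis
    by (intro that[of "min r1 r2" Y]) (use r1 r2 eq Y0 in auto)
qed


section \<open>Modular laws of \<open>A\<close> and \<open>E_2\<close>\<close>

locale modular_matrix =
  fixes a b c d :: int and \<tau> j \<tau>' :: complex
  assumes det: "a * d - b * c = 1" and Im_\<tau>: "Im \<tau> > 0"
  defines "j \<equiv> of_int c * \<tau> + of_int d"
  defines "\<tau>' \<equiv> (of_int a * \<tau> + of_int b) / j"
begin

lemma det': "of_int a * of_int d - of_int b * of_int c = (1 :: complex)"
  using det by (metis of_int_1 of_int_diff of_int_mult)

lemma j_nz: "j \<noteq> 0"
proof
  assume "j = 0"
  then have "Im j = 0" "Re j = 0" by auto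
  then have "c = 0" "d = 0" using Im_\<tau> by (auto simp: j_def)
  then show False using det by simp
qed

lemma Im_\<tau>': "Im \<tau>' > 0"
proof -
  have 1: "real_of_int a * real_of_int d - real_of_int b * real_of_int c = 1"
    using det by (metis of_int_1 of_int_diff of_int_mult)
  have "Im (of_int a * \<tau> + of_int b) * Re j - Re (of_int a * \<tau> + of_int b) * Im j =
      (real_of_int a * real_of_int d - real_of_int b * real_of_int c) * Im \<tau>"
    by (simp add: j_def algebra_simps)
  also have "\<dots> = Im \<tau>" by (simp only: 1 mult_1)
  finally have "Im \<tau>' = Im \<tau> / (norm j)\<^sup>2"
    by (simp add: \<tau>'_def Im_divide cmod_power2)
  then show ?thesis using Im_\<tau> j_nz by simp
qed

text \<open>The new coordinates are the row \<open>(l, u)\<close> times the inverse matrix, by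
  \<open>det = 1\<close>.\<close>

lemma period_divide:
  "(z + of_int l * \<tau> + of_int u) / j =
    z / j + of_int (l * d - u * c) * \<tau>' + of_int (u * a - l * b)"
proof -
  have "x * \<tau>' + y = (x * (of_int a * \<tau> + of_int b) + y * j) / j" for x y
    using j_nz by (simp add: \<tau>'_def field_simps)
  then have "of_int (l * d - u * c) * \<tau>' + of_int (u * a - l * b) =
      (of_int (l * d - u * c) * (of_int a * \<tau> + of_int b) + of_int (u * a - l * b) * j) / j"
    by blast
  also have "of_int (l * d - u * c) * (of_int a * \<tau> + of_int b) + of_int (u * a - l * b) * j =
      (of_int l * \<tau> + of_int u) * (of_int a * of_int d - of_int b * of_int c)"
    by (simp add: j_def algebra_simps)
  finally show ?thesis by (simp add: det' add_divide_distrib)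
qed

lemma lattice_divide_iff: "z / j \<in> lattice \<tau>' \<longleftrightarrow> z \<in> lattice \<tau>"
proof
  assume "z \<in> lattice \<tau>"
  then obtain l u where "z = 0 + of_int l * \<tau> + of_int u" by (auto simp: lattice_def)
  then have "z / j = of_int (l * d - u * c) * \<tau>' + of_int (u * a - l * b)"
    using period_divide[of 0 l u] by simp
  then show "z / j \<in> lattice \<tau>'"
    unfolding lattice_def by blast
next
  assume "z / j \<in> lattice \<tau>'"
  then obtain l u where "z / j = of_int l * \<tau>' + of_int u" by (auto simp: lattice_def)
  then have "z = (of_int l * \<tau>' + of_int u) * j" using j_nz by (simp add: field_simps)
  also have "\<dots> = of_int l * (of_int a * \<tau> + of_int b) + of_int u * j"
    using j_nz by (simp add: \<tau>'_def field_simps)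
  also have "\<dots> = of_int (l * a + u * c) * \<tau> + of_int (l * b + u * d)"
    by (simp add: j_def algebra_simps)
  finally show "z \<in> lattice \<tau>" unfolding lattice_def by blast
qed

text \<open>Under a period, \<open>jA \<tau>'\<close> and the term \<open>c * z\<close> together
  change by \<open>- l * j\<close>, so after division by \<open>j\<close> the difference with
  \<open>jA \<tau>\<close> is elliptic. The simple poles at \<open>0\<close> have equal principal
  parts, and without constant terms the difference tends to \<open>0\<close> there.\<close>

lemma jA_modular:
  assumes z: "z \<notin> lattice \<tau>"
  shows "jA \<tau>' (z / j) = j * jA \<tau> z + of_int c * z"
proof -
  define f where "f z = (jA \<tau>' (z / j) - of_int c * z) / j - jA \<tau> z" for z
  have per: "f (z + of_int l * \<tau> + of_int u) = f z" if z: "z \<notin> lattice \<tau>" for z l u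
  proof -
    have 1: "jA \<tau>' ((z + of_int l * \<tau> + of_int u) / j) = jA \<tau>' (z / j) - of_int (l * d - u * c)"
      unfolding period_divide using z lattice_divide_iff by (intro jA_add_lattice Im_\<tau>') blast
    have 2: "jA \<tau> (z + of_int l * \<tau> + of_int u) = jA \<tau> z - of_int l"
      using z by (intro jA_add_lattice Im_\<tau>)
    have 3: "w - of_int (l * d - u * c) - of_int c * (z + of_int l * \<tau> + of_int u) = w - of_int c * z - of_int l * j" for w
      by (simp add: j_def algebra_simps)
    show ?thesis
      unfolding f_def 1 2 3 using j_nz by (simp add: diff_divide_distrib)
  qed
  have ana: "f analytic_on {z}" if z: "z \<notin> lattice \<tau>" for z
  proof -
    have "(jA \<tau>' \<circ> (\<lambda>z. z / j)) analytic_on {z}"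
      by (rule analytic_on_compose_gen[where T = "{z / j}"])
        (use z j_nz lattice_divide_iff Im_\<tau>' in \<open>auto intro!: analytic_intros jA_analytic\<close>)
    then show ?thesis unfolding f_def o_def
      by (intro analytic_intros jA_analytic Im_\<tau> z) (use j_nz in auto)
  qed
  obtain Y r where Y: "r > 0" "Y holomorphic_on ball 0 r"
    "\<And>z. z \<in> ball 0 r - {0} \<Longrightarrow> z \<notin> lattice \<tau> \<and>
        jA \<tau> z = 1 / (2 * of_real pi * \<i> * z) + 2 * of_real pi * \<i> * z * Y z"
    by (rule jA_local[OF Im_\<tau>]) blast
  obtain Y' r' where Y': "r' > 0" "Y' holomorphic_on ball 0 r'"
    "\<And>z. z \<in> ball 0 r' - {0} \<Longrightarrow> z \<notin> lattice \<tau>' \<and>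
        jA \<tau>' z = 1 / (2 * of_real pi * \<i> * z) + 2 * of_real pi * \<i> * z * Y' z"
    by (rule jA_local[OF Im_\<tau>']) blast
  have tY: "Y \<midarrow>0\<rightarrow> Y 0" using Y(1,2)
    by (intro isContD) (auto simp: continuous_on_eq_continuous_at dest!: holomorphic_on_imp_continuous_on)
  have cY': "isCont Y' 0" using Y'(1,2)
    by (auto simp: continuous_on_eq_continuous_at dest!: holomorphic_on_imp_continuous_on)
  have "((\<lambda>z. z / j) \<longlongrightarrow> 0 / j) (at 0)" by (intro tendsto_intros) (use j_nz in auto)
  then have zj: "((\<lambda>z. z / j) \<longlongrightarrow> 0) (at 0)" by simp
  have tY': "((\<lambda>z. Y' (z / j)) \<longlongrightarrow> Y' 0) (at 0)" by (rule isCont_tendsto_compose[OF cY' zj])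
  have "((\<lambda>z. (2 * of_real pi * \<i> * z / j * Y' (z / j) - of_int c * z) / j - 2 * of_real pi * \<i> * z * Y z)
      \<longlongrightarrow> (2 * of_real pi * \<i> * 0 / j * Y' 0 - of_int c * 0) / j - 2 * of_real pi * \<i> * 0 * Y 0) (at 0)"
    by (intro tendsto_intros tY tY') (use j_nz in auto)
  then have "((\<lambda>z. (2 * of_real pi * \<i> * z / j * Y' (z / j) - of_int c * z) / j - 2 * of_real pi * \<i> * z * Y z) \<longlongrightarrow> 0) (at 0)"
    by simp
  moreover have "\<forall>\<^sub>F z in at 0. f z = (2 * of_real pi * \<i> * z / j * Y' (z / j) - of_int c * z) / j - 2 * of_real pi * \<i> * z * Y z"
  proof -
    have "\<forall>\<^sub>F z in at 0. z \<in> ball 0 r" using Y(1) by (intro eventually_at_in_open') auto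
    moreover have "\<forall>\<^sub>F z in at 0. z / j \<in> ball 0 r'"
      using topological_tendstoD[OF zj, of "ball 0 r'"] Y'(1) by auto
    ultimately show ?thesis using eventually_neq_at_within[of 0 0 UNIV]
    proof eventually_elim
      case (elim z)
      then have "jA \<tau> z = 1 / (2 * of_real pi * \<i> * z) + 2 * of_real pi * \<i> * z * Y z" using Y(3) by blast
      moreover have "jA \<tau>' (z / j) = 1 / (2 * of_real pi * \<i> * (z / j)) + 2 * of_real pi * \<i> * (z / j) * Y' (z / j)"
        using Y'(3)[of "z / j"] elim j_nz by simp
      ultimately show ?case using elim j_nz
        by (simp add: f_def add_divide_distrib diff_divide_distrib)
    qed
  qed
  ultimately have lim: "f \<midarrow>0\<rightarrow> 0" using tendsto_cong by fastforce
  have "f z = 0"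
    by (rule elliptic_constant[OF Im_\<tau> ana _ _ lim z]) (use per[of _ 0 1] per[of _ 1 0] in auto)
  then show ?thesis using j_nz by (simp add: f_def field_simps)
qed

text \<open>Obtained from \<open>jA_modular\<close> by comparing the coefficients of
  \<open>z\<close>: the summand \<open>c * z\<close> is the source of the defect, and
  \<open>12\<close> comes from \<open>Y 0 = E2 \<tau> / 12\<close>.\<close>

lemma E2_modular: "E2 \<tau>' = j\<^sup>2 * E2 \<tau> + 12 * of_int c * j / (2 * of_real pi * \<i>)"
proof -
  define \<kappa> where "\<kappa> = 2 * of_real pi * \<i>"
  have \<kappa>: "\<kappa> \<noteq> 0" by (simp add: \<kappa>_def)
  obtain Y r where Y: "r > 0" "Y holomorphic_on ball 0 r" "Y 0 = E2 \<tau> / 12"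
    "\<And>z. z \<in> ball 0 r - {0} \<Longrightarrow> z \<notin> lattice \<tau> \<and> jA \<tau> z = 1 / (\<kappa> * z) + \<kappa> * z * Y z"
    unfolding \<kappa>_def by (rule jA_local[OF Im_\<tau>]) blast
  obtain Y' r' where Y': "r' > 0" "Y' holomorphic_on ball 0 r'" "Y' 0 = E2 \<tau>' / 12"
    "\<And>z. z \<in> ball 0 r' - {0} \<Longrightarrow> z \<notin> lattice \<tau>' \<and> jA \<tau>' z = 1 / (\<kappa> * z) + \<kappa> * z * Y' z"
    unfolding \<kappa>_def by (rule jA_local[OF Im_\<tau>']) blast
  have tY: "Y \<midarrow>0\<rightarrow> Y 0" using Y(1,2)
    by (intro isContD) (auto simp: continuous_on_eq_continuous_at dest!: holomorphic_on_imp_continuous_on)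
  have cY': "isCont Y' 0" using Y'(1,2)
    by (auto simp: continuous_on_eq_continuous_at dest!: holomorphic_on_imp_continuous_on)
  have "((\<lambda>z. z / j) \<longlongrightarrow> 0 / j) (at 0)" by (intro tendsto_intros) (use j_nz in auto)
  then have zj: "((\<lambda>z. z / j) \<longlongrightarrow> 0) (at 0)" by simp
  have tY': "((\<lambda>z. Y' (z / j)) \<longlongrightarrow> Y' 0) (at 0)" by (rule isCont_tendsto_compose[OF cY' zj])
  have "((\<lambda>z. j\<^sup>2 * Y z + of_int c * j / \<kappa>) \<longlongrightarrow> j\<^sup>2 * Y 0 + of_int c * j / \<kappa>) (at 0)"
    by (intro tendsto_intros tY)
  moreover have "\<forall>\<^sub>F z in at 0. Y' (z / j) = j\<^sup>2 * Y z + of_int c * j / \<kappa>"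
  proof -
    have "\<forall>\<^sub>F z in at 0. z \<in> ball 0 r" using Y(1) by (intro eventually_at_in_open') auto
    moreover have "\<forall>\<^sub>F z in at 0. z / j \<in> ball 0 r'"
      using topological_tendstoD[OF zj, of "ball 0 r'"] Y'(1) by auto
    ultimately show ?thesis using eventually_neq_at_within[of 0 0 UNIV]
    proof eventually_elim
      case (elim z)
      then have z: "z \<notin> lattice \<tau>" "jA \<tau> z = 1 / (\<kappa> * z) + \<kappa> * z * Y z" using Y(4) by blast+
      moreover have "jA \<tau>' (z / j) = 1 / (\<kappa> * (z / j)) + \<kappa> * (z / j) * Y' (z / j)"
        using Y'(4)[of "z / j"] elim j_nz by simp
      ultimately have "1 / (\<kappa> * (z / j)) + \<kappa> * (z / j) * Y' (z / j) = j * (1 / (\<kappa> * z) + \<kappa> * z * Y z) + of_int c * z"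
        using jA_modular[OF z(1)] by simp
      then have "\<kappa> * (z / j) * Y' (z / j) = j * (\<kappa> * z * Y z) + of_int c * z"
        using elim j_nz \<kappa> by (simp add: ring_distribs)
      then have "(\<kappa> * z / j) * Y' (z / j) = (\<kappa> * z / j) * (j\<^sup>2 * Y z + of_int c * j / \<kappa>)"
        using j_nz \<kappa> by (simp add: field_simps power2_eq_square)
      then show ?case using elim j_nz \<kappa> by (subst (asm) mult_cancel_left) auto
    qed
  qed
  ultimately have "((\<lambda>z. Y' (z / j)) \<longlongrightarrow> j\<^sup>2 * Y 0 + of_int c * j / \<kappa>) (at 0)"
    using tendsto_cong by fastforce
  then have "Y' 0 = j\<^sup>2 * Y 0 + of_int c * j / \<kappa>"
    using tY' tendsto_unique trivial_limit_at by blast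
  then show ?thesis unfolding Y(3) Y'(3) \<kappa>_def[symmetric] by (simp add: field_simps)
qed

end

lemma deriv_jA_add_lattice:
  assumes \<tau>: "Im \<tau> > 0" and z: "z \<notin> lattice \<tau>"
  shows "deriv (jA \<tau>) (z + of_int l * \<tau> + of_int u) = deriv (jA \<tau>) z"
proof -
  have "\<forall>\<^sub>F w in nhds z. w \<notin> lattice \<tau>"
    using eventually_not_lattice[OF \<tau>, of z] z by (simp add: eventually_nhds_conv_at)
  then have ev: "\<forall>\<^sub>F w in nhds z. jA \<tau> (w + (of_int l * \<tau> + of_int u)) = jA \<tau> w - of_int l"
    by eventually_elim (use jA_add_lattice[OF \<tau>] in \<open>simp add: add.assoc\<close>)
  have d: "(jA \<tau> has_field_derivative deriv (jA \<tau>) w) (at w)" if "w \<notin> lattice \<tau>" for w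
    using jA_analytic[OF \<tau> that] analytic_on_imp_differentiable_at DERIV_deriv_iff_field_differentiable by blast
  have "((\<lambda>w. jA \<tau> w - of_int l) has_field_derivative deriv (jA \<tau>) z) (at z)"
    using d[OF z] by (auto intro!: derivative_eq_intros)
  moreover have "((\<lambda>w. jA \<tau> (w + (of_int l * \<tau> + of_int u))) has_field_derivative
      deriv (jA \<tau>) (z + (of_int l * \<tau> + of_int u))) (at z)"
    using d[of "z + of_int l * \<tau> + of_int u"] z unfolding lattice_add_iff
    by (simp add: DERIV_shift add.assoc)
  ultimately show ?thesis
    using DERIV_cong_ev[OF refl ev refl] DERIV_unique by (metis add.assoc)
qed

text \<open>The derivative of \<open>A\<close> is elliptic, and \<open>A^2\<close> and
  \<open>J_2\<close> have the same increments, so the combination is elliptic. At \<open>0\<close>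
  the double pole of \<open>A^2\<close> cancels against that of the derivative. In terms of theta,
  \<open>A' + A^2\<close> is the second derivative of \<open>\<theta>_1\<close> divided by
  \<open>\<theta>_1\<close>.\<close>

lemma jB_eq:
  assumes \<tau>: "Im \<tau> > 0" and z: "z \<notin> lattice \<tau>"
  shows "jB \<tau> z = 1 / (2 * of_real pi * \<i>) * deriv (jA \<tau>) z + (jA \<tau> z)\<^sup>2 - E2 \<tau> / 12"
proof -
  define \<kappa> where "\<kappa> = 2 * of_real pi * \<i>"
  have \<kappa>: "\<kappa> \<noteq> 0" by (simp add: \<kappa>_def)
  define f where "f z = 1 / \<kappa> * deriv (jA \<tau>) z + (jA \<tau> z)\<^sup>2 - jB \<tau> z" for z
  have ana: "f analytic_on {z}" if "z \<notin> lattice \<tau>" for z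
    unfolding f_def by (intro analytic_intros jA_analytic jB_analytic \<tau> that) (use \<kappa> in auto)
  have per1: "f (z + 1) = f z" if "z \<notin> lattice \<tau>" for z
    using deriv_jA_add_lattice[OF \<tau> that, of 0 1] jA_add_int[of \<tau> z 1] jB_add_int[of \<tau> z 1] by (simp add: f_def)
  have per\<tau>: "f (z + \<tau>) = f z" if "z \<notin> lattice \<tau>" for z
  proof -
    have "deriv (jA \<tau>) (z + \<tau>) = deriv (jA \<tau>) z" using deriv_jA_add_lattice[OF \<tau> that, of 1 0] by simp
    then show ?thesis
      unfolding f_def jA_add_tau[OF \<tau> that] jB_add_tau[OF \<tau> that]
      by (simp add: power2_eq_square algebra_simps)
  qed
  obtain Y r where Y: "r > 0" "Y holomorphic_on ball 0 r" "Y 0 = E2 \<tau> / 12"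
    "\<And>z. z \<in> ball 0 r - {0} \<Longrightarrow> z \<notin> lattice \<tau> \<and> jA \<tau> z = 1 / (\<kappa> * z) + \<kappa> * z * Y z"
    unfolding \<kappa>_def by (rule jA_local[OF \<tau>]) blast
  have tY: "Y \<midarrow>0\<rightarrow> Y 0" using Y(1,2)
    by (intro isContD) (auto simp: continuous_on_eq_continuous_at dest!: holomorphic_on_imp_continuous_on)
  have tdY: "deriv Y \<midarrow>0\<rightarrow> deriv Y 0" using Y(1) holomorphic_deriv[OF Y(2)]
    by (intro isContD) (auto simp: continuous_on_eq_continuous_at dest!: holomorphic_on_imp_continuous_on)
  have tB: "jB \<tau> \<midarrow>0\<rightarrow> jB \<tau> 0"
    by (intro isContD analytic_at_imp_isCont jB_analytic_strip) (use \<tau> in auto)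
  \<comment> \<open>One \<open>Y\<close> comes from the derivative and two from the cross term of
    the square. The constant is thus \<open>E2/4 - E2/6 = E2/12\<close>.\<close>
  have "((\<lambda>z. 3 * Y z + z * deriv Y z + \<kappa>\<^sup>2 * z\<^sup>2 * (Y z)\<^sup>2 - jB \<tau> z) \<longlongrightarrow>
      3 * Y 0 + 0 * deriv Y 0 + \<kappa>\<^sup>2 * 0\<^sup>2 * (Y 0)\<^sup>2 - jB \<tau> 0) (at 0)"
    by (intro tendsto_intros tY tdY tB)
  then have "((\<lambda>z. 3 * Y z + z * deriv Y z + \<kappa>\<^sup>2 * z\<^sup>2 * (Y z)\<^sup>2 - jB \<tau> z) \<longlongrightarrow> E2 \<tau> / 12) (at 0)"
    by (simp add: Y(3) jB_0[OF \<tau>])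
  moreover have "\<forall>\<^sub>F z in at 0. f z = 3 * Y z + z * deriv Y z + \<kappa>\<^sup>2 * z\<^sup>2 * (Y z)\<^sup>2 - jB \<tau> z"
  proof -
    have "\<forall>\<^sub>F z in at 0. z \<in> ball 0 r" using Y(1) by (intro eventually_at_in_open') auto
    then show ?thesis using eventually_neq_at_within[of 0 0 UNIV]
    proof eventually_elim
      case (elim z)
      have "(Y has_field_derivative deriv Y z) (at z)"
        using Y(2) elim holomorphic_derivI[OF Y(2) open_ball] by blast
      then have h1: "((\<lambda>z. 1 / (\<kappa> * z) + \<kappa> * z * Y z) has_field_derivative
          (- 1 / (\<kappa> * z\<^sup>2) + \<kappa> * Y z + \<kappa> * z * deriv Y z)) (at z)"
        using elim \<kappa> by (auto intro!: derivative_eq_intros simp: power2_eq_square field_simps)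
      have "\<forall>\<^sub>F w in nhds z. w \<in> ball 0 r - {0}"
        using elim by (intro eventually_nhds_in_open) auto
      then have ev: "\<forall>\<^sub>F w in nhds z. 1 / (\<kappa> * w) + \<kappa> * w * Y w = jA \<tau> w"
        by eventually_elim (use Y(4) in force)
      have "(jA \<tau> has_field_derivative (- 1 / (\<kappa> * z\<^sup>2) + \<kappa> * Y z + \<kappa> * z * deriv Y z)) (at z)"
        by (rule DERIV_cong_ev[OF refl ev refl, THEN iffD1, OF h1])
      then have "deriv (jA \<tau>) z = - 1 / (\<kappa> * z\<^sup>2) + \<kappa> * Y z + \<kappa> * z * deriv Y z"
        by (rule DERIV_imp_deriv)
      moreover have "jA \<tau> z = 1 / (\<kappa> * z) + \<kappa> * z * Y z" using Y(4) elim by blast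
      moreover have "1 / \<kappa> * (- 1 / (\<kappa> * z\<^sup>2) + \<kappa> * y + \<kappa> * z * d) = - (1 / (\<kappa> * z)\<^sup>2) + y + z * d" for y d
        using elim \<kappa> by (simp add: field_simps power2_eq_square)
      moreover have "(1 / x + x * y)\<^sup>2 = 1 / x\<^sup>2 + 2 * y + x\<^sup>2 * y\<^sup>2" if "x \<noteq> 0" for x y :: complex
        using that by (simp add: field_simps power2_eq_square)
      ultimately show ?case using elim \<kappa>
        by (simp add: f_def power_mult_distrib)
    qed
  qed
  ultimately have lim: "f \<midarrow>0\<rightarrow> E2 \<tau> / 12" using tendsto_cong by fastforce
  have "f z = E2 \<tau> / 12" by (rule elliptic_constant[OF \<tau> ana per1 per\<tau> lim z])
  then show ?thesis unfolding \<kappa>_def[symmetric] f_def by (simp only: eq_diff_eq diff_eq_eq add_ac)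
qed

lemma (in modular_matrix) deriv_jA_modular:
  assumes z: "z \<notin> lattice \<tau>"
  shows "deriv (jA \<tau>') (z / j) = j * (j * deriv (jA \<tau>) z + of_int c)"
proof -
  have "\<forall>\<^sub>F w in nhds z. w \<notin> lattice \<tau>"
    using eventually_not_lattice[OF Im_\<tau>, of z] z by (simp add: eventually_nhds_conv_at)
  then have ev: "\<forall>\<^sub>F w in nhds z. jA \<tau>' (w / j) = j * jA \<tau> w + of_int c * w"
    by eventually_elim (rule jA_modular)
  have d: "(jA t has_field_derivative deriv (jA t) w) (at w)" if "Im t > 0" "w \<notin> lattice t" for t w
    using jA_analytic[OF that] analytic_on_imp_differentiable_at DERIV_deriv_iff_field_differentiable by blast
  have "((\<lambda>w. w / j) has_field_derivative 1 / j) (at z)"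
    using j_nz by (auto intro!: derivative_eq_intros)
  then have 1: "((\<lambda>w. jA \<tau>' (w / j)) has_field_derivative deriv (jA \<tau>') (z / j) * (1 / j)) (at z)"
    using z lattice_divide_iff by (intro DERIV_chain2[OF d[OF Im_\<tau>']]) auto
  have "((\<lambda>w. j * jA \<tau> w + of_int c * w) has_field_derivative j * deriv (jA \<tau>) z + of_int c) (at z)"
    using d[OF Im_\<tau> z] by (auto intro!: derivative_eq_intros)
  then have "deriv (jA \<tau>') (z / j) * (1 / j) = j * deriv (jA \<tau>) z + of_int c"
    using DERIV_unique[OF DERIV_cong_ev[OF refl ev refl, THEN iffD1, OF 1]] by blast
  then show ?thesis using j_nz by (simp add: field_simps)
qed

section \<open>Strip expansions of \<open>E_2\<close>, \<open>J_1\<close> and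
  \<open>J_2\<close>\<close>

lemma expands_const: "expands 0 (\<lambda>z \<tau>. b)"
  by (rule expands_family[where I = "{()}" and a = "\<lambda>_. b" and g = "\<lambda>_. (0, 0)"])
    (auto intro: has_sum_finiteI)

text \<open>The sign \<epsilon> covers the arguments \<open>z\<close>, \<open>- z\<close> and
  \<open>0\<close> at once. The exponents give \<open>k * (r + \<epsilon> * x)\<close> with
  \<open>r \<ge> 1\<close>, which is nonnegative for \<open>x\<close> in \<open>[0, 1]\<close>; for
  \<epsilon> \<open>= -1\<close> and \<open>r = 1\<close> it fails beyond \<open>1\<close>.\<close>

lemma expands_lambert:
  assumes a: "a \<le> 1" and e: "\<And>x. 0 \<le> x \<Longrightarrow> x \<le> 1 \<Longrightarrow> 0 \<le> 1 + of_int \<epsilon> * (x :: real)" "\<bar>\<epsilon>\<bar> \<le> 1"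
  shows "expands 0 (\<lambda>z \<tau>. lambert a \<tau> (of_int \<epsilon> * z))"
proof (rule expands_family[where I = "{1::nat..} \<times> {1::nat..}" and a = "\<lambda>(k, r). of_nat r ^ a"
      and g = "\<lambda>(k, r). (int (k * r), \<epsilon> * int k)"])
  fix i and x :: real assume i: "i \<in> {1::nat..} \<times> {1::nat..}" and x: "0 \<le> x" "x \<le> 1"
  obtain k r where kr: "i = (k, r)" "r \<ge> 1" using i by auto
  have "0 \<le> (real r - 1) + (1 + of_int \<epsilon> * x)"
    using kr(2) e(1)[OF x] by linarith
  then have "0 \<le> real k * ((real r - 1) + (1 + of_int \<epsilon> * x))"
    by (rule mult_nonneg_nonneg[rotated]) simp
  then show "0 \<le> real_of_int (fst (case i of (k, r) \<Rightarrow> (int (k * r), \<epsilon> * int k))) +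
      real_of_int (snd (case i of (k, r) \<Rightarrow> (int (k * r), \<epsilon> * int k))) * x + 0 * x\<^sup>2"
    by (simp add: kr algebra_simps)
next
  fix z \<tau> :: complex assume z: "0 < Im z" "Im z < Im \<tau>"
  have "\<epsilon> = -1 \<or> \<epsilon> = 0 \<or> \<epsilon> = 1" using e(2) by linarith
  then have "Im (of_int \<epsilon> * z) > - Im \<tau>" using z by auto
  from has_sum_lambert[OF this _ a] z
  show "((\<lambda>i. (case i of (k, r) \<Rightarrow> of_nat r ^ a) *
      ee (of_int (fst (case i of (k, r) \<Rightarrow> (int (k * r), \<epsilon> * int k))) * \<tau> +
          of_int (snd (case i of (k, r) \<Rightarrow> (int (k * r), \<epsilon> * int k))) * z)) has_sum
      lambert a \<tau> (of_int \<epsilon> * z)) ({1..} \<times> {1..})"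
    by (simp add: case_prod_beta' algebra_simps)
qed

lemma expands_E2: "expands 0 (\<lambda>z \<tau>. E2 \<tau>)"
proof -
  have "expands 0 (\<lambda>z \<tau>. 1 + (- 24) * lambert 1 \<tau> (of_int 0 * z))"
    by (intro expands_add expands_const expands_cmult expands_lambert) auto
  then show ?thesis by (rule expands_cong) (simp add: E2_eq)
qed

lemma not_lattice_strip:
  assumes "0 < Im z" "Im z < Im \<tau>"
  shows "z \<notin> lattice \<tau>"
proof
  assume "z \<in> lattice \<tau>"
  then have "z \<in> \<int>" using assms by (intro lattice_Im) auto
  then show False using assms by (auto elim!: Ints_cases)
qed

text \<open>Above the real axis \<open>|p| < 1\<close>, so the fraction is \<open>-1/2\<close> minus
  a geometric series with exponents \<open>(0, k)\<close>. These satisfy the support condition only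
  for \<open>x \<ge> 0\<close>, which fixes the lower end of the interval.\<close>

lemma expands_J1: "expands 0 (\<lambda>z \<tau>. J 1 z \<tau>)"
proof -
  have "expands 0 (\<lambda>z \<tau>. geom z)"
  proof (rule expands_family[where I = "{1::nat..}" and a = "\<lambda>_. 1" and g = "\<lambda>k. (0, int k)"])
    fix z \<tau> :: complex assume "0 < Im z"
    then have "norm (ee z) < 1" by (simp add: norm_ee)
    from has_sum_geometric_from_1[OF this]
    show "((\<lambda>k. 1 * ee (of_int (fst (0, int k)) * \<tau> + of_int (snd (0, int k)) * z)) has_sum geom z) {1::nat..}"
      by (simp add: geom_def ee_power)
  qed auto
  then have "expands 0 (\<lambda>z \<tau>. (- 1 / 2 + (- 1) * geom z) +
      ((- 1) * lambert 0 \<tau> (of_int 1 * z) + lambert 0 \<tau> (of_int (- 1) * z)))"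
    by (intro expands_add expands_const expands_cmult expands_lambert) auto
  then show ?thesis
  proof (rule expands_cong)
    fix z \<tau> :: complex assume z: "0 < Im z" "Im z < Im \<tau>"
    have "ee z \<noteq> 1" using not_lattice_strip[OF z] Ints_subset_lattice by (auto simp: ee_eq_1_iff)
    then have "(ee z + 1) / (2 * (ee z - 1)) = - 1 / 2 - geom z"
      by (simp add: geom_def divide_simps) (simp add: algebra_simps)
    then show "(- 1 / 2 + (- 1) * geom z) +
      ((- 1) * lambert 0 \<tau> (of_int 1 * z) + lambert 0 \<tau> (of_int (- 1) * z)) = J 1 z \<tau>"
      using z J1_eq_jA[of \<tau> z] not_lattice_strip[OF z] by (simp add: jA_def)
  qed
qed

lemma expands_J2: "expands 0 (\<lambda>z \<tau>. J 2 z \<tau>)"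
proof -
  have "expands 0 (\<lambda>z \<tau>. 1 / 6 + (- 2) * (lambert 1 \<tau> (of_int 1 * z) + lambert 1 \<tau> (of_int (- 1) * z)))"
    by (intro expands_add expands_const expands_cmult expands_lambert) auto
  then show ?thesis
    by (rule expands_cong) (use J2_eq_jB not_lattice_strip in \<open>simp add: jB_def\<close>)
qed

section \<open>The Jacobi--Serre derivative\<close>

text \<open>\<open>jacobi_serre_deriv\<close> branches on these poles. A period changes
  \<open>jA\<close> only by an additive constant, so its pole at \<open>0\<close> recurs at each
  lattice point.\<close>

lemma J1_is_pole_iff:
  assumes \<tau>: "Im \<tau> > 0"
  shows "is_pole (\<lambda>x. J 1 x \<tau>) z \<longleftrightarrow> z \<in> lattice \<tau>"
proof
  assume "is_pole (\<lambda>x. J 1 x \<tau>) z"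
  then have "is_pole (remove_sings (jA \<tau>)) z" by (simp only: J1_eq[OF \<tau>])
  then show "z \<in> lattice \<tau>"
    using remove_sings_analytic_on[OF jA_analytic[OF \<tau>]] analytic_at_imp_no_pole by blast
next
  assume "z \<in> lattice \<tau>"
  then obtain l u where z: "z = of_int l * \<tau> + of_int u" by (auto simp: lattice_def)
  obtain Y r where Y: "r > 0" "Y holomorphic_on ball 0 r"
    "\<And>z. z \<in> ball 0 r - {0} \<Longrightarrow> z \<notin> lattice \<tau> \<and>
        jA \<tau> z = 1 / (2 * of_real pi * \<i> * z) + 2 * of_real pi * \<i> * z * Y z"
    by (rule jA_local[OF \<tau>]) blast
  have tY: "Y \<midarrow>0\<rightarrow> Y 0" using Y(1,2)
    by (intro isContD) (auto simp: continuous_on_eq_continuous_at dest!: holomorphic_on_imp_continuous_on)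
  have "((\<lambda>w. 2 * of_real pi * \<i> * w) \<longlongrightarrow> 2 * of_real pi * \<i> * 0) (at 0)" by (intro tendsto_intros)
  then have "filterlim (\<lambda>w. 2 * of_real pi * \<i> * w) (at 0) (at 0)"
    by (auto simp: filterlim_at eventually_at_filter)
  then have "filterlim (\<lambda>w. inverse (2 * of_real pi * \<i> * w)) at_infinity (at 0)"
    by (rule filterlim_compose[OF filterlim_inverse_at_infinity])
  then have inf: "filterlim (\<lambda>w. 1 / (2 * of_real pi * \<i> * w)) at_infinity (at 0)"
    by (simp add: inverse_eq_divide)
  have "((\<lambda>w. 2 * of_real pi * \<i> * w * Y w - of_int l) \<longlongrightarrow> 2 * of_real pi * \<i> * 0 * Y 0 - of_int l) (at 0)"
    by (intro tendsto_intros tY)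
  from tendsto_add_filterlim_at_infinity[OF this inf]
  have "is_pole (\<lambda>w. 2 * of_real pi * \<i> * w * Y w - of_int l + 1 / (2 * of_real pi * \<i> * w)) 0"
    by (simp add: is_pole_def)
  moreover have "\<forall>\<^sub>F w in at 0. 2 * of_real pi * \<i> * w * Y w - of_int l + 1 / (2 * of_real pi * \<i> * w) = J 1 (z + w) \<tau>"
  proof -
    have "\<forall>\<^sub>F w in at 0. w \<in> ball 0 r" using Y(1) by (intro eventually_at_in_open') auto
    then show ?thesis using eventually_neq_at_within[of 0 0 UNIV]
    proof eventually_elim
      case (elim w)
      then have w: "w \<notin> lattice \<tau>" "jA \<tau> w = 1 / (2 * of_real pi * \<i> * w) + 2 * of_real pi * \<i> * w * Y w"
        using Y(3) by blast+
      have zw: "z + w = w + of_int l * \<tau> + of_int u" by (simp add: z)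
      have "z + w \<notin> lattice \<tau>" unfolding zw lattice_add_iff by (rule w(1))
      then have "J 1 (z + w) \<tau> = jA \<tau> w - of_int l"
        using J1_eq_jA[OF \<tau>] jA_add_lattice[OF \<tau> w(1)] unfolding zw by simp
      then show ?case unfolding w(2) by simp
    qed
  qed
  ultimately have "is_pole (\<lambda>w. J 1 (z + w) \<tau>) 0" using is_pole_cong by fastforce
  then show "is_pole (\<lambda>x. J 1 x \<tau>) z" by (subst is_pole_shift_0)
qed

lemma quadratic_nonneg:
  fixes n r :: int and m :: nat and x :: real
  assumes "r\<^sup>2 \<le> 4 * n * int m" "0 \<le> n"
  shows "0 \<le> of_int n + of_int r * x + of_nat m * x\<^sup>2"
proof (cases "m = 0")
  case True
  then show ?thesis using assms by simp
next
  case False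
  have "real_of_int (r\<^sup>2) \<le> real_of_int (4 * n * int m)" using assms(1) by (simp only: of_int_le_iff)
  then have "(of_int r)\<^sup>2 \<le> 4 * real_of_int n * of_nat m" by simp
  then have "0 \<le> (2 * of_nat m * x + of_int r)\<^sup>2 + (4 * real_of_int n * of_nat m - (of_int r)\<^sup>2)" by simp
  also have "\<dots> = 4 * of_nat m * (of_int n + of_int r * x + of_nat m * x\<^sup>2)"
    by (simp add: power2_eq_square algebra_simps)
  finally show ?thesis using False by (simp add: zero_le_mult_iff)
qed

section \<open>Fourier expansions of Jacobi forms\<close>

text \<open>The expansion of a Jacobi form with coefficients extended by zero, so that index shifts
  stay within one type. For \<open>m = 0\<close> the discriminant bound says nothing about the sign
  of \<open>n\<close>, hence the separate \<open>0 \<le> n\<close>.\<close>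

definition jacobi_fourier :: "nat \<Rightarrow> (int \<times> int \<Rightarrow> complex) \<Rightarrow> (complex \<Rightarrow> complex \<Rightarrow> complex) \<Rightarrow> bool" where
  "jacobi_fourier m c F \<longleftrightarrow> (\<forall>n r. c (n, r) \<noteq> 0 \<longrightarrow> r\<^sup>2 \<le> 4 * n * int m \<and> 0 \<le> n) \<and>
     (\<forall>z \<tau>. Im \<tau> > 0 \<longrightarrow> (fourier_term c z \<tau> has_sum F z \<tau>) UNIV)"

lemma jacobi_fourier_iff:
  "(\<exists>c. jacobi_fourier m c F) \<longleftrightarrow>
   (\<exists>coef :: nat \<Rightarrow> int \<Rightarrow> complex. \<forall>z. \<forall>\<tau>\<in>upper_half_plane.
        ((\<lambda>(n, r). coef n r * ee \<tau> ^ n * ee z powi r) has_sum F z \<tau>)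
          {(n, r). r ^ 2 \<le> 4 * int n * int m})" (is "_ \<longleftrightarrow> ?R")
proof -
  define A where "A = {(n, r). 0 \<le> n \<and> r\<^sup>2 \<le> 4 * n * int m}"
  have reindex: "((\<lambda>(n, r). c (int n, r) * ee \<tau> ^ n * ee z powi r) has_sum S) {(n, r). r ^ 2 \<le> 4 * int n * int m}
      \<longleftrightarrow> (fourier_term c z \<tau> has_sum S) A" for c z \<tau> S
    by (rule has_sum_reindex_bij_witness[where i = "\<lambda>(n, r). (nat n, r)" and j = "\<lambda>(n, r). (int n, r)"])
      (auto simp: A_def fourier_term_def ee_add ee_power ee_powi)
  have neutral: "(fourier_term c z \<tau> has_sum S) A \<longleftrightarrow> (fourier_term c z \<tau> has_sum S) UNIV"
    if "\<forall>n r. c (n, r) \<noteq> 0 \<longrightarrow> r\<^sup>2 \<le> 4 * n * int m \<and> 0 \<le> n" for c z \<tau> S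
    by (rule has_sum_cong_neutral) (use that in \<open>auto simp: A_def fourier_term_def\<close>)
  show ?thesis
  proof
    assume "\<exists>c. jacobi_fourier m c F"
    then obtain c where c: "jacobi_fourier m c F" by blast
    show ?R
    proof (intro exI[of _ "\<lambda>n r. c (int n, r)"] allI ballI)
      fix z \<tau> assume "\<tau> \<in> upper_half_plane"
      then show "((\<lambda>(n, r). c (int n, r) * ee \<tau> ^ n * ee z powi r) has_sum F z \<tau>) {(n, r). r ^ 2 \<le> 4 * int n * int m}"
        using c unfolding reindex jacobi_fourier_def by (simp add: neutral)
    qed
  next
    assume ?R
    then obtain coef :: "nat \<Rightarrow> int \<Rightarrow> complex" where coef: "\<And>z \<tau>. Im \<tau> > 0 \<Longrightarrow>
      ((\<lambda>(n, r). coef n r * ee \<tau> ^ n * ee z powi r) has_sum F z \<tau>) {(n, r). r ^ 2 \<le> 4 * int n * int m}"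
      by auto
    define c where "c = (\<lambda>(n, r). if 0 \<le> n \<and> r\<^sup>2 \<le> 4 * n * int m then coef (nat n) r else 0)"
    have supp: "\<forall>n r. c (n, r) \<noteq> 0 \<longrightarrow> r\<^sup>2 \<le> 4 * n * int m \<and> 0 \<le> n"
      by (auto simp: c_def split: if_splits)
    have "(fourier_term c z \<tau> has_sum F z \<tau>) UNIV" if "Im \<tau> > 0" for z \<tau>
    proof -
      have "((\<lambda>(n, r). c (int n, r) * ee \<tau> ^ n * ee z powi r) has_sum F z \<tau>) {(n, r). r ^ 2 \<le> 4 * int n * int m}"
        using coef[OF that, of z] by (rule has_sum_cong[THEN iffD1, rotated]) (auto simp: c_def)
      then show ?thesis unfolding reindex using neutral[OF supp] by simp
    qed
    then show "\<exists>c. jacobi_fourier m c F" using supp unfolding jacobi_fourier_def by blast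
  qed
qed

lemma jacobi_fourier_expands:
  assumes "jacobi_fourier m c F"
  shows "expands (real m) F"
  unfolding expands_def
  using assms quadratic_nonneg unfolding jacobi_fourier_def by (intro exI[of _ c]) force

lemma jacobi_fourier_dz:
  assumes F: "jacobi_fourier m c F"
  shows "jacobi_fourier m (\<lambda>x. of_int (snd x) * c x) (dz F)"
    and "Im \<tau> > 0 \<Longrightarrow> ((\<lambda>z. F z \<tau>) has_field_derivative 2 * of_real pi * \<i> * dz F z \<tau>) (at z)"
proof -
  show "jacobi_fourier m (\<lambda>x. of_int (snd x) * c x) (dz F)"
    using F fourier_dz(2)[of c _ F] unfolding jacobi_fourier_def by auto
  show "((\<lambda>z. F z \<tau>) has_field_derivative 2 * of_real pi * \<i> * dz F z \<tau>) (at z)" if "Im \<tau> > 0"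
    using F fourier_dz(1)[of c \<tau> F z] that unfolding jacobi_fourier_def
    by (simp add: dz_def DERIV_deriv_iff_field_differentiable)
qed

lemma jacobi_fourier_dtau:
  assumes F: "jacobi_fourier m c F"
  shows "jacobi_fourier m (\<lambda>x. of_int (fst x) * c x) (dtau F)"
    and "Im \<tau> > 0 \<Longrightarrow> ((\<lambda>t. F z t) has_field_derivative 2 * of_real pi * \<i> * dtau F z \<tau>) (at \<tau>)"
proof -
  show "jacobi_fourier m (\<lambda>x. of_int (fst x) * c x) (dtau F)"
    using F fourier_dtau(2)[of c _ F] unfolding jacobi_fourier_def by auto
  show "((\<lambda>t. F z t) has_field_derivative 2 * of_real pi * \<i> * dtau F z \<tau>) (at \<tau>)" if "Im \<tau> > 0"
    using F fourier_dtau(1)[of c z F \<tau>] that unfolding jacobi_fourier_def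
    by (simp add: dtau_def DERIV_deriv_iff_field_differentiable)
qed

text \<open>Here \<open>A'\<close> is the normalised derivative of \<open>A\<close>, and
  \<open>E\<close> stands for \<open>E2 / 4\<close>. The terms in \<open>l * Fz\<close> and in
  \<open>l\<^sup>2 * F\<close> each cancel by \<open>q * (1 - 4 * M) = 1\<close>; those in
  \<open>l * A * F\<close> cancel inside the bracket.\<close>

lemma elliptic_identity:
  fixes q M :: complex
  assumes "q * (1 - 4 * M) = 1"
  shows "\<psi> * (Ft - l * Fz + M * l\<^sup>2 * F) - e * (\<psi> * F)
      + q * (\<psi> * (Fzz - 4 * M * l * Fz + 4 * M\<^sup>2 * l\<^sup>2 * F) - (A - l) * (\<psi> * (Fz - 2 * M * l * F))
        + M * (A' + (A - l)\<^sup>2 - E) * (\<psi> * F))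
    = \<psi> * (Ft - e * F + q * (Fzz - A * Fz + M * (A' + A\<^sup>2 - E) * F))"
  using assms by algebra

text \<open>With \<open>s = c z / j\<close> and \<open>h\<close> the defect of \<open>E_2\<close>
  divided by \<open>12 * j\<^sup>2\<close>, the terms in \<open>s\<close> cancel as in the elliptic
  case. The weight term \<open>w * h\<close> is absorbed by \<open>w / 12 * E2\<close>, and
  \<open>2 * M * h + M * h - 3 * M * h = 0\<close> settles the rest.\<close>

lemma modular_identity:
  fixes q M :: complex
  assumes "q * (1 - 4 * M) = 1"
  shows "\<phi> * j\<^sup>2 * (Ft + s * Fz + (w * h + M * s\<^sup>2) * F) - w / 12 * (j\<^sup>2 * (E + 12 * h)) * (\<phi> * F)
      + q * (\<phi> * j\<^sup>2 * (Fzz + 4 * M * s * Fz + (4 * M\<^sup>2 * s\<^sup>2 + 2 * M * h) * F)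
        - j * (A + s) * (\<phi> * j * (Fz + 2 * M * s * F))
        + M * (j\<^sup>2 * (A' + h) + (j * (A + s))\<^sup>2 - j\<^sup>2 * (E + 12 * h) / 4) * (\<phi> * F))
    = \<phi> * j\<^sup>2 * (Ft - w / 12 * E * F + q * (Fzz - A * Fz + M * (A' + A\<^sup>2 - E / 4) * F))"
proof -
  \<comment> \<open>The denominators are cleared from the \<open>h\<close> terms, so that divisions
    survive only in \<open>w / 12 * E\<close> and \<open>E / 4\<close>, which occur on both sides of
    the goal.\<close>
  have E: "w / 12 * (j\<^sup>2 * (E + 12 * h)) * (\<phi> * F) = \<phi> * j\<^sup>2 * ((w / 12 * E) * F + w * h * F)"
    "j\<^sup>2 * (E + 12 * h) / 4 = j\<^sup>2 * (E / 4 + 3 * h)"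
    by (simp_all add: field_simps)
  show ?thesis unfolding E using assms by algebra
qed

section \<open>The derivative of a fixed form and its transformation laws\<close>

locale even_jacobi_form =
  fixes k m :: nat and F :: "complex \<Rightarrow> complex \<Rightarrow> complex"
  assumes jacobi: "jacobi_form (2 * k) m F"
begin

abbreviation \<kappa> :: complex where "\<kappa> \<equiv> 2 * of_real pi * \<i>"

text \<open>At lattice points the value of \<open>P\<close> has no meaning, since \<open>J 1\<close>
  is set to \<open>0\<close> there. The laws are proved for \<open>P\<close> off the lattice and
  reach \<open>G\<close> through limits.\<close>

abbreviation P where "P \<equiv> jacobi_serre_formula (2 * k) m F"

abbreviation G where "G \<equiv> jacobi_serre_deriv (2 * k) m F"

lemma F_modular:
  "a * d - b * c = 1 \<Longrightarrow> Im \<tau> > 0 \<Longrightarrow>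
    F (z / (of_int c * \<tau> + of_int d)) ((of_int a * \<tau> + of_int b) / (of_int c * \<tau> + of_int d)) =
        (of_int c * \<tau> + of_int d) ^ (2 * k)
          * ee (of_nat m * of_int c * z ^ 2 / (of_int c * \<tau> + of_int d)) * F z \<tau>"
  using jacobi unfolding jacobi_form_def by blast

lemma F_elliptic:
  "Im \<tau> > 0 \<Longrightarrow> F (z + of_int l * \<tau> + of_int u) \<tau> =
        ee (- of_nat m * (of_int l ^ 2 * \<tau> + 2 * of_int l * z)) * F z \<tau>"
  using jacobi unfolding jacobi_form_def by blast

lemma fourier_ex: "\<exists>c. jacobi_fourier m c F"
  using jacobi unfolding jacobi_form_def jacobi_fourier_iff by blast

lemma
  assumes "Im \<tau> > 0"
  shows DERIV_F: "((\<lambda>z. F z \<tau>) has_field_derivative \<kappa> * dz F z \<tau>) (at z)"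
    and DERIV_dz: "((\<lambda>z. dz F z \<tau>) has_field_derivative \<kappa> * dz (dz F) z \<tau>) (at z)"
    and DERIV_dz_dz: "((\<lambda>z. dz (dz F) z \<tau>) has_field_derivative \<kappa> * dz (dz (dz F)) z \<tau>) (at z)"
    and DERIV_dtau: "((\<lambda>z. dtau F z \<tau>) has_field_derivative \<kappa> * dz (dtau F) z \<tau>) (at z)"
    and DERIV_tau: "((\<lambda>t. F z t) has_field_derivative \<kappa> * dtau F z \<tau>) (at \<tau>)"
proof -
  obtain c where c: "jacobi_fourier m c F" using fourier_ex by blast
  note c1 = jacobi_fourier_dz(1)[OF c]
  note c2 = jacobi_fourier_dz(1)[OF c1]
  show "((\<lambda>z. F z \<tau>) has_field_derivative \<kappa> * dz F z \<tau>) (at z)"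
    by (rule jacobi_fourier_dz(2)[OF c assms])
  show "((\<lambda>z. dz F z \<tau>) has_field_derivative \<kappa> * dz (dz F) z \<tau>) (at z)"
    by (rule jacobi_fourier_dz(2)[OF c1 assms])
  show "((\<lambda>z. dz (dz F) z \<tau>) has_field_derivative \<kappa> * dz (dz (dz F)) z \<tau>) (at z)"
    by (rule jacobi_fourier_dz(2)[OF c2 assms])
  show "((\<lambda>z. dtau F z \<tau>) has_field_derivative \<kappa> * dz (dtau F) z \<tau>) (at z)"
    by (rule jacobi_fourier_dz(2)[OF jacobi_fourier_dtau(1)[OF c] assms])
  show "((\<lambda>t. F z t) has_field_derivative \<kappa> * dtau F z \<tau>) (at \<tau>)"
    by (rule jacobi_fourier_dtau(2)[OF c assms])
qed

lemma expands_P: "expands (real m) P"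
proof -
  obtain c where c: "jacobi_fourier m c F" using fourier_ex by blast
  have e: "expands (0 + real m) F" "expands (0 + real m) (dz F)" "expands (0 + real m) (dz (dz F))" "expands (0 + real m) (dtau F)"
    using jacobi_fourier_expands[OF c] jacobi_fourier_expands[OF jacobi_fourier_dz(1)[OF c]]
      jacobi_fourier_expands[OF jacobi_fourier_dz(1)[OF jacobi_fourier_dz(1)[OF c]]]
      jacobi_fourier_expands[OF jacobi_fourier_dtau(1)[OF c]] by simp_all
  have e': "expands 0 (\<lambda>z \<tau>. E2 \<tau>)" "expands 0 (\<lambda>z \<tau>. J 1 z \<tau>)" "expands 0 (\<lambda>z \<tau>. J 2 z \<tau>)"
    by (fact expands_E2 expands_J1 expands_J2)+
  have F': "expands (real m) F" "expands (real m) (dz F)" using e by simp_all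
  have "expands (0 + real m) (\<lambda>z \<tau>. (dtau F z \<tau> + (- (of_nat (2 * k) / 12)) * (E2 \<tau> * F z \<tau>)) +
      1 / (1 - 4 * of_nat m) * ((dz (dz F) z \<tau> + (- 1) * (J 1 z \<tau> * dz F z \<tau>)) +
        (of_nat m * (J 2 z \<tau> * F z \<tau>) + (- (of_nat m / 6)) * (E2 \<tau> * F z \<tau>))))"
    by (intro expands_add expands_cmult e
        expands_mult[OF e'(1) F'(1)] expands_mult[OF e'(2) F'(2)] expands_mult[OF e'(3) F'(1)])
  then show ?thesis
    by (simp only: add_0) (erule expands_cong, simp add: jacobi_serre_formula_def algebra_simps)
qed

lemma four_m_nz: "1 - 4 * of_nat m \<noteq> (0 :: complex)"
proof
  assume "1 - 4 * of_nat m = (0 :: complex)"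
  then have "of_nat 1 = (of_nat (4 * m) :: complex)" by simp
  then have "1 = 4 * m" by (simp only: of_nat_eq_iff)
  then show False by presburger
qed

text \<open>Eliminates \<open>J 2\<close> by \<open>jB_eq\<close>, with
  \<open>1/12 + 1/6 = 1/4\<close>. What remains involves only \<open>A\<close>, its derivative and
  \<open>E_2\<close>, whose transformation laws are available.\<close>

lemma P_eq:
  assumes \<tau>: "Im \<tau> > 0" and z: "z \<notin> lattice \<tau>"
  shows "P z \<tau> = dtau F z \<tau> - of_nat (2 * k) / 12 * E2 \<tau> * F z \<tau>
     + 1 / (1 - 4 * of_nat m) * (dz (dz F) z \<tau> - jA \<tau> z * dz F z \<tau>
       + of_nat m * (1 / \<kappa> * deriv (jA \<tau>) z + (jA \<tau> z)\<^sup>2 - E2 \<tau> / 4) * F z \<tau>)"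
proof -
  have "J 2 z \<tau> = 1 / \<kappa> * deriv (jA \<tau>) z + (jA \<tau> z)\<^sup>2 - E2 \<tau> / 12"
    using J2_eq_jB[OF \<tau> z] jB_eq[OF \<tau> z] by simp
  then have e: "of_nat m * J 2 z \<tau> * F z \<tau> - of_nat m / 6 * E2 \<tau> * F z \<tau> =
      of_nat m * (1 / \<kappa> * deriv (jA \<tau>) z + (jA \<tau> z)\<^sup>2 - E2 \<tau> / 4) * F z \<tau>"
    by (simp only:) (simp add: algebra_simps)
  have assoc: "x + y - w = x + (y - w)" for x y w :: complex by simp
  show ?thesis
    unfolding jacobi_serre_formula_def J1_eq_jA[OF \<tau> z]
      assoc[of "dz (dz F) z \<tau> - jA \<tau> z * dz F z \<tau>"] e
    by (rule refl)
qed

text \<open>Differentiating the transformation laws in \<tau> moves both arguments, so a chain rule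
  along curves is required. The total derivative from \<open>holomorphic2_on\<close> supplies it;
  its coefficients are identified by restriction to the two coordinate directions.\<close>

lemma DERIV_F_comp:
  assumes "Im (g t) > 0" "(f has_field_derivative f') (at t)" "(g has_field_derivative g') (at t)"
  shows "((\<lambda>t. F (f t) (g t)) has_field_derivative \<kappa> * (dz F (f t) (g t) * f' + dtau F (f t) (g t) * g')) (at t)"
proof -
  obtain a b where ab: "((\<lambda>(z, \<tau>). F z \<tau>) has_derivative (\<lambda>(u, v). a * u + b * v)) (at (f t, g t))"
    using jacobi assms(1) unfolding jacobi_form_def holomorphic2_on_def by blast
  have comp: "((\<lambda>s. F (p s) (q s)) has_field_derivative a * p' + b * q') (at s)"
    if "(p has_field_derivative p') (at s)" "(q has_field_derivative q') (at s)" "p s = f t" "q s = g t" for p q p' q' s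
  proof -
    have "((\<lambda>s. (p s, q s)) has_derivative (\<lambda>h. (p' * h, q' * h))) (at s)"
      using that by (intro has_derivative_Pair) (auto simp: has_field_derivative_def)
    moreover have "((\<lambda>(z, \<tau>). F z \<tau>) has_derivative (\<lambda>(u, v). a * u + b * v)) (at (p s, q s))"
      using ab that by simp
    ultimately have "((\<lambda>x. (\<lambda>(z, \<tau>). F z \<tau>) (p x, q x)) has_derivative
        (\<lambda>h. (\<lambda>(u, v). a * u + b * v) (p' * h, q' * h))) (at s)"
      by (rule has_derivative_compose)
    moreover have "(\<lambda>h. (\<lambda>(u, v). a * u + b * v) (p' * h, q' * h)) = (*) (a * p' + b * q')"
      by (simp add: fun_eq_iff algebra_simps)
    ultimately show ?thesis by (simp add: has_field_derivative_def)
  qed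
  have "((\<lambda>s. F s (g t)) has_field_derivative a * 1 + b * 0) (at (f t))"
    by (rule comp) (auto intro!: derivative_eq_intros)
  then have a: "a = \<kappa> * dz F (f t) (g t)" using DERIV_unique[OF DERIV_F[OF assms(1)]] by simp
  have "((\<lambda>s. F (f t) s) has_field_derivative a * 0 + b * 1) (at (g t))"
    by (rule comp) (auto intro!: derivative_eq_intros)
  then have b: "b = \<kappa> * dtau F (f t) (g t)" using DERIV_unique[OF DERIV_tau[OF assms(1)]] by simp
  show ?thesis using comp[OF assms(2,3)] a b by (simp add: algebra_simps)
qed

text \<open>The elliptic law differentiated. In the \<tau>-derivative the point
  \<open>z + l * \<tau> + u\<close> moves as well, and the resulting multiple of \<open>dz F\<close>
  is rewritten by the first formula.\<close>

lemma
  fixes l u :: int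
  assumes \<tau>: "Im \<tau> > 0"
  defines "\<psi> \<equiv> \<lambda>z. ee (- of_nat m * (of_int l ^ 2 * \<tau> + 2 * of_int l * z))"
  shows dz_elliptic: "dz F (z + of_int l * \<tau> + of_int u) \<tau> = \<psi> z * (dz F z \<tau> - 2 * of_nat m * of_int l * F z \<tau>)"
    and dz_dz_elliptic: "dz (dz F) (z + of_int l * \<tau> + of_int u) \<tau> =
      \<psi> z * (dz (dz F) z \<tau> - 4 * of_nat m * of_int l * dz F z \<tau> + 4 * (of_nat m)\<^sup>2 * (of_int l)\<^sup>2 * F z \<tau>)"
    and dtau_elliptic: "dtau F (z + of_int l * \<tau> + of_int u) \<tau> =
      \<psi> z * (dtau F z \<tau> - of_int l * dz F z \<tau> + of_nat m * (of_int l)\<^sup>2 * F z \<tau>)"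
proof -
  have \<psi>: "(\<psi> has_field_derivative \<kappa> * (- 2 * of_nat m * of_int l) * \<psi> z) (at z)" for z
    unfolding \<psi>_def by (auto intro!: derivative_eq_intros)
  have 1: "dz F (z + of_int l * \<tau> + of_int u) \<tau> = \<psi> z * (dz F z \<tau> - 2 * of_nat m * of_int l * F z \<tau>)" for z
  proof -
    have "((\<lambda>z. F (z + of_int l * \<tau> + of_int u) \<tau>) has_field_derivative \<kappa> * dz F (z + of_int l * \<tau> + of_int u) \<tau> * 1) (at z)"
      by (rule DERIV_chain2[OF DERIV_F[OF \<tau>]]) (auto intro!: derivative_eq_intros)
    moreover have "((\<lambda>z. F (z + of_int l * \<tau> + of_int u) \<tau>) has_field_derivative
        \<kappa> * (- 2 * of_nat m * of_int l) * \<psi> z * F z \<tau> + \<kappa> * dz F z \<tau> * \<psi> z) (at z)"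
      unfolding F_elliptic[OF \<tau>] using DERIV_mult[OF \<psi> DERIV_F[OF \<tau>]] by (simp add: \<psi>_def)
    ultimately have "\<kappa> * dz F (z + of_int l * \<tau> + of_int u) \<tau> =
        \<kappa> * (\<psi> z * (dz F z \<tau> - 2 * of_nat m * of_int l * F z \<tau>))"
      using DERIV_unique by (fastforce simp: algebra_simps)
    then show ?thesis by simp
  qed
  show "dz F (z + of_int l * \<tau> + of_int u) \<tau> = \<psi> z * (dz F z \<tau> - 2 * of_nat m * of_int l * F z \<tau>)" by (rule 1)
  show "dz (dz F) (z + of_int l * \<tau> + of_int u) \<tau> =
      \<psi> z * (dz (dz F) z \<tau> - 4 * of_nat m * of_int l * dz F z \<tau> + 4 * (of_nat m)\<^sup>2 * (of_int l)\<^sup>2 * F z \<tau>)"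
  proof -
    have "((\<lambda>z. dz F (z + of_int l * \<tau> + of_int u) \<tau>) has_field_derivative \<kappa> * dz (dz F) (z + of_int l * \<tau> + of_int u) \<tau> * 1) (at z)"
      by (rule DERIV_chain2[OF DERIV_dz[OF \<tau>]]) (auto intro!: derivative_eq_intros)
    moreover have "((\<lambda>z. dz F (z + of_int l * \<tau> + of_int u) \<tau>) has_field_derivative
        \<kappa> * (- 2 * of_nat m * of_int l) * \<psi> z * (dz F z \<tau> - 2 * of_nat m * of_int l * F z \<tau>)
        + (\<kappa> * dz (dz F) z \<tau> - 2 * of_nat m * of_int l * (\<kappa> * dz F z \<tau>)) * \<psi> z) (at z)"
      unfolding 1 by (intro DERIV_mult \<psi> DERIV_diff DERIV_dz DERIV_F DERIV_cmult \<tau>)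
    ultimately have "\<kappa> * dz (dz F) (z + of_int l * \<tau> + of_int u) \<tau> * 1 =
        \<kappa> * (- 2 * of_nat m * of_int l) * \<psi> z * (dz F z \<tau> - 2 * of_nat m * of_int l * F z \<tau>)
        + (\<kappa> * dz (dz F) z \<tau> - 2 * of_nat m * of_int l * (\<kappa> * dz F z \<tau>)) * \<psi> z"
      by (rule DERIV_unique)
    also have "\<dots> = \<kappa> * (\<psi> z * (dz (dz F) z \<tau> - 4 * of_nat m * of_int l * dz F z \<tau> + 4 * (of_nat m)\<^sup>2 * (of_int l)\<^sup>2 * F z \<tau>))"
      by (simp add: algebra_simps power2_eq_square)
    finally show ?thesis by simp
  qed
  show "dtau F (z + of_int l * \<tau> + of_int u) \<tau> =
      \<psi> z * (dtau F z \<tau> - of_int l * dz F z \<tau> + of_nat m * (of_int l)\<^sup>2 * F z \<tau>)"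
  proof -
    define \<theta> where "\<theta> t = ee (- of_nat m * (of_int l ^ 2 * t + 2 * of_int l * z))" for t
    have \<theta>\<tau>: "\<theta> \<tau> = \<psi> z" by (simp add: \<theta>_def \<psi>_def)
    have \<theta>: "(\<theta> has_field_derivative \<kappa> * (- of_nat m * (of_int l)\<^sup>2) * \<theta> \<tau>) (at \<tau>)"
      unfolding \<theta>_def by (auto intro!: derivative_eq_intros)
    have "((\<lambda>t. F (z + of_int l * t + of_int u) t) has_field_derivative
        \<kappa> * (dz F (z + of_int l * \<tau> + of_int u) \<tau> * of_int l + dtau F (z + of_int l * \<tau> + of_int u) \<tau> * 1)) (at \<tau>)"
      by (rule DERIV_F_comp) (auto intro!: derivative_eq_intros simp: \<tau>)
    moreover have "((\<lambda>t. F (z + of_int l * t + of_int u) t) has_field_derivative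
        \<kappa> * (- of_nat m * (of_int l)\<^sup>2) * \<theta> \<tau> * F z \<tau> + \<kappa> * dtau F z \<tau> * \<theta> \<tau>) (at \<tau>)"
    proof -
      have ev: "\<forall>\<^sub>F t in nhds \<tau>. \<theta> t * F z t = F (z + of_int l * t + of_int u) t"
        using eventually_nhds_in_open[OF open_upper_half_plane, of \<tau>] \<tau>
        by (auto elim!: eventually_mono simp: F_elliptic \<theta>_def)
      show ?thesis
        by (rule DERIV_cong_ev[OF refl ev refl, THEN iffD1, OF DERIV_mult[OF \<theta> DERIV_tau[OF \<tau>]]])
    qed
    ultimately have "\<kappa> * (dz F (z + of_int l * \<tau> + of_int u) \<tau> * of_int l + dtau F (z + of_int l * \<tau> + of_int u) \<tau> * 1) =
        \<kappa> * (- of_nat m * (of_int l)\<^sup>2) * \<theta> \<tau> * F z \<tau> + \<kappa> * dtau F z \<tau> * \<theta> \<tau>"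
      by (rule DERIV_unique)
    also have "\<dots> = \<kappa> * (\<psi> z * (dtau F z \<tau> - of_nat m * (of_int l)\<^sup>2 * F z \<tau>))"
      unfolding \<theta>\<tau> by (simp add: algebra_simps)
    finally have "dz F (z + of_int l * \<tau> + of_int u) \<tau> * of_int l + dtau F (z + of_int l * \<tau> + of_int u) \<tau>
        = \<psi> z * (dtau F z \<tau> - of_nat m * (of_int l)\<^sup>2 * F z \<tau>)" by simp
    then have "dtau F (z + of_int l * \<tau> + of_int u) \<tau> = \<psi> z * (dtau F z \<tau> - of_nat m * (of_int l)\<^sup>2 * F z \<tau>)
        - \<psi> z * (dz F z \<tau> - 2 * of_nat m * of_int l * F z \<tau>) * of_int l"
      unfolding 1 by (metis add_diff_cancel_left')
    then show ?thesis by (simp add: algebra_simps power2_eq_square)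
  qed
qed

lemma P_elliptic:
  assumes \<tau>: "Im \<tau> > 0" and z: "z \<notin> lattice \<tau>"
  shows "P (z + of_int l * \<tau> + of_int u) \<tau> =
    ee (- of_nat m * (of_int l ^ 2 * \<tau> + 2 * of_int l * z)) * P z \<tau>"
proof -
  have z': "z + of_int l * \<tau> + of_int u \<notin> lattice \<tau>" using z by (simp add: lattice_add_iff)
  have q: "1 / (1 - 4 * of_nat m) * (1 - 4 * of_nat m) = (1 :: complex)"
    using four_m_nz by simp
  show ?thesis
    unfolding P_eq[OF \<tau> z'] P_eq[OF \<tau> z] dz_elliptic[OF \<tau>] dz_dz_elliptic[OF \<tau>] dtau_elliptic[OF \<tau>]
      F_elliptic[OF \<tau>] jA_add_lattice[OF \<tau> z] deriv_jA_add_lattice[OF \<tau> z]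
    by (rule elliptic_identity[OF q])
qed


text \<open>The modular law differentiated. The derivative of \<open>s\<close> is
  \<open>\<kappa> * h\<close>; in \<tau>, the arguments \<open>z / j\<close> and
  \<open>\<tau>'\<close> have derivatives \<open>- s / j\<close> and \<open>1 / j\<^sup>2\<close>,
  and \<open>j ^ (2 * k)\<close> has logarithmic derivative
  \<open>\<kappa> * (2 * k * h)\<close>.\<close>

lemma
  fixes a b c d :: int
  assumes det: "a * d - b * c = 1" and \<tau>: "Im \<tau> > 0"
  defines "j \<equiv> of_int c * \<tau> + of_int d"
  defines "\<tau>' \<equiv> (of_int a * \<tau> + of_int b) / j"
  defines "\<phi> \<equiv> \<lambda>z. j ^ (2 * k) * ee (of_nat m * of_int c * z ^ 2 / j)"
  defines "s \<equiv> \<lambda>z. of_int c * z / j"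
  defines "h \<equiv> of_int c / (\<kappa> * j)"
  shows dz_modular: "dz F (z / j) \<tau>' = \<phi> z * j * (dz F z \<tau> + 2 * of_nat m * s z * F z \<tau>)"
    and dz_dz_modular: "dz (dz F) (z / j) \<tau>' = \<phi> z * j\<^sup>2 * (dz (dz F) z \<tau> + 4 * of_nat m * s z * dz F z \<tau>
      + (4 * (of_nat m)\<^sup>2 * (s z)\<^sup>2 + 2 * of_nat m * h) * F z \<tau>)"
    and dtau_modular: "dtau F (z / j) \<tau>' = \<phi> z * j\<^sup>2 * (dtau F z \<tau> + s z * dz F z \<tau>
      + (of_nat (2 * k) * h + of_nat m * (s z)\<^sup>2) * F z \<tau>)"
proof -
  interpret modular_matrix a b c d \<tau> j \<tau>'
    by unfold_locales (simp_all add: det \<tau> j_def \<tau>'_def)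
  note j = j_nz
  have \<kappa>: "\<kappa> \<noteq> 0" by simp
  have mod: "F (z / j) \<tau>' = \<phi> z * F z \<tau>" for z
    using F_modular[OF det \<tau>, of z] by (simp add: j_def \<tau>'_def \<phi>_def)
  have \<phi>: "(\<phi> has_field_derivative \<phi> z * (\<kappa> * (2 * of_nat m * s z))) (at z)" for z
    unfolding \<phi>_def s_def using j by (auto intro!: derivative_eq_intros simp: field_simps power2_eq_square)
  have s: "(s has_field_derivative \<kappa> * h) (at z)" for z
    unfolding s_def h_def using j \<kappa> by (auto intro!: derivative_eq_intros)
  have div: "((\<lambda>z. z / j) has_field_derivative 1 / j) (at z)" for z
    using j by (auto intro!: derivative_eq_intros)
  have 1: "dz F (z / j) \<tau>' = \<phi> z * j * (dz F z \<tau> + 2 * of_nat m * s z * F z \<tau>)" for z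
  proof -
    have "((\<lambda>z. F (z / j) \<tau>') has_field_derivative \<kappa> * dz F (z / j) \<tau>' * (1 / j)) (at z)"
      by (rule DERIV_chain2[OF DERIV_F[OF Im_\<tau>'] div])
    moreover have "((\<lambda>z. F (z / j) \<tau>') has_field_derivative
        \<phi> z * (\<kappa> * (2 * of_nat m * s z)) * F z \<tau> + \<kappa> * dz F z \<tau> * \<phi> z) (at z)"
      unfolding mod by (rule DERIV_mult[OF \<phi> DERIV_F[OF \<tau>]])
    ultimately have "\<kappa> * dz F (z / j) \<tau>' * (1 / j) =
        \<phi> z * (\<kappa> * (2 * of_nat m * s z)) * F z \<tau> + \<kappa> * dz F z \<tau> * \<phi> z"
      by (rule DERIV_unique)
    also have "\<dots> = \<kappa> * (\<phi> z * j * (dz F z \<tau> + 2 * of_nat m * s z * F z \<tau>)) * (1 / j)"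
      using j by (simp add: algebra_simps)
    finally show ?thesis using j \<kappa> by (simp only: mult_cancel_right mult_cancel_left) simp
  qed
  show "dz F (z / j) \<tau>' = \<phi> z * j * (dz F z \<tau> + 2 * of_nat m * s z * F z \<tau>)" by (rule 1)
  show "dz (dz F) (z / j) \<tau>' = \<phi> z * j\<^sup>2 * (dz (dz F) z \<tau> + 4 * of_nat m * s z * dz F z \<tau>
      + (4 * (of_nat m)\<^sup>2 * (s z)\<^sup>2 + 2 * of_nat m * h) * F z \<tau>)"
  proof -
    let ?g = "\<lambda>z. dz F z \<tau> + 2 * of_nat m * s z * F z \<tau>"
    have "((\<lambda>z. dz F (z / j) \<tau>') has_field_derivative \<kappa> * dz (dz F) (z / j) \<tau>' * (1 / j)) (at z)"
      by (rule DERIV_chain2[OF DERIV_dz[OF Im_\<tau>'] div])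
    moreover have "((\<lambda>z. dz F (z / j) \<tau>') has_field_derivative
        \<phi> z * (\<kappa> * (2 * of_nat m * s z)) * j * ?g z +
        (\<kappa> * dz (dz F) z \<tau> + (2 * of_nat m * (\<kappa> * h) * F z \<tau> + \<kappa> * dz F z \<tau> * (2 * of_nat m * s z))) * (\<phi> z * j)) (at z)"
      unfolding 1 by (intro DERIV_mult DERIV_add DERIV_cmult DERIV_cmult_right \<phi> s DERIV_dz DERIV_F \<tau>)
    ultimately have "\<kappa> * dz (dz F) (z / j) \<tau>' * (1 / j) =
        \<phi> z * (\<kappa> * (2 * of_nat m * s z)) * j * ?g z +
        (\<kappa> * dz (dz F) z \<tau> + (2 * of_nat m * (\<kappa> * h) * F z \<tau> + \<kappa> * dz F z \<tau> * (2 * of_nat m * s z))) * (\<phi> z * j)"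
      by (rule DERIV_unique)
    also have "\<dots> = \<kappa> * (\<phi> z * j\<^sup>2 * (dz (dz F) z \<tau> + 4 * of_nat m * s z * dz F z \<tau>
      + (4 * (of_nat m)\<^sup>2 * (s z)\<^sup>2 + 2 * of_nat m * h) * F z \<tau>)) * (1 / j)"
      using j by (simp add: algebra_simps power2_eq_square)
    finally show ?thesis using j \<kappa> by simp
  qed
  show "dtau F (z / j) \<tau>' = \<phi> z * j\<^sup>2 * (dtau F z \<tau> + s z * dz F z \<tau>
      + (of_nat (2 * k) * h + of_nat m * (s z)\<^sup>2) * F z \<tau>)"
  proof -
    define v where "v t = of_int c * t + of_int d" for t :: complex
    define \<theta> where "\<theta> t = v t ^ (2 * k) * ee (of_nat m * of_int c * z ^ 2 / v t)" for t
    have v\<tau>: "v \<tau> = j" by (simp add: v_def j_def)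
    have \<theta>\<tau>: "\<theta> \<tau> = \<phi> z" by (simp add: \<theta>_def \<phi>_def v\<tau>)
    have dv: "(v has_field_derivative of_int c) (at t)" for t
      unfolding v_def by (auto intro!: derivative_eq_intros)
    have dpow: "((\<lambda>t. v t ^ (2 * k)) has_field_derivative j ^ (2 * k) * (\<kappa> * (of_nat (2 * k) * h))) (at \<tau>)"
    proof -
      have "((\<lambda>t. v t ^ (2 * k)) has_field_derivative of_nat (2 * k) * (of_int c * v \<tau> ^ (2 * k - Suc 0))) (at \<tau>)"
        by (rule DERIV_power[OF dv])
      moreover have "of_nat (2 * k) * (of_int c * v \<tau> ^ (2 * k - Suc 0)) = j ^ (2 * k) * (\<kappa> * (of_nat (2 * k) * h))"
      \<comment> \<open>The exponent \<open>2 * k - 1\<close> is truncated for \<open>k = 0\<close>,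
        where both sides vanish.\<close>
      proof (cases "k = 0")
        case False
        then have "j ^ (2 * k) = j * j ^ (2 * k - Suc 0)" by (simp flip: power_Suc)
        then show ?thesis unfolding v\<tau> h_def using j \<kappa> by (simp add: field_simps)
      qed simp
      ultimately show ?thesis by (simp only:)
    qed
    have dee: "((\<lambda>t. ee (of_nat m * of_int c * z ^ 2 / v t)) has_field_derivative
        \<kappa> * (- of_nat m * (s z)\<^sup>2) * ee (of_nat m * of_int c * z ^ 2 / v \<tau>)) (at \<tau>)"
      using j v\<tau> by (auto intro!: derivative_eq_intros dv simp: s_def field_simps power2_eq_square)
    have \<theta>: "(\<theta> has_field_derivative \<phi> z * \<kappa> * (of_nat (2 * k) * h - of_nat m * (s z)\<^sup>2)) (at \<tau>)"
      unfolding \<theta>_def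
      by (rule DERIV_cong[OF DERIV_mult[OF dpow dee]]) (simp add: v\<tau> \<phi>_def algebra_simps)
    have dp: "((\<lambda>t. z / v t) has_field_derivative - (s z / j)) (at \<tau>)"
      using j v\<tau> by (auto intro!: derivative_eq_intros dv simp: s_def)
    have "((\<lambda>t. (of_int a * t + of_int b) / v t) has_field_derivative
        (of_int a * j - (of_int a * \<tau> + of_int b) * of_int c) / (j * j)) (at \<tau>)"
      using j v\<tau> by (auto intro!: derivative_eq_intros dv)
    moreover have "of_int a * j - (of_int a * \<tau> + of_int b) * of_int c = 1"
      using det' by (simp add: j_def algebra_simps)
    ultimately have dq: "((\<lambda>t. (of_int a * t + of_int b) / v t) has_field_derivative 1 / (j * j)) (at \<tau>)"
      by simp
    have "((\<lambda>t. F (z / v t) ((of_int a * t + of_int b) / v t)) has_field_derivative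
        \<kappa> * (dz F (z / v \<tau>) ((of_int a * \<tau> + of_int b) / v \<tau>) * - (s z / j)
         + dtau F (z / v \<tau>) ((of_int a * \<tau> + of_int b) / v \<tau>) * (1 / (j * j)))) (at \<tau>)"
      by (rule DERIV_F_comp[OF _ dp dq]) (use Im_\<tau>' in \<open>simp add: v\<tau> \<tau>'_def\<close>)
    then have "((\<lambda>t. F (z / v t) ((of_int a * t + of_int b) / v t)) has_field_derivative
        \<kappa> * (dz F (z / j) \<tau>' * - (s z / j) + dtau F (z / j) \<tau>' * (1 / (j * j)))) (at \<tau>)"
      unfolding v\<tau> \<tau>'_def .
    moreover have "((\<lambda>t. F (z / v t) ((of_int a * t + of_int b) / v t)) has_field_derivative
        \<phi> z * \<kappa> * (of_nat (2 * k) * h - of_nat m * (s z)\<^sup>2) * F z \<tau> + \<kappa> * dtau F z \<tau> * \<theta> \<tau>) (at \<tau>)"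
    proof -
      have ev: "\<forall>\<^sub>F t in nhds \<tau>. \<theta> t * F z t = F (z / v t) ((of_int a * t + of_int b) / v t)"
        using eventually_nhds_in_open[OF open_upper_half_plane, of \<tau>] \<tau>
        by (auto elim!: eventually_mono simp: F_modular[OF det] \<theta>_def v_def)
      show ?thesis
        by (rule DERIV_cong_ev[OF refl ev refl, THEN iffD1, OF DERIV_mult[OF \<theta> DERIV_tau[OF \<tau>]]])
    qed
    ultimately have "\<kappa> * (dz F (z / j) \<tau>' * - (s z / j) + dtau F (z / j) \<tau>' * (1 / (j * j))) =
        \<phi> z * \<kappa> * (of_nat (2 * k) * h - of_nat m * (s z)\<^sup>2) * F z \<tau> + \<kappa> * dtau F z \<tau> * \<theta> \<tau>"
      by (rule DERIV_unique)
    also have "\<dots> = \<kappa> * (\<phi> z * (dtau F z \<tau> + (of_nat (2 * k) * h - of_nat m * (s z)\<^sup>2) * F z \<tau>))"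
      unfolding \<theta>\<tau> by (simp add: algebra_simps)
    finally have "dz F (z / j) \<tau>' * - (s z / j) + dtau F (z / j) \<tau>' * (1 / (j * j)) =
        \<phi> z * (dtau F z \<tau> + (of_nat (2 * k) * h - of_nat m * (s z)\<^sup>2) * F z \<tau>)"
      using \<kappa> by (simp only: mult_cancel_left) simp
    then have "dtau F (z / j) \<tau>' = j * j * (\<phi> z * (dtau F z \<tau> + (of_nat (2 * k) * h - of_nat m * (s z)\<^sup>2) * F z \<tau>))
        + j * s z * dz F (z / j) \<tau>'"
      using j by (simp add: field_simps)
    then show ?thesis unfolding 1 by (simp add: algebra_simps power2_eq_square)
  qed
qed

lemma P_modular:
  assumes det: "a * d - b * c = 1" and \<tau>: "Im \<tau> > 0" and z: "z \<notin> lattice \<tau>"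
  defines "j \<equiv> of_int c * \<tau> + of_int d"
  shows "P (z / j) ((of_int a * \<tau> + of_int b) / j) =
    j ^ (2 * k + 2) * ee (of_nat m * of_int c * z ^ 2 / j) * P z \<tau>"
proof -
  define \<tau>' where "\<tau>' = (of_int a * \<tau> + of_int b) / j"
  interpret modular_matrix a b c d \<tau> j \<tau>'
    by unfold_locales (simp_all add: det \<tau> j_def \<tau>'_def)
  define h where "h = of_int c / (\<kappa> * j)"
  define s where "s = of_int c * z / j"
  define \<phi> where "\<phi> = j ^ (2 * k) * ee (of_nat m * of_int c * z ^ 2 / j)"
  have z': "z / j \<notin> lattice \<tau>'" using z lattice_divide_iff by simp
  have q: "1 / (1 - 4 * of_nat m) * (1 - 4 * of_nat m) = (1 :: complex)"
    using four_m_nz by simp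
  have A: "jA \<tau>' (z / j) = j * (jA \<tau> z + s)"
    using jA_modular[OF z] j_nz by (simp add: s_def field_simps)
  have A': "1 / \<kappa> * deriv (jA \<tau>') (z / j) = j\<^sup>2 * (1 / \<kappa> * deriv (jA \<tau>) z + h)"
    using deriv_jA_modular[OF z] j_nz by (simp add: h_def field_simps power2_eq_square)
  have E: "E2 \<tau>' = j\<^sup>2 * (E2 \<tau> + 12 * h)"
  proof -
    have "12 * of_int c * j / \<kappa> = j\<^sup>2 * (12 * h)"
      using j_nz by (simp add: h_def power2_eq_square)
    then show ?thesis unfolding E2_modular by (simp add: ring_distribs)
  qed
  have F': "F (z / j) \<tau>' = \<phi> * F z \<tau>"
    using F_modular[OF det \<tau>, of z] by (simp add: j_def \<tau>'_def \<phi>_def)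
  have dF: "dz F (z / j) \<tau>' = \<phi> * j * (dz F z \<tau> + 2 * of_nat m * s * F z \<tau>)"
    using dz_modular[OF det \<tau>, of z] unfolding \<phi>_def s_def \<tau>'_def j_def .
  have ddF: "dz (dz F) (z / j) \<tau>' = \<phi> * j\<^sup>2 * (dz (dz F) z \<tau> + 4 * of_nat m * s * dz F z \<tau>
      + (4 * (of_nat m)\<^sup>2 * s\<^sup>2 + 2 * of_nat m * h) * F z \<tau>)"
    using dz_dz_modular[OF det \<tau>, of z] unfolding \<phi>_def s_def \<tau>'_def j_def h_def .
  have tF: "dtau F (z / j) \<tau>' = \<phi> * j\<^sup>2 * (dtau F z \<tau> + s * dz F z \<tau>
      + (of_nat (2 * k) * h + of_nat m * s\<^sup>2) * F z \<tau>)"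
    using dtau_modular[OF det \<tau>, of z] unfolding \<phi>_def s_def \<tau>'_def j_def h_def .
  have "P (z / j) \<tau>' = \<phi> * j\<^sup>2 * P z \<tau>"
    unfolding P_eq[OF Im_\<tau>' z'] P_eq[OF \<tau> z] A A' E F' dF ddF tF
    by (rule modular_identity[OF q])
  then show ?thesis by (simp add: \<phi>_def \<tau>'_def power_add power2_eq_square mult_ac)
qed


section \<open>Extension across the lattice points\<close>

text \<open>The modular law for minus the identity matrix, whose factor
  \<open>(-1) ^ (2 * k)\<close> is \<open>1\<close>.\<close>

lemma F_minus: "Im \<tau> > 0 \<Longrightarrow> F (- z) \<tau> = F z \<tau>"
  using F_modular[of "-1" "-1" 0 0 \<tau> z] by (simp add: power_mult)

lemma dz_0: 
  assumes \<tau>: "Im \<tau> > 0"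
  shows "dz F 0 \<tau> = 0"
proof -
  have "((\<lambda>z. F (- z) \<tau>) has_field_derivative \<kappa> * dz F (- 0) \<tau> * - 1) (at 0)"
    by (rule DERIV_chain2[OF DERIV_F[OF \<tau>]]) (auto intro!: derivative_eq_intros)
  then have "\<kappa> * dz F (- 0) \<tau> * - 1 = \<kappa> * dz F 0 \<tau>"
    using DERIV_unique[OF _ DERIV_F[OF \<tau>, of 0]] by (simp only: F_minus[OF \<tau>])
  then have "\<kappa> * dz F 0 \<tau> = 0" by simp
  then show ?thesis by simp
qed

text \<open>Since \<open>dz F\<close> vanishes at \<open>0\<close>, its product with the pole of
  \<open>A\<close> tends to \<open>dz (dz F) 0 \<tau>\<close> and cancels the second derivative; the
  \<open>J_2\<close> and \<open>E_2\<close> terms cancel by \<open>jB_0\<close>. The whole bracket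
  disappears, leaving the Serre derivative of the restriction.\<close>

lemma P_tendsto_0:
  assumes \<tau>: "Im \<tau> > 0"
  shows "(\<lambda>z. P z \<tau>) \<midarrow>0\<rightarrow> dtau F 0 \<tau> - of_nat (2 * k) / 12 * E2 \<tau> * F 0 \<tau>"
proof -
  obtain Y r where Y: "r > 0" "Y holomorphic_on ball 0 r"
    "\<And>z. z \<in> ball 0 r - {0} \<Longrightarrow> z \<notin> lattice \<tau> \<and> jA \<tau> z = 1 / (\<kappa> * z) + \<kappa> * z * Y z"
    by (rule jA_local[OF \<tau>]) blast
  have tY: "Y \<midarrow>0\<rightarrow> Y 0" using Y(1,2)
    by (intro isContD) (auto simp: continuous_on_eq_continuous_at dest!: holomorphic_on_imp_continuous_on)
  have tB: "jB \<tau> \<midarrow>0\<rightarrow> jB \<tau> 0"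
    by (intro isContD analytic_at_imp_isCont jB_analytic_strip) (use \<tau> in auto)
  have t: "(\<lambda>z. F z \<tau>) \<midarrow>0\<rightarrow> F 0 \<tau>" "(\<lambda>z. dz F z \<tau>) \<midarrow>0\<rightarrow> dz F 0 \<tau>"
    "(\<lambda>z. dz (dz F) z \<tau>) \<midarrow>0\<rightarrow> dz (dz F) 0 \<tau>" "(\<lambda>z. dtau F z \<tau>) \<midarrow>0\<rightarrow> dtau F 0 \<tau>"
    by (rule isContD, rule DERIV_isCont, rule DERIV_F[OF \<tau>] DERIV_dz[OF \<tau>] DERIV_dz_dz[OF \<tau>] DERIV_dtau[OF \<tau>])+
  have "(\<lambda>z. dz F z \<tau> / z) \<midarrow>0\<rightarrow> \<kappa> * dz (dz F) 0 \<tau>"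
    using DERIV_dz[OF \<tau>, of 0] by (simp add: has_field_derivative_iff dz_0[OF \<tau>])
  then have "(\<lambda>z. dtau F z \<tau> - of_nat (2 * k) / 12 * E2 \<tau> * F z \<tau> + 1 / (1 - 4 * of_nat m) *
      (dz (dz F) z \<tau> - (1 / \<kappa> * (dz F z \<tau> / z) + \<kappa> * z * Y z * dz F z \<tau>)
       + of_nat m * jB \<tau> z * F z \<tau> - of_nat m / 6 * E2 \<tau> * F z \<tau>)) \<midarrow>0\<rightarrow>
      dtau F 0 \<tau> - of_nat (2 * k) / 12 * E2 \<tau> * F 0 \<tau> + 1 / (1 - 4 * of_nat m) *
      (dz (dz F) 0 \<tau> - (1 / \<kappa> * (\<kappa> * dz (dz F) 0 \<tau>) + \<kappa> * 0 * Y 0 * dz F 0 \<tau>)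
       + of_nat m * jB \<tau> 0 * F 0 \<tau> - of_nat m / 6 * E2 \<tau> * F 0 \<tau>)"
    by (intro tendsto_intros t tY tB)
  moreover have "dtau F 0 \<tau> - of_nat (2 * k) / 12 * E2 \<tau> * F 0 \<tau> + 1 / (1 - 4 * of_nat m) *
      (dz (dz F) 0 \<tau> - (1 / \<kappa> * (\<kappa> * dz (dz F) 0 \<tau>) + \<kappa> * 0 * Y 0 * dz F 0 \<tau>)
       + of_nat m * jB \<tau> 0 * F 0 \<tau> - of_nat m / 6 * E2 \<tau> * F 0 \<tau>) =
      dtau F 0 \<tau> - of_nat (2 * k) / 12 * E2 \<tau> * F 0 \<tau>"
    by (simp add: jB_0[OF \<tau>])
  ultimately have "(\<lambda>z. dtau F z \<tau> - of_nat (2 * k) / 12 * E2 \<tau> * F z \<tau> + 1 / (1 - 4 * of_nat m) *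
      (dz (dz F) z \<tau> - (1 / \<kappa> * (dz F z \<tau> / z) + \<kappa> * z * Y z * dz F z \<tau>)
       + of_nat m * jB \<tau> z * F z \<tau> - of_nat m / 6 * E2 \<tau> * F z \<tau>)) \<midarrow>0\<rightarrow>
      dtau F 0 \<tau> - of_nat (2 * k) / 12 * E2 \<tau> * F 0 \<tau>"
    by (simp only:)
  moreover have "\<forall>\<^sub>F z in at 0. P z \<tau> = dtau F z \<tau> - of_nat (2 * k) / 12 * E2 \<tau> * F z \<tau> + 1 / (1 - 4 * of_nat m) *
      (dz (dz F) z \<tau> - (1 / \<kappa> * (dz F z \<tau> / z) + \<kappa> * z * Y z * dz F z \<tau>)
       + of_nat m * jB \<tau> z * F z \<tau> - of_nat m / 6 * E2 \<tau> * F z \<tau>)"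
  proof -
    have "\<forall>\<^sub>F z in at 0. z \<in> ball 0 r" using Y(1) by (intro eventually_at_in_open') auto
    then show ?thesis using eventually_neq_at_within[of 0 0 UNIV]
    proof eventually_elim
      case (elim z)
      then have z: "z \<notin> lattice \<tau>" "jA \<tau> z = 1 / (\<kappa> * z) + \<kappa> * z * Y z" using Y(3) by blast+
      have "jA \<tau> z * dz F z \<tau> = 1 / \<kappa> * (dz F z \<tau> / z) + \<kappa> * z * Y z * dz F z \<tau>"
        unfolding z(2) by (simp add: ring_distribs)
      then show ?case
        unfolding jacobi_serre_formula_def J1_eq_jA[OF \<tau> z(1)] J2_eq_jB[OF \<tau> z(1)] by (simp only:)
    qed
  qed
  ultimately show ?thesis using tendsto_cong by fastforce
qed

lemma P_analytic:
  assumes \<tau>: "Im \<tau> > 0" and z: "z \<notin> lattice \<tau>"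
  shows "(\<lambda>z. P z \<tau>) analytic_on {z}"
proof -
  have entire: "f analytic_on {z}" if "\<And>z. (f has_field_derivative f' z) (at z)" for f f' :: "complex \<Rightarrow> complex"
  proof -
    have "f holomorphic_on UNIV"
      unfolding holomorphic_on_def field_differentiable_def using that by blast
    then show ?thesis using analytic_at by blast
  qed
  have a: "(\<lambda>z. F z \<tau>) analytic_on {z}" "(\<lambda>z. dz F z \<tau>) analytic_on {z}"
    "(\<lambda>z. dz (dz F) z \<tau>) analytic_on {z}" "(\<lambda>z. dtau F z \<tau>) analytic_on {z}"
    by (rule entire, rule DERIV_F[OF \<tau>] DERIV_dz[OF \<tau>] DERIV_dz_dz[OF \<tau>] DERIV_dtau[OF \<tau>])+
  have "(\<lambda>z. J 1 z \<tau>) analytic_on {z}" "(\<lambda>z. J 2 z \<tau>) analytic_on {z}"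
    using remove_sings_analytic_on[OF jA_analytic[OF \<tau> z]] remove_sings_analytic_on[OF jB_analytic[OF \<tau> z]]
    by (simp_all only: J1_eq[OF \<tau>] J2_eq[OF \<tau>])
  then show ?thesis unfolding jacobi_serre_formula_def
    by (intro analytic_intros a) (use four_m_nz in auto)
qed

lemma G_eq_P:
  assumes "Im \<tau> > 0" "z \<notin> lattice \<tau>"
  shows "G z \<tau> = P z \<tau>"
  using assms J1_is_pole_iff[of \<tau> z] by (simp add: jacobi_serre_deriv_def)

text \<open>\<open>Lim\<close> has the intended meaning only if the limit exists. At a lattice point
  it does because the elliptic law carries the limit at \<open>0\<close> there.\<close>

lemma P_tendsto_G:
  assumes \<tau>: "Im \<tau> > 0"
  shows "(\<lambda>z. P z \<tau>) \<midarrow>z\<rightarrow> G z \<tau>"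
proof (cases "z \<in> lattice \<tau>")
  case False
  then show ?thesis
    using analytic_at_imp_isCont[OF P_analytic[OF \<tau> False]] G_eq_P[OF \<tau> False] by (simp add: isCont_def)
next
  case True
  then obtain l u where z: "z = of_int l * \<tau> + of_int u" by (auto simp: lattice_def)
  let ?\<psi> = "\<lambda>w. ee (- of_nat m * (of_int l ^ 2 * \<tau> + 2 * of_int l * w))"
  let ?L = "?\<psi> 0 * (dtau F 0 \<tau> - of_nat (2 * k) / 12 * E2 \<tau> * F 0 \<tau>)"
  have "(\<lambda>w. ?\<psi> w * P w \<tau>) \<midarrow>0\<rightarrow> ?L"
    by (intro tendsto_intros P_tendsto_0[OF \<tau>])
  moreover have "\<forall>\<^sub>F w in at 0. P (w + z) \<tau> = ?\<psi> w * P w \<tau>"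
    using eventually_not_lattice[OF \<tau>, of 0]
    by eventually_elim (use P_elliptic[OF \<tau>] in \<open>simp add: z add.assoc\<close>)
  ultimately have "(\<lambda>w. P (w + z) \<tau>) \<midarrow>0\<rightarrow> ?L" using tendsto_cong by fastforce
  then have "(\<lambda>w. P w \<tau>) \<midarrow>z\<rightarrow> ?L" using LIM_offset_zero_iff[where f = "\<lambda>w. P w \<tau>" and a = z] by (simp add: add.commute)
  moreover from this have "Lim (at z) (\<lambda>w. P w \<tau>) = ?L" by (rule tendsto_Lim[OF trivial_limit_at])
  ultimately show ?thesis using True J1_is_pole_iff[OF \<tau>] by (simp add: jacobi_serre_deriv_def)
qed

lemma G_holomorphic:
  assumes \<tau>: "Im \<tau> > 0"
  shows "(\<lambda>z. G z \<tau>) holomorphic_on UNIV"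
proof -
  have "(\<lambda>z. G z \<tau>) analytic_on {z}" for z
  proof -
    have ev: "\<forall>\<^sub>F w in at z. P w \<tau> = G w \<tau>"
      using eventually_not_lattice[OF \<tau>, of z] by eventually_elim (use G_eq_P[OF \<tau>] in simp)
    obtain r where r: "r > 0" "\<And>w. w \<noteq> z \<Longrightarrow> dist w z < r \<Longrightarrow> w \<notin> lattice \<tau>"
      using eventually_not_lattice[OF \<tau>, of z] unfolding eventually_at by blast
    then have "(\<lambda>w. P w \<tau>) analytic_on ball z r - {z}"
      by (subst analytic_on_analytic_at) (auto intro!: P_analytic[OF \<tau>] simp: dist_commute)
    then have "isolated_singularity_at (\<lambda>w. P w \<tau>) z" using r unfolding isolated_singularity_at_def by blast
    from removable_singularity'[OF this P_tendsto_G[OF \<tau>]]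
    have "(\<lambda>y. if y = z then G z \<tau> else P y \<tau>) analytic_on {z}" .
    moreover have "\<forall>\<^sub>F y in nhds z. (if y = z then G z \<tau> else P y \<tau>) = G y \<tau>"
      using ev unfolding eventually_nhds_conv_at by (auto elim: eventually_mono)
    ultimately show ?thesis
      using analytic_at_cong[of "\<lambda>y. if y = z then G z \<tau> else P y \<tau>" "\<lambda>y. G y \<tau>" z z] by simp
  qed
  then have "(\<lambda>z. G z \<tau>) analytic_on UNIV" using analytic_on_analytic_at by blast
  then show ?thesis by (simp add: analytic_on_open)
qed

text \<open>Both sides are limits of expressions in \<open>P\<close> that agree on a punctured
  neighbourhood of \<open>z\<close>; the modular law below is passed to \<open>G\<close> in the same
  way.\<close>

lemma G_elliptic:
  assumes \<tau>: "Im \<tau> > 0"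
  shows "G (z + of_int l * \<tau> + of_int u) \<tau> =
    ee (- of_nat m * (of_int l ^ 2 * \<tau> + 2 * of_int l * z)) * G z \<tau>"
proof -
  let ?\<psi> = "\<lambda>w. ee (- of_nat m * (of_int l ^ 2 * \<tau> + 2 * of_int l * w))"
  have 1: "(\<lambda>w. P (w + (of_int l * \<tau> + of_int u)) \<tau>) \<midarrow>z\<rightarrow> G (z + of_int l * \<tau> + of_int u) \<tau>"
    using LIM_offset[OF P_tendsto_G[OF \<tau>, of "z + of_int l * \<tau> + of_int u"], of "of_int l * \<tau> + of_int u"]
    by (simp add: add.assoc)
  have "(\<lambda>w. ?\<psi> w * P w \<tau>) \<midarrow>z\<rightarrow> ?\<psi> z * G z \<tau>"
    by (intro tendsto_intros P_tendsto_G[OF \<tau>])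
  moreover have "\<forall>\<^sub>F w in at z. P (w + (of_int l * \<tau> + of_int u)) \<tau> = ?\<psi> w * P w \<tau>"
    using eventually_not_lattice[OF \<tau>, of z]
    by eventually_elim (use P_elliptic[OF \<tau>] in \<open>simp add: add.assoc\<close>)
  ultimately have "(\<lambda>w. P (w + (of_int l * \<tau> + of_int u)) \<tau>) \<midarrow>z\<rightarrow> ?\<psi> z * G z \<tau>"
    using tendsto_cong by fastforce
  from LIM_unique[OF 1 this] show ?thesis .
qed

lemma G_modular:
  assumes det: "a * d - b * c = 1" and \<tau>: "Im \<tau> > 0"
  defines "j \<equiv> of_int c * \<tau> + of_int d"
  shows "G (z / j) ((of_int a * \<tau> + of_int b) / j) =
    j ^ (2 * k + 2) * ee (of_nat m * of_int c * z ^ 2 / j) * G z \<tau>"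
proof -
  define \<tau>' where "\<tau>' = (of_int a * \<tau> + of_int b) / j"
  interpret modular_matrix a b c d \<tau> j \<tau>'
    by unfold_locales (simp_all add: det \<tau> j_def \<tau>'_def)
  let ?\<phi> = "\<lambda>z. j ^ (2 * k + 2) * ee (of_nat m * of_int c * z ^ 2 / j)"
  have "((\<lambda>w. w / j) \<longlongrightarrow> z / j) (at z)" by (intro tendsto_intros j_nz)
  moreover have "\<forall>\<^sub>F w in at z. w / j \<noteq> z / j"
    using eventually_neq_at_within[of z z UNIV] by eventually_elim (use j_nz in auto)
  ultimately have "filterlim (\<lambda>w. w / j) (at (z / j)) (at z)" by (simp add: filterlim_at)
  from filterlim_compose[OF P_tendsto_G[OF Im_\<tau>'] this]
  have 1: "(\<lambda>w. P (w / j) \<tau>') \<midarrow>z\<rightarrow> G (z / j) \<tau>'" .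
  have "(\<lambda>w. ?\<phi> w * P w \<tau>) \<midarrow>z\<rightarrow> ?\<phi> z * G z \<tau>"
    by (intro tendsto_intros P_tendsto_G[OF \<tau>] j_nz)
  moreover have "\<forall>\<^sub>F w in at z. P (w / j) \<tau>' = ?\<phi> w * P w \<tau>"
    using eventually_not_lattice[OF \<tau>, of z]
    by eventually_elim (use P_modular[OF det \<tau>] in \<open>simp add: \<tau>'_def j_def\<close>)
  ultimately have "(\<lambda>w. P (w / j) \<tau>') \<midarrow>z\<rightarrow> ?\<phi> z * G z \<tau>"
    using tendsto_cong by fastforce
  from LIM_unique[OF 1 this] show ?thesis by (simp only: \<tau>'_def)
qed

text \<open>The strip expansion of \<open>P\<close> is one of \<open>G\<close>, because the open
  strip avoids the lattice. Its extension to all \<open>z\<close> gives both the Fourier condition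
  and joint holomorphy.\<close>

lemma G_jacobi_form: "jacobi_form (2 * k + 2) m G"
proof -
  have "expands (real m) G"
    using expands_P by (rule expands_cong) (use G_eq_P not_lattice_strip in simp)
  then obtain c where c: "\<And>n r. c (n, r) \<noteq> 0 \<Longrightarrow> r\<^sup>2 \<le> 4 * n * int m \<and> 0 \<le> n"
    "\<And>z \<tau>. Im \<tau> > 0 \<Longrightarrow> (fourier_term c z \<tau> has_sum G z \<tau>) UNIV"
    using fourier_expansion_extends[OF _ G_holomorphic G_elliptic] by blast
  then have "jacobi_fourier m c G" unfolding jacobi_fourier_def by blast
  moreover have "holomorphic2_on G (UNIV \<times> upper_half_plane)"
    by (rule fourier_holomorphic2[OF c(2)])
  ultimately show ?thesis
    unfolding jacobi_form_def jacobi_fourier_iff[symmetric]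
    using G_modular G_elliptic by blast
qed

lemma G_0: "Im \<tau> > 0 \<Longrightarrow> G 0 \<tau> = serre_deriv (2 * k) (\<lambda>t. F 0 t) \<tau>"
  using LIM_unique[OF P_tendsto_G P_tendsto_0] by (simp add: serre_deriv_def dtau_def)

end

section \<open>Linearity\<close>

lemma jacobi_form_linear:
  assumes "jacobi_form w m F" "jacobi_form w m H"
  shows "jacobi_form w m (\<lambda>z \<tau>. \<alpha> * F z \<tau> + \<beta> * H z \<tau>)"
proof -
  have "holomorphic2_on (\<lambda>z \<tau>. \<alpha> * F z \<tau> + \<beta> * H z \<tau>) (UNIV \<times> upper_half_plane)"
    unfolding holomorphic2_on_def
  proof
    fix x assume x: "x \<in> (UNIV :: complex set) \<times> upper_half_plane"
    have hol: "holomorphic2_on F (UNIV \<times> upper_half_plane)" "holomorphic2_on H (UNIV \<times> upper_half_plane)"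
      using assms unfolding jacobi_form_def by simp_all
    obtain a b where d1: "((\<lambda>(z, \<tau>). F z \<tau>) has_derivative (\<lambda>(u, v). a * u + b * v)) (at x)"
      using hol(1) x unfolding holomorphic2_on_def by blast
    obtain a' b' where d2: "((\<lambda>(z, \<tau>). H z \<tau>) has_derivative (\<lambda>(u, v). a' * u + b' * v)) (at x)"
      using hol(2) x unfolding holomorphic2_on_def by blast
    have "((\<lambda>y. \<alpha> * (\<lambda>(z, \<tau>). F z \<tau>) y + \<beta> * (\<lambda>(z, \<tau>). H z \<tau>) y) has_derivative
       (\<lambda>y. \<alpha> * (\<lambda>(u, v). a * u + b * v) y + \<beta> * (\<lambda>(u, v). a' * u + b' * v) y)) (at x)"
      by (intro has_derivative_add has_derivative_mult_right d1 d2)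
    moreover have "(\<lambda>y. \<alpha> * (\<lambda>(u, v). a * u + b * v) y + \<beta> * (\<lambda>(u, v). a' * u + b' * v) y) =
       (\<lambda>(u, v). (\<alpha> * a + \<beta> * a') * u + (\<alpha> * b + \<beta> * b') * v)"
      by (auto simp: fun_eq_iff algebra_simps)
    ultimately show "\<exists>a b. ((\<lambda>(z, \<tau>). \<alpha> * F z \<tau> + \<beta> * H z \<tau>) has_derivative (\<lambda>(u, v). a * u + b * v)) (at x)"
      by (intro exI[of _ "\<alpha> * a + \<beta> * a'"] exI[of _ "\<alpha> * b + \<beta> * b'"]) (simp add: case_prod_beta')
  qed
  moreover have "\<exists>c. jacobi_fourier m c (\<lambda>z \<tau>. \<alpha> * F z \<tau> + \<beta> * H z \<tau>)"
  proof -
    have "\<exists>c. jacobi_fourier m c F" "\<exists>d. jacobi_fourier m d H"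
      using assms unfolding jacobi_form_def jacobi_fourier_iff by simp_all
    then obtain c d where cd: "jacobi_fourier m c F" "jacobi_fourier m d H" by blast
    have "(fourier_term (\<lambda>x. \<alpha> * c x + \<beta> * d x) z \<tau> has_sum \<alpha> * F z \<tau> + \<beta> * H z \<tau>) UNIV" if "Im \<tau> > 0" for z \<tau>
    proof -
      have "((\<lambda>x. \<alpha> * fourier_term c z \<tau> x + \<beta> * fourier_term d z \<tau> x) has_sum \<alpha> * F z \<tau> + \<beta> * H z \<tau>) UNIV"
        using cd that unfolding jacobi_fourier_def by (intro has_sum_add has_sum_cmult_right) auto
      then show ?thesis by (simp add: fourier_term_def[abs_def] algebra_simps)
    qed
    moreover have "r\<^sup>2 \<le> 4 * n * int m \<and> 0 \<le> n" if "\<alpha> * c (n, r) + \<beta> * d (n, r) \<noteq> 0" for n r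
    proof -
      have "c (n, r) \<noteq> 0 \<or> d (n, r) \<noteq> 0" using that by auto
      then show ?thesis using cd unfolding jacobi_fourier_def by blast
    qed
    ultimately have "jacobi_fourier m (\<lambda>x. \<alpha> * c x + \<beta> * d x) (\<lambda>z \<tau>. \<alpha> * F z \<tau> + \<beta> * H z \<tau>)"
      unfolding jacobi_fourier_def by blast
    then show ?thesis by blast
  qed
  moreover have "x * (\<alpha> * y + \<beta> * y') = \<alpha> * (x * y) + \<beta> * (x * y')" for x y y' :: complex
    by (simp add: algebra_simps)
  ultimately show ?thesis
    using assms unfolding jacobi_form_def jacobi_fourier_iff[symmetric] by simp
qed

lemma jacobi_serre_formula_linear:
  assumes F: "jacobi_form (2 * k) m F" and H: "jacobi_form (2 * k) m H" and \<tau>: "Im \<tau> > 0"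
  shows "jacobi_serre_formula (2 * k) m (\<lambda>z \<tau>. \<alpha> * F z \<tau> + \<beta> * H z \<tau>) z \<tau> =
    \<alpha> * jacobi_serre_formula (2 * k) m F z \<tau> + \<beta> * jacobi_serre_formula (2 * k) m H z \<tau>"
proof -
  interpret F: even_jacobi_form k m F by unfold_locales (rule F)
  interpret H: even_jacobi_form k m H by unfold_locales (rule H)
  let ?L = "\<lambda>z \<tau>. \<alpha> * F z \<tau> + \<beta> * H z \<tau>"
  have 1: "dz ?L z \<tau> = \<alpha> * dz F z \<tau> + \<beta> * dz H z \<tau>" for z
    using DERIV_imp_deriv[OF DERIV_add[OF DERIV_cmult[OF F.DERIV_F[OF \<tau>, of z], of \<alpha>] DERIV_cmult[OF H.DERIV_F[OF \<tau>, of z], of \<beta>]]]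
    by (simp add: dz_def[of ?L] field_simps)
  have 2: "dz (dz ?L) z \<tau> = \<alpha> * dz (dz F) z \<tau> + \<beta> * dz (dz H) z \<tau>"
    using DERIV_imp_deriv[OF DERIV_add[OF DERIV_cmult[OF F.DERIV_dz[OF \<tau>, of z], of \<alpha>] DERIV_cmult[OF H.DERIV_dz[OF \<tau>, of z], of \<beta>]]]
    by (simp add: dz_def[of "dz ?L"] 1 field_simps)
  have 3: "dtau ?L z \<tau> = \<alpha> * dtau F z \<tau> + \<beta> * dtau H z \<tau>"
    using DERIV_imp_deriv[OF DERIV_add[OF DERIV_cmult[OF F.DERIV_tau[OF \<tau>, of z], of \<alpha>] DERIV_cmult[OF H.DERIV_tau[OF \<tau>, of z], of \<beta>]]]
    by (simp add: dtau_def[of ?L] field_simps)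
  show ?thesis unfolding jacobi_serre_formula_def 1 2 3 by (simp add: algebra_simps)
qed

text \<open>At lattice points \<open>Lim\<close> is additive only because both limits exist; writing
  every value as the limit of the formula treats these points together with the others.\<close>

lemma jacobi_serre_deriv_linear:
  assumes F: "jacobi_form (2 * k) m F" and H: "jacobi_form (2 * k) m H" and \<tau>: "Im \<tau> > 0"
  shows "jacobi_serre_deriv (2 * k) m (\<lambda>z \<tau>. \<alpha> * F z \<tau> + \<beta> * H z \<tau>) z \<tau> =
    \<alpha> * jacobi_serre_deriv (2 * k) m F z \<tau> + \<beta> * jacobi_serre_deriv (2 * k) m H z \<tau>"
proof -
  interpret F: even_jacobi_form k m F by unfold_locales (rule F)
  interpret H: even_jacobi_form k m H by unfold_locales (rule H)
  interpret L: even_jacobi_form k m "\<lambda>z \<tau>. \<alpha> * F z \<tau> + \<beta> * H z \<tau>"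
    by unfold_locales (rule jacobi_form_linear[OF F H])
  have "(\<lambda>z. \<alpha> * F.P z \<tau> + \<beta> * H.P z \<tau>) \<midarrow>z\<rightarrow> \<alpha> * F.G z \<tau> + \<beta> * H.G z \<tau>"
    by (intro tendsto_intros F.P_tendsto_G[OF \<tau>] H.P_tendsto_G[OF \<tau>])
  then have "(\<lambda>z. L.P z \<tau>) \<midarrow>z\<rightarrow> \<alpha> * F.G z \<tau> + \<beta> * H.G z \<tau>"
    unfolding jacobi_serre_formula_linear[OF F H \<tau>] .
  from LIM_unique[OF L.P_tendsto_G[OF \<tau>] this] show ?thesis .
qed

theorem theorem0p1:
  fixes k m :: nat
  shows "(\<forall>F. jacobi_form (2 * k) m F \<longrightarrow>
            jacobi_form (2 * k + 2) m (jacobi_serre_deriv (2 * k) m F)) \<and>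
         (\<forall>F G \<alpha> \<beta>. jacobi_form (2 * k) m F \<longrightarrow> jacobi_form (2 * k) m G \<longrightarrow>
            jacobi_form (2 * k) m (\<lambda>z \<tau>. \<alpha> * F z \<tau> + \<beta> * G z \<tau>) \<and>
            (\<forall>z. \<forall>\<tau>\<in>upper_half_plane.
               jacobi_serre_deriv (2 * k) m (\<lambda>z \<tau>. \<alpha> * F z \<tau> + \<beta> * G z \<tau>) z \<tau> =
               \<alpha> * jacobi_serre_deriv (2 * k) m F z \<tau> + \<beta> * jacobi_serre_deriv (2 * k) m G z \<tau>)) \<and>
         (\<forall>F. jacobi_form (2 * k) m F \<longrightarrow> (\<forall>\<tau>\<in>upper_half_plane.
            jacobi_serre_deriv (2 * k) m F 0 \<tau> = serre_deriv (2 * k) (\<lambda>t. F 0 t) \<tau>))"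
proof (intro conjI allI impI ballI)
  fix F assume "jacobi_form (2 * k) m F"
  then interpret even_jacobi_form k m F by unfold_locales
  show "jacobi_form (2 * k + 2) m (jacobi_serre_deriv (2 * k) m F)" by (rule G_jacobi_form)
  show "jacobi_serre_deriv (2 * k) m F 0 \<tau> = serre_deriv (2 * k) (\<lambda>t. F 0 t) \<tau>" if "\<tau> \<in> upper_half_plane" for \<tau>
    using that G_0 by simp
next
  fix F G \<alpha> \<beta> assume *: "jacobi_form (2 * k) m F" "jacobi_form (2 * k) m G"
  show "jacobi_form (2 * k) m (\<lambda>z \<tau>. \<alpha> * F z \<tau> + \<beta> * G z \<tau>)"
    by (rule jacobi_form_linear[OF *])
  show "jacobi_serre_deriv (2 * k) m (\<lambda>z \<tau>. \<alpha> * F z \<tau> + \<beta> * G z \<tau>) z \<tau> =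
      \<alpha> * jacobi_serre_deriv (2 * k) m F z \<tau> + \<beta> * jacobi_serre_deriv (2 * k) m G z \<tau>"
    if "\<tau> \<in> upper_half_plane" for z \<tau>
    using that by (intro jacobi_serre_deriv_linear[OF *]) simp
qed

end
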